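(* Let $X=X(Q,T_1,T_2,G_1,G_2)$ and $\tilde X=X(\tilde Q,\tilde T_1,\tilde T_2,\tilde G_1,\tilde G_2)$ be two boundary value problems of the form described in the context, with spectral data $\{\lambda_{nk},\alpha_{nk}\}_{(n,k)\in J}$ and $\{\tilde\lambda_{nk},\tilde\alpha_{nk}\}_{(n,k)\in\tilde J}$, respectively. If $J=\tilde J$ and $\lambda_{nk}=\tilde\lambda_{nk}$, $\alpha_{nk}=\tilde\alpha_{nk}$ for all $(n,k)\in J$, then $Q(x)=\tilde Q(x)$ a.e. on $(0,\pi)$, $T_1=\tilde T_1$, $T_2=\tilde T_2$, $G_1=\tilde G_1$, $G_2=\tilde G_2$.
   Context: Let $m\ge 1$; $\dagger$ denotes conjugate transpose and $I$ the unit $(m\times m)$-matrix. Let $Q\in L_1((0,\pi);\mathbb C^{m\times m})$ be Hermitian, $Q(x)=(Q(x))^\dagger$. Let $T_j,G_j\in\mathbb C^{m\times m}$, $j=1,2$, satisfy $T_j=T_j^\dagger=T_j^2$, $T_j^\perp:=I-T_j$, $G_j=G_j^\dagger=T_jG_jT_j$. Denote $$V_1(Y):=T_1(Y'(0)-G_1Y(0))-T_1^\perp Y(0),\quad V_2(Y):=T_2(Y'(\pi)-G_2Y(\pi))-T_2^\perp Y(\pi),\quad V_1^\perp(Y):=T_1^\perp Y'(0)+T_1Y(0).$$ $X=X(Q,T_1,T_2,G_1,G_2)$ is the boundary value problem $-Y''+Q(x)Y=\lambda Y$ on $(0,\pi)$, $V_1(Y)=V_2(Y)=0$ (solutions have $Y,Y'$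 absolutely continuous on $[0,\pi]$). Spectral data: let $p^\perp:=\dim(\operatorname{Ker}T_1\cap\operatorname{Ker}T_2)$ and $J:=\{(n,k)\colon n\in\mathbb N,\ k=1,\dots,m\}\cup\{(0,k)\colon k=p^\perp+1,\dots,m\}$, ordered lexicographically, $\mathbb N=\{1,2,\dots\}$. The eigenvalues of $X$ are real and, counted with multiplicity (dimension of the space of eigenfunctions), are numbered as $\{\lambda_{nk}\}_{(n,k)\in J}$ in non-decreasing order. The Weyl solution $\Phi(x,\lambda)$ is the matrix solution of $-\Phi''+Q\Phi=\lambda\Phi$ with $V_1(\Phi)=I$, $V_2(\Phi)=0$; the Weyl matrix $M(\lambda):=V_1^\perp(\Phi)$ is meromorphic with simple poles at the eigenvalues of $X$; the weight matrices are $\alpha_{nk}:=\operatorname{Res}_{\lambda=\lambda_{nk}}M(\lambda)$. The spectral data of $X$ are $\{\lambda_{nk},\alpha_{nk}\}_{(n,k)\in J}$. Objects with a tilde are the analogous objects for $\tilde X$, which has the same $m$; $\tilde J$ is defined by $\tilde T_1,\tilde T_2$. *)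

theory Defs
  imports "HOL-Complex_Analysis.Complex_Analysis" "HOL-Library.Function_Algebras"
begin

definition conj_transpose :: "complex^'n^'m \<Rightarrow> complex^'m^'n"
  where "conj_transpose A = (\<chi> i j. cnj (A $ j $ i))"

(* D is a finite family of pairwise non-overlapping compact intervals, K = {Inf K..Sup K},
   inside {a..b}. *)
definition abs_continuous_on :: "real \<Rightarrow> real \<Rightarrow> (real \<Rightarrow> 'a::real_normed_vector) \<Rightarrow> bool"
  where "abs_continuous_on a b f \<longleftrightarrow>
    (\<forall>e>0. \<exists>d>0. \<forall>D. D division_of (\<Union>D) \<and> \<Union>D \<subseteq> {a..b} \<and> (\<Sum>K\<in>D. Sup K - Inf K) < d
       \<longrightarrow> (\<Sum>K\<in>D. norm (f (Sup K) - f (Inf K))) < e)"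

definition boundary_value_problem ::
    "(real \<Rightarrow> complex^'m^'m) \<Rightarrow> complex^'m^'m \<Rightarrow> complex^'m^'m \<Rightarrow> complex^'m^'m \<Rightarrow> complex^'m^'m \<Rightarrow> bool"
  where "boundary_value_problem Q T1 T2 G1 G2 \<longleftrightarrow>
    Q absolutely_integrable_on {0<..<pi} \<and>
    (AE x in lebesgue_on {0<..<pi}. Q x = conj_transpose (Q x)) \<and>
    T1 = conj_transpose T1 \<and> T1 = T1 ** T1 \<and>
    T2 = conj_transpose T2 \<and> T2 = T2 ** T2 \<and>
    G1 = conj_transpose G1 \<and> G1 = T1 ** G1 ** T1 \<and>
    G2 = conj_transpose G2 \<and> G2 = T2 ** G2 ** T2"

(* Solutions of -Y'' + Q Y = lam Y, first vector-valued, then matrix-valued; DY is Y'.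
   Since Y' is continuous on [0,pi], Y is differentiable everywhere there (one-sidedly at the
   endpoints), whereas Y'' exists only almost everywhere. *)
definition vector_solution ::
    "(real \<Rightarrow> complex^'m^'m) \<Rightarrow> complex \<Rightarrow> (real \<Rightarrow> complex^'m) \<Rightarrow> (real \<Rightarrow> complex^'m) \<Rightarrow> bool"
  where "vector_solution Q lam Y DY \<longleftrightarrow>
    abs_continuous_on 0 pi Y \<and> abs_continuous_on 0 pi DY \<and>
    (\<forall>x\<in>{0..pi}. (Y has_vector_derivative DY x) (at x within {0..pi})) \<and>
    (AE x in lebesgue_on {0<..<pi}. \<exists>D2Y. (DY has_vector_derivative D2Y) (at x) \<and>
        - D2Y + Q x *v Y x = lam *s Y x)"

definition matrix_solution ::
    "(real \<Rightarrow> complex^'m^'m) \<Rightarrow> complex \<Rightarrow> (real \<Rightarrow> complex^'m^'m) \<Rightarrow> (real \<Rightarrow> complex^'m^'m) \<Rightarrow> bool"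
  where "matrix_solution Q lam Y DY \<longleftrightarrow>
    abs_continuous_on 0 pi Y \<and> abs_continuous_on 0 pi DY \<and>
    (\<forall>x\<in>{0..pi}. (Y has_vector_derivative DY x) (at x within {0..pi})) \<and>
    (AE x in lebesgue_on {0<..<pi}. \<exists>D2Y. (DY has_vector_derivative D2Y) (at x) \<and>
        - D2Y + Q x ** Y x = mat lam ** Y x)"

(* The boundary forms act on the values y = Y(p), dy = Y'(p) at an endpoint p:
   V1 is taken at p = 0 with T1, G1 and V2 at p = pi with T2, G2. *)
definition boundary_form_vector ::
    "complex^'m^'m \<Rightarrow> complex^'m^'m \<Rightarrow> complex^'m \<Rightarrow> complex^'m \<Rightarrow> complex^'m"
  where "boundary_form_vector T G y dy = T *v (dy - G *v y) - (mat 1 - T) *v y"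

definition boundary_form_matrix ::
    "complex^'m^'m \<Rightarrow> complex^'m^'m \<Rightarrow> complex^'m^'m \<Rightarrow> complex^'m^'m \<Rightarrow> complex^'m^'m"
  where "boundary_form_matrix T G y dy = T ** (dy - G ** y) - (mat 1 - T) ** y"

(* Functions on [0,pi] are represented by their extension by zero, so that the dimension
   of this subspace of real => complex^'m is the dimension of the space of eigenfunctions. *)
definition eigenspace ::
    "(real \<Rightarrow> complex^'m^'m) \<Rightarrow> complex^'m^'m \<Rightarrow> complex^'m^'m \<Rightarrow> complex^'m^'m \<Rightarrow> complex^'m^'m
      \<Rightarrow> complex \<Rightarrow> (real \<Rightarrow> complex^'m) set"
  where "eigenspace Q T1 T2 G1 G2 lam =
    {Y. (\<forall>x. x \<notin> {0..pi} \<longrightarrow> Y x = 0) \<and>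
        (\<exists>DY. vector_solution Q lam Y DY \<and>
          boundary_form_vector T1 G1 (Y 0) (DY 0) = 0 \<and>
          boundary_form_vector T2 G2 (Y pi) (DY pi) = 0)}"

(* Complex dimension; it is 0 exactly when lam is not an eigenvalue. *)
definition eigenvalue_multiplicity ::
    "(real \<Rightarrow> complex^'m^'m) \<Rightarrow> complex^'m^'m \<Rightarrow> complex^'m^'m \<Rightarrow> complex^'m^'m \<Rightarrow> complex^'m^'m
      \<Rightarrow> complex \<Rightarrow> nat"
  where "eigenvalue_multiplicity Q T1 T2 G1 G2 lam =
    vector_space.dim (\<lambda>(c::complex) (Y :: real \<Rightarrow> complex^'m) x. c *s Y x)
      (eigenspace Q T1 T2 G1 G2 lam)"

definition p_perp :: "complex^'m^'m \<Rightarrow> complex^'m^'m \<Rightarrow> nat"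
  where "p_perp T1 T2 = vec.dim {v. T1 *v v = 0 \<and> T2 *v v = 0}"

definition index_set :: "complex^'m^'m \<Rightarrow> complex^'m^'m \<Rightarrow> (nat \<times> nat) set"
  where "index_set T1 T2 =
    {(n, k). 1 \<le> n \<and> 1 \<le> k \<and> k \<le> CARD('m)} \<union>
    {(n, k). n = 0 \<and> p_perp T1 T2 + 1 \<le> k \<and> k \<le> CARD('m)}"

(* lam is the non-decreasing (w.r.t. the lexicographic order of the indices) enumeration of
   all eigenvalues, each of them being listed as often as its multiplicity. *)
definition eigenvalue_numbering ::
    "(real \<Rightarrow> complex^'m^'m) \<Rightarrow> complex^'m^'m \<Rightarrow> complex^'m^'m \<Rightarrow> complex^'m^'m \<Rightarrow> complex^'m^'m
      \<Rightarrow> (nat \<Rightarrow> nat \<Rightarrow> real) \<Rightarrow> bool"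
  where "eigenvalue_numbering Q T1 T2 G1 G2 lam \<longleftrightarrow>
    (\<forall>(n, k) \<in> index_set T1 T2. \<forall>(n', k') \<in> index_set T1 T2.
        n < n' \<or> n = n' \<and> k \<le> k' \<longrightarrow> lam n k \<le> lam n' k') \<and>
    (\<forall>mu::complex. finite {(n, k) \<in> index_set T1 T2. complex_of_real (lam n k) = mu} \<and>
        card {(n, k) \<in> index_set T1 T2. complex_of_real (lam n k) = mu}
          = eigenvalue_multiplicity Q T1 T2 G1 G2 mu)"

definition weyl_solution ::
    "(real \<Rightarrow> complex^'m^'m) \<Rightarrow> complex^'m^'m \<Rightarrow> complex^'m^'m \<Rightarrow> complex^'m^'m \<Rightarrow> complex^'m^'m
      \<Rightarrow> complex \<Rightarrow> (real \<Rightarrow> complex^'m^'m) \<Rightarrow> (real \<Rightarrow> complex^'m^'m) \<Rightarrow> bool"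
  where "weyl_solution Q T1 T2 G1 G2 lam Phi DPhi \<longleftrightarrow>
    matrix_solution Q lam Phi DPhi \<and>
    boundary_form_matrix T1 G1 (Phi 0) (DPhi 0) = mat 1 \<and>
    boundary_form_matrix T2 G2 (Phi pi) (DPhi pi) = 0"

(* The Weyl solution is unique unless lam is an eigenvalue, where the value below is arbitrary;
   this does not affect residues. *)
definition weyl_matrix ::
    "(real \<Rightarrow> complex^'m^'m) \<Rightarrow> complex^'m^'m \<Rightarrow> complex^'m^'m \<Rightarrow> complex^'m^'m \<Rightarrow> complex^'m^'m
      \<Rightarrow> complex \<Rightarrow> complex^'m^'m"
  where "weyl_matrix Q T1 T2 G1 G2 lam =
    (THE M. \<exists>Phi DPhi. weyl_solution Q T1 T2 G1 G2 lam Phi DPhi \<and>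
       M = (mat 1 - T1) ** DPhi 0 + T1 ** Phi 0)"

definition weight_matrix ::
    "(real \<Rightarrow> complex^'m^'m) \<Rightarrow> complex^'m^'m \<Rightarrow> complex^'m^'m \<Rightarrow> complex^'m^'m \<Rightarrow> complex^'m^'m
      \<Rightarrow> complex \<Rightarrow> complex^'m^'m"
  where "weight_matrix Q T1 T2 G1 G2 lam =
    (\<chi> i j. residue (\<lambda>z. weyl_matrix Q T1 T2 G1 G2 z $ i $ j) lam)"

definition spectral_data ::
    "(real \<Rightarrow> complex^'m^'m) \<Rightarrow> complex^'m^'m \<Rightarrow> complex^'m^'m \<Rightarrow> complex^'m^'m \<Rightarrow> complex^'m^'m
      \<Rightarrow> (nat \<Rightarrow> nat \<Rightarrow> real) \<Rightarrow> (nat \<Rightarrow> nat \<Rightarrow> complex^'m^'m) \<Rightarrow> bool"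
  where "spectral_data Q T1 T2 G1 G2 lam alpha \<longleftrightarrow>
    eigenvalue_numbering Q T1 T2 G1 G2 lam \<and>
    (\<forall>(n, k) \<in> index_set T1 T2.
        alpha n k = weight_matrix Q T1 T2 G1 G2 (complex_of_real (lam n k)))"

end

(* The Weyl matrix M determines the problem, and M is determined by its poles and residues.

   By self-adjointness -M is a Herglotz function, so |M(z)| <= K (1 + |z|)^2 / |Im z|. Hence the poles
   are simple, and the difference E of two Weyl matrices with the same poles and residues extends to an
   entire function; on |z| = R the factor z^2 - R^2 has modulus 2 R |Im z|, so the maximum principle for
   (z^2 - R^2) E(z) shows that E is affine. Solutions satisfying the right boundary condition behave
   like exp(i rho x), z = rho^2, to leading order, so M = -i rho (1 - T1) + o(1) along a ray. This gives
   T1 = T1~, M = M~, and at the next order G1 = G1~.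

   For the potential, let phi and psi be the solutions normalised at 0 such that the Weyl solution is
   Phi = psi + phi M. As M = M~, the entire function P = phi psi~* - psi phi~* equals
   phi Phi~* - Phi phi~*, which is O(1/rho) off a sector around the positive half axis since phi grows
   like exp(x Im rho) and Phi decays at that rate. It has order 1/2, so P = 0 by Phragmen-Lindelof.
   Differentiating P = 0 in x gives phi = phi~ and psi = psi~, hence the potentials agree, and then
   the values of Phi at pi determine T2 and G2. *)

theory Submission
  imports Defs
begin

section \<open>Absolutely continuous functions\<close>

text \<open>As \<open>Q\<close> is merely integrable, second derivatives exist only almost
  everywhere and identities between solutions must be integrated; hence the calculus of absolutely
  continuous functions. Matrices do not commute; the substitute for the scalar Wronskian pairs a
  solution at \<open>z\<close> with the conjugate transpose of a solution at \<open>cnj z\<close>.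
  For Hermitian \<open>Q\<close> it is constant and inverts the fundamental matrix explicitly. For
  the same reason \<open>cnj z\<close> enters \<open>P\<close>, and \<open>M (cnj z)\<close> has to
  be the adjoint of \<open>M z\<close>. Asymptotic formulas say nothing near the real axis, where
  the poles of \<open>M\<close> lie; positivity gives a bound up to the axis without any knowledge
  of the eigenvalues. The affine function left over contributes at the orders 1 and rho^2 and the
  difference of the two \<open>T1\<close> at the order rho, so a single ray separates all three. On
  that ray \<open>z\<close> must be nonreal and Im rho comparable with the modulus of rho. For
  integrable \<open>Q\<close> the errors have no rate; to reach \<open>G1\<close> they must be
  measured relative to the small vector \<open>Phi (rho^2) 0 *v v\<close>, not relative to
  \<open>v\<close>.\<close>

lemma AE_lebesgue_on_iff_negligible:
  fixes P :: "real \<Rightarrow> bool"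
  assumes "S \<in> sets lebesgue"
  shows "(AE x in lebesgue_on S. P x) \<longleftrightarrow> (\<exists>N. negligible N \<and> (\<forall>x\<in>S - N. P x))"
proof -
  have "(AE x in lebesgue_on S. P x) \<longleftrightarrow> (AE x in lebesgue. x \<in> S \<longrightarrow> P x)"
    using assms by (simp add: AE_restrict_space_iff)
  also have "\<dots> \<longleftrightarrow> (\<exists>N. negligible N \<and> (\<forall>x\<in>S - N. P x))"
  proof
    assume "AE x in lebesgue. x \<in> S \<longrightarrow> P x"
    then obtain N where "{x \<in> space lebesgue. \<not> (x \<in> S \<longrightarrow> P x)} \<subseteq> N" "N \<in> null_sets lebesgue"
      unfolding eventually_ae_filter by auto
    then show "\<exists>N. negligible N \<and> (\<forall>x\<in>S - N. P x)"
      by (intro exI[of _ N]) (auto simp: negligible_iff_null_sets)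
  next
    assume "\<exists>N. negligible N \<and> (\<forall>x\<in>S - N. P x)"
    then obtain N where "negligible N" "\<forall>x\<in>S - N. P x" by blast
    then show "AE x in lebesgue. x \<in> S \<longrightarrow> P x"
      unfolding eventually_ae_filter
      by (intro bexI[of _ N]) (auto simp: negligible_iff_null_sets)
  qed
  finally show ?thesis .
qed

lemma division_of_real_element:
  fixes a b :: real
  assumes "D division_of S" "S \<subseteq> {a..b}" "K \<in> D"
  shows "Inf K \<in> {a..b}" "Sup K \<in> {a..b}" "Inf K \<le> Sup K" "K = {Inf K..Sup K}" "measure lborel K = Sup K - Inf K"
proof -
  obtain u v where K: "K = {u..v}" using division_ofD(4)[OF assms(1,3)] by (auto simp: cbox_interval)
  have "K \<noteq> {}" "K \<subseteq> S" using division_ofD[OF assms(1)] assms(3) by auto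
  moreover from this have "K \<subseteq> {a..b}" using assms(2) by blast
  ultimately have uv: "u \<le> v" and sub: "{u..v} \<subseteq> {a..b}" using K by auto
  then have "u \<in> {a..b}" "v \<in> {a..b}" by auto
  then show "Inf K \<in> {a..b}" "Sup K \<in> {a..b}" "Inf K \<le> Sup K" "K = {Inf K..Sup K}" "measure lborel K = Sup K - Inf K"
    using uv K by (auto simp: cInf_atLeastAtMost)
qed

text \<open>Replaces the epsilon-delta argument for sums, products, linear images and compositions:
  it is enough to bound a single increment.\<close>

lemma abs_continuous_on_dominated:
  fixes f :: "real \<Rightarrow> 'a::real_normed_vector" and g :: "real \<Rightarrow> 'b::real_normed_vector"
    and h :: "real \<Rightarrow> 'c::real_normed_vector"
  assumes f: "abs_continuous_on a b f" and g: "abs_continuous_on a b g"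
    and h: "\<And>u v. u \<in> {a..b} \<Longrightarrow> v \<in> {a..b} \<Longrightarrow> u \<le> v \<Longrightarrow>
        norm (h v - h u) \<le> C * (norm (f v - f u) + norm (g v - g u))"
  shows "abs_continuous_on a b h"
  unfolding abs_continuous_on_def
proof (intro allI impI)
  fix e :: real assume "e > 0"
  \<comment> \<open>The sign of \<open>C\<close> is arbitrary, and a positive constant is wanted as
    a divisor.\<close>
  define C' where "C' = \<bar>C\<bar> + 1"
  have C': "C' > 0" "C \<le> C'" by (auto simp: C'_def)
  have e': "e / (2 * C') > 0" using \<open>e > 0\<close> C' by simp
  obtain d1 where d1: "d1 > 0" "\<And>D. D division_of (\<Union>D) \<and> \<Union>D \<subseteq> {a..b} \<and> (\<Sum>K\<in>D. Sup K - Inf K) < d1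
       \<Longrightarrow> (\<Sum>K\<in>D. norm (f (Sup K) - f (Inf K))) < e / (2 * C')"
    using f e' unfolding abs_continuous_on_def by blast
  obtain d2 where d2: "d2 > 0" "\<And>D. D division_of (\<Union>D) \<and> \<Union>D \<subseteq> {a..b} \<and> (\<Sum>K\<in>D. Sup K - Inf K) < d2
       \<Longrightarrow> (\<Sum>K\<in>D. norm (g (Sup K) - g (Inf K))) < e / (2 * C')"
    using g e' unfolding abs_continuous_on_def by blast
  show "\<exists>d>0. \<forall>D. D division_of (\<Union>D) \<and> \<Union>D \<subseteq> {a..b} \<and> (\<Sum>K\<in>D. Sup K - Inf K) < d
       \<longrightarrow> (\<Sum>K\<in>D. norm (h (Sup K) - h (Inf K))) < e"
  proof (intro exI[of _ "min d1 d2"] conjI allI impI)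
    fix D assume D: "D division_of (\<Union>D) \<and> \<Union>D \<subseteq> {a..b} \<and> (\<Sum>K\<in>D. Sup K - Inf K) < min d1 d2"
    have "(\<Sum>K\<in>D. norm (h (Sup K) - h (Inf K)))
      \<le> (\<Sum>K\<in>D. C' * (norm (f (Sup K) - f (Inf K)) + norm (g (Sup K) - g (Inf K))))"
    proof (rule sum_mono)
      fix K assume K: "K \<in> D"
      note E = division_of_real_element[OF _ _ K, of "\<Union>D" a b]
      have "norm (h (Sup K) - h (Inf K)) \<le> C * (norm (f (Sup K) - f (Inf K)) + norm (g (Sup K) - g (Inf K)))"
        using h E D by blast
      also have "\<dots> \<le> C' * (norm (f (Sup K) - f (Inf K)) + norm (g (Sup K) - g (Inf K)))"
        using C' by (intro mult_right_mono) auto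
      finally show "norm (h (Sup K) - h (Inf K)) \<le> \<dots>" .
    qed
    also have "\<dots> = C' * ((\<Sum>K\<in>D. norm (f (Sup K) - f (Inf K))) + (\<Sum>K\<in>D. norm (g (Sup K) - g (Inf K))))"
      by (simp add: sum_distrib_left[symmetric] sum.distrib)
    also have "\<dots> < C' * (e / (2 * C') + e / (2 * C'))"
      using d1(2)[of D] d2(2)[of D] D C'(1) by (intro mult_strict_left_mono add_strict_mono) auto
    also have "\<dots> = e" using C'(1) by (simp add: field_simps)
    finally show "(\<Sum>K\<in>D. norm (h (Sup K) - h (Inf K))) < e" .
  qed (use d1 d2 in auto)
qed

lemma abs_continuous_on_lipschitz:
  fixes h :: "real \<Rightarrow> 'c::real_normed_vector"
  assumes h: "\<And>u v. u \<in> {a..b} \<Longrightarrow> v \<in> {a..b} \<Longrightarrow> u \<le> v \<Longrightarrow> norm (h v - h u) \<le> C * (v - u)"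
  shows "abs_continuous_on a b h"
proof -
  have "abs_continuous_on a b (\<lambda>x. x)"
    unfolding abs_continuous_on_def
  proof (intro allI impI)
    fix e :: real assume "e > 0"
    have "(\<Sum>K\<in>D. norm (Sup K - Inf K)) < e" 
      if "D division_of (\<Union>D)" "\<Union>D \<subseteq> {a..b}" "(\<Sum>K\<in>D. Sup K - Inf K) < e" for D
    proof -
      have "(\<Sum>K\<in>D. norm (Sup K - Inf K)) = (\<Sum>K\<in>D. Sup K - Inf K)"
        using division_of_real_element(3)[OF that(1,2)] by (intro sum.cong) auto
      then show ?thesis using that by simp
    qed
    then show "\<exists>d>0. \<forall>D. D division_of \<Union>D \<and> \<Union>D \<subseteq> {a..b} \<and> (\<Sum>K\<in>D. Sup K - Inf K) < d
        \<longrightarrow> (\<Sum>K\<in>D. norm (Sup K - Inf K)) < e"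
      using \<open>e > 0\<close> by blast
  qed
  from this this show ?thesis
  proof (rule abs_continuous_on_dominated)
    fix u v assume "u \<in> {a..b}" "v \<in> {a..b}" "u \<le> v"
    then have "norm (h v - h u) \<le> C * (v - u)" "norm (v - u) = v - u" using h[of u v] by auto
    \<comment> \<open>The identity function dominates in both places, which accounts for the
      half.\<close>
    then show "norm (h v - h u) \<le> C / 2 * (norm (v - u) + norm (v - u))" by (simp add: field_simps)
  qed
qed

lemma abs_continuous_on_imp_continuous_on:
  assumes "abs_continuous_on a b f"
  shows "continuous_on {a..b} f"
  unfolding continuous_on_iff
proof (intro ballI allI impI)
  fix x e :: real assume x: "x \<in> {a..b}" and "e > 0"
  then obtain d where d: "d > 0" "\<And>D. D division_of (\<Union>D) \<and> \<Union>D \<subseteq> {a..b} \<and> (\<Sum>K\<in>D. Sup K - Inf K) < d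
       \<Longrightarrow> (\<Sum>K\<in>D. norm (f (Sup K) - f (Inf K))) < e"
    using assms unfolding abs_continuous_on_def by blast
  have *: "norm (f v - f u) < e" if "u \<in> {a..b}" "v \<in> {a..b}" "u \<le> v" "v - u < d" for u v
  proof -
    have "cbox u v \<noteq> {}" using that by (auto simp: cbox_interval)
    then have "{{u..v}} division_of \<Union>{{u..v}}" using division_of_self[of u v] by (simp add: cbox_interval)
    then show ?thesis using d(2)[of "{{u..v}}"] that by (auto simp: cInf_atLeastAtMost)
  qed
  show "\<exists>d>0. \<forall>x'\<in>{a..b}. dist x' x < d \<longrightarrow> dist (f x') (f x) < e"
  proof (intro exI[of _ d] conjI ballI impI d)
    fix y assume "y \<in> {a..b}" "dist y x < d"
    then show "dist (f y) (f x) < e"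
      using *[of x y] *[of y x] x by (cases "x \<le> y") (auto simp: dist_norm norm_minus_commute)
  qed
qed

section \<open>The fundamental theorem of calculus for absolutely continuous functions\<close>

text \<open>Only the class of \<open>g\<close> modulo null sets matters. The end points are left out
  of the differentiability condition, so that restriction to subintervals is immediate.\<close>

definition ac_deriv :: "real \<Rightarrow> real \<Rightarrow> (real \<Rightarrow> 'a::real_normed_vector) \<Rightarrow> (real \<Rightarrow> 'a) \<Rightarrow> bool"
  where "ac_deriv a b f g \<longleftrightarrow> abs_continuous_on a b f \<and>
    (\<exists>N. negligible N \<and> (\<forall>x\<in>{a<..<b} - N. (f has_vector_derivative g x) (at x)))"

lemma ac_derivD_continuous: "ac_deriv a b f g \<Longrightarrow> continuous_on {a..b} f"
  by (simp add: ac_deriv_def abs_continuous_on_imp_continuous_on)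

lemma abs_continuous_on_subset:
  assumes "abs_continuous_on a b f" "{c..d} \<subseteq> {a..b}"
  shows "abs_continuous_on c d f"
  using assms unfolding abs_continuous_on_def by (meson subset_trans)

lemma ac_deriv_subset:
  assumes "ac_deriv a b f g" "a \<le> c" "d \<le> b"
  shows "ac_deriv c d f g"
proof -
  have sub: "{c<..<d} \<subseteq> {a<..<b}" "{c..d} \<subseteq> {a..b}" using assms by auto
  obtain N where "negligible N" "\<forall>x\<in>{a<..<b} - N. (f has_vector_derivative g x) (at x)" "abs_continuous_on a b f"
    using assms(1) unfolding ac_deriv_def by blast
  then show ?thesis using abs_continuous_on_subset[OF _ sub(2)] sub(1)
    unfolding ac_deriv_def by (meson Diff_iff subsetD)
qed

text \<open>The straddle lemma controls a fine Riemann sum off the exceptional null set; over that set,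
  absolute continuity makes the increments of \<open>f\<close> small because the tagged intervals lie in an
  open set of small measure.\<close>

lemma ac_deriv_has_integral:
  fixes f :: "real \<Rightarrow> 'a::banach"
  assumes "ac_deriv a b f g" "a \<le> b"
  shows "(g has_integral (f b - f a)) {a..b}"
proof -
  obtain N0 where N0: "negligible N0" "\<And>x. x \<in> {a<..<b} - N0 \<Longrightarrow> (f has_vector_derivative g x) (at x)"
    and ac: "abs_continuous_on a b f"
    using assms unfolding ac_deriv_def by blast
  \<comment> \<open>The derivative is known only inside the interval, so the end points join the
    exceptional set.\<close>
  define N where "N = N0 \<union> {a, b}"
  have N: "negligible N" unfolding N_def using N0 by auto
  \<comment> \<open>With the value 0 on the null set, a tag there contributes nothing to the Riemann
    sum, and only the increment of \<open>f\<close> is left.\<close>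
  define g' where "g' x = (if x \<in> N then 0 else g x)" for x
  have der: "(f has_vector_derivative g' x) (at x)" if "x \<in> {a..b} - N" for x
    using that N0(2)[of x] by (auto simp: g'_def N_def)
  have "(g' has_integral (f b - f a)) (cbox a b)"
    unfolding has_integral
  proof (intro allI impI)
    fix e :: real assume "e > 0"
    \<comment> \<open>Multiplied by the length \<open>b - a\<close> this is at most
      \<open>e / 2\<close>; the added 1 covers \<open>a = b\<close>.\<close>
    define e1 where "e1 = e / (2 * (b - a + 1))"
    have e1: "e1 > 0" using \<open>e > 0\<close> assms(2) by (auto simp: e1_def)
    obtain d where d: "d > 0" "\<And>D. D division_of (\<Union>D) \<and> \<Union>D \<subseteq> {a..b} \<and> (\<Sum>K\<in>D. Sup K - Inf K) < d
       \<Longrightarrow> (\<Sum>K\<in>D. norm (f (Sup K) - f (Inf K))) < e/2"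
      using ac \<open>e > 0\<close> unfolding abs_continuous_on_def by (meson half_gt_zero)
    obtain U where U: "open U" "N \<subseteq> U" "U \<in> lmeasurable" "measure lebesgue U < d"
    proof -
      have "N \<in> lmeasurable" "measure lebesgue N = 0"
        using N negligible_imp_measurable negligible_imp_measure0 by blast+
      obtain U where "open U" "N \<subseteq> U" "U - N \<in> lmeasurable" "emeasure lebesgue (U - N) < ennreal d"
        using sets_lebesgue_outer_open[of N d] \<open>N \<in> lmeasurable\<close> d(1) by auto
      have "U \<in> lmeasurable" using \<open>U - N \<in> lmeasurable\<close> \<open>N \<in> lmeasurable\<close> \<open>N \<subseteq> U\<close>
        by (metis Diff_partition fmeasurable.Un)
      moreover have "measure lebesgue U = measure lebesgue (U - N)"
        by (metis Diff_partition N \<open>N \<subseteq> U\<close> measure_Un_null_set negligible_iff_null_sets sup_commute \<open>U - N \<in> lmeasurable\<close> fmeasurableD)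
      moreover have "measure lebesgue (U - N) < d"
        using \<open>emeasure lebesgue (U - N) < ennreal d\<close> \<open>U - N \<in> lmeasurable\<close> d(1)
        by (metis emeasure_eq_measure2 ennreal_less_iff measure_nonneg)
      ultimately show ?thesis using that \<open>open U\<close> \<open>N \<subseteq> U\<close> by simp
    qed
    have "\<exists>r>0. (x \<in> N \<longrightarrow> ball x r \<subseteq> U) \<and> (x \<in> {a..b} - N \<longrightarrow>
            (\<forall>y. \<bar>y - x\<bar> < r \<longrightarrow> norm (f y - f x - (y - x) *\<^sub>R g' x) \<le> e1 * \<bar>y - x\<bar>))" for x
    proof (cases "x \<in> N")
      case True
      then obtain r where "r > 0" "ball x r \<subseteq> U" using U by (meson open_contains_ball subsetD)
      then show ?thesis using True by blast
    next
      case False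
      show ?thesis
      proof (cases "x \<in> {a..b}")
        case True
        then have "(f has_derivative (\<lambda>h. h *\<^sub>R g' x)) (at x)" using der False
          by (auto simp: has_vector_derivative_def)
        then obtain r where "r > 0" "\<forall>y. norm (y - x) < r \<longrightarrow> norm (f y - f x - (y - x) *\<^sub>R g' x) \<le> e1 * norm (y - x)"
          using e1 unfolding has_derivative_at_alt by blast
        then show ?thesis using False by auto
      qed (use False in \<open>auto intro: exI[of _ 1]\<close>)
    qed
    then obtain r where r: "\<And>x. r x > 0" "\<And>x. x \<in> N \<Longrightarrow> ball x (r x) \<subseteq> U"
      "\<And>x y. x \<in> {a..b} - N \<Longrightarrow> \<bar>y - x\<bar> < r x \<Longrightarrow> norm (f y - f x - (y - x) *\<^sub>R g' x) \<le> e1 * \<bar>y - x\<bar>"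
      by metis
    show "\<exists>\<gamma>. gauge \<gamma> \<and> (\<forall>\<D>. \<D> tagged_division_of cbox a b \<and> \<gamma> fine \<D> \<longrightarrow>
            norm ((\<Sum>(x, k)\<in>\<D>. measure lborel k *\<^sub>R g' x) - (f b - f a)) < e)"
    proof (intro exI[of _ "\<lambda>x. ball x (r x)"] conjI allI impI)
      show "gauge (\<lambda>x. ball x (r x))" using r(1) by (auto simp: gauge_def)
      fix p assume p: "p tagged_division_of cbox a b \<and> (\<lambda>x. ball x (r x)) fine p"
      then have pt: "p tagged_division_of {a..b}" and fine: "\<And>x K. (x,K) \<in> p \<Longrightarrow> K \<subseteq> ball x (r x)"
        by (auto simp: fine_def cbox_interval)
      have fin: "finite p" using pt by blast
      have K: "\<exists>u v. K = {u..v} \<and> u \<le> x \<and> x \<le> v \<and> u \<in> {a..b} \<and> v \<in> {a..b}" if "(x,K) \<in> p" for x K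
        using tagged_division_ofD(2,3,4)[OF pt that] by (fastforce simp: cbox_interval)
      have tel: "(\<Sum>(x,K)\<in>p. f (Sup K) - f (Inf K)) = f b - f a"
        using additive_tagged_division_1[OF assms(2) pt, of f] by simp
      let ?t = "\<lambda>x K. measure lborel K *\<^sub>R g' x - (f (Sup K) - f (Inf K))"
      have eq: "(\<Sum>(x, k)\<in>p. measure lborel k *\<^sub>R g' x) - (f b - f a) = (\<Sum>(x,K)\<in>p. ?t x K)"
        unfolding tel[symmetric] by (simp add: sum_subtractf case_prod_unfold)
      have split: "p = {(x,K) \<in> p. x \<in> N} \<union> {(x,K) \<in> p. x \<notin> N}" by auto
      have "norm (\<Sum>(x,K)\<in>p. ?t x K) \<le> (\<Sum>(x,K)\<in>p. norm (?t x K))"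
        by (rule order_trans[OF norm_sum]) (simp add: case_prod_unfold)
      also have "\<dots> = (\<Sum>(x,K)\<in>{(x,K) \<in> p. x \<in> N}. norm (?t x K)) + (\<Sum>(x,K)\<in>{(x,K) \<in> p. x \<notin> N}. norm (?t x K))"
        by (subst split, subst sum.union_disjoint) (use fin in \<open>auto intro: finite_subset[OF _ fin]\<close>)
      also have "(\<Sum>(x,K)\<in>{(x,K) \<in> p. x \<notin> N}. norm (?t x K)) \<le> e1 * (b - a)"
      proof -
        have "(\<Sum>(x,K)\<in>{(x,K) \<in> p. x \<notin> N}. norm (?t x K)) \<le> (\<Sum>(x,K)\<in>{(x,K) \<in> p. x \<notin> N}. e1 * measure lborel K)"
        proof (rule sum_mono, clarify)
          fix x K assume xK: "(x,K) \<in> p" "x \<notin> N"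
          obtain u v where uv: "K = {u..v}" "u \<le> x" "x \<le> v" "u \<in> {a..b}" "v \<in> {a..b}" using K[OF xK(1)] by blast
          have sub: "u \<in> ball x (r x)" "v \<in> ball x (r x)" using fine[OF xK(1)] uv by (auto simp: subset_iff)
          have xab: "x \<in> {a..b} - N" using uv xK by auto
          \<comment> \<open>The increment is split at the tag \<open>x\<close>, which lies between
            \<open>u\<close> and \<open>v\<close>, so that both parts are compared with the
            derivative at \<open>x\<close> and the two errors add up to \<open>e1\<close> times the
            length.\<close>
          have "?t x K = - ((f v - f x - (v - x) *\<^sub>R g' x) - (f u - f x - (u - x) *\<^sub>R g' x))"
            using uv by (simp add: algebra_simps cInf_atLeastAtMost)
          then have "norm (?t x K) \<le> norm (f v - f x - (v - x) *\<^sub>R g' x) + norm (f u - f x - (u - x) *\<^sub>R g' x)"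
            by (metis norm_minus_cancel norm_triangle_ineq4)
          also have "\<dots> \<le> e1 * \<bar>v - x\<bar> + e1 * \<bar>u - x\<bar>"
            using r(3)[OF xab, of u] r(3)[OF xab, of v] sub by (intro add_mono) (auto simp: dist_real_def)
          also have "\<dots> = e1 * measure lborel K" using uv by (simp add: algebra_simps)
          finally show "norm (?t x K) \<le> e1 * measure lborel K" .
        qed
        also have "\<dots> \<le> (\<Sum>(x,K)\<in>p. e1 * measure lborel K)"
          using e1 fin by (intro sum_mono2) (auto simp: zero_le_mult_iff)
        also have "\<dots> = e1 * (b - a)"
          using additive_content_tagged_division[of p a b] p assms(2)
          by (simp add: sum_distrib_left[symmetric] case_prod_unfold)
        finally show ?thesis .
      qed
      also have "(\<Sum>(x,K)\<in>{(x,K) \<in> p. x \<in> N}. norm (?t x K)) < e/2"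
      proof -
        define p' where "p' = {(x,K) \<in> p. x \<in> N}"
        have p': "p' tagged_partial_division_of {a..b}"
          using pt unfolding tagged_division_of_def p'_def
          by (metis (no_types, lifting) case_prodE mem_Collect_eq prod.inject subsetI tagged_partial_division_subset)
        define D where "D = snd ` p'"
        have pt': "p' tagged_division_of \<Union>D" unfolding D_def
          using tagged_partial_division_of_Union_self[OF p'] .
        have D: "D division_of \<Union>D" unfolding D_def 
          using division_of_tagged_division[OF pt'] unfolding D_def .
        have Dsub: "\<Union>D \<subseteq> {a..b}" using tagged_partial_division_ofD(3)[OF p'] unfolding D_def by fastforce
        have DU: "\<Union>D \<subseteq> U" using fine r(2) by (fastforce simp: D_def p'_def)
        have "(\<Sum>K\<in>D. Sup K - Inf K) = (\<Sum>K\<in>D. measure lebesgue K)"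
        proof (intro sum.cong refl)
          fix K assume "K \<in> D"
          note E = division_of_real_element[OF D Dsub this]
          show "Sup K - Inf K = measure lebesgue K"
            using E(3) by (subst (3) E(4)) simp
        qed
        also have "\<dots> = measure lebesgue (\<Union>D)" by (rule content_division[OF D])
        also have "\<dots> \<le> measure lebesgue U"
          by (intro measure_mono_fmeasurable DU U) (use lmeasurable_division[OF D] in \<open>auto dest: fmeasurableD\<close>)
        also have "\<dots> < d" by fact
        finally have "(\<Sum>K\<in>D. norm (f (Sup K) - f (Inf K))) < e/2" using d(2) D Dsub by blast
        moreover have "(\<Sum>(x,K)\<in>p'. norm (?t x K)) = (\<Sum>(x,K)\<in>p'. norm (f (Sup K) - f (Inf K)))"
          by (intro sum.cong refl) (auto simp: p'_def g'_def norm_minus_commute)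
        moreover have "(\<Sum>(x,K)\<in>p'. norm (f (Sup K) - f (Inf K))) = (\<Sum>K\<in>D. norm (f (Sup K) - f (Inf K)))"
        proof -
          \<comment> \<open>\<open>Inf\<close> and \<open>Sup\<close> of the empty set are
            unspecified, while the lemma on tagged divisions asks for the value 0 there.\<close>
          define d' where "d' K = (if K = {} then 0 else norm (f (Sup K) - f (Inf K)))" for K :: "real set"
          have "(\<Sum>(x,K)\<in>p'. d' K) = (\<Sum>K\<in>snd ` p'. d' K)"
          proof (rule sum.over_tagged_division_lemma[OF pt'])
            fix u v :: real assume "box u v = {}"
            then show "d' (cbox u v) = 0" by (auto simp: d'_def cbox_interval box_real cInf_atLeastAtMost)
          qed
          moreover have "d' K = norm (f (Sup K) - f (Inf K))" if "(x,K) \<in> p'" for x K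
            using tagged_partial_division_ofD(2)[OF p' that] by (auto simp: d'_def)
          moreover have "(\<Sum>(x,K)\<in>p'. d' K) = (\<Sum>(x,K)\<in>p'. norm (f (Sup K) - f (Inf K)))"
            using calculation(2) by (intro sum.cong refl) auto
          moreover have "(\<Sum>K\<in>snd ` p'. d' K) = (\<Sum>K\<in>D. norm (f (Sup K) - f (Inf K)))"
            using calculation(2) unfolding D_def by (intro sum.cong refl) auto
          ultimately show ?thesis by simp
        qed
        ultimately show ?thesis by (simp add: p'_def)
      qed
      finally have "norm (\<Sum>(x,K)\<in>p. ?t x K) < e/2 + e1 * (b - a)" by simp
      also have "e1 * (b - a) \<le> e/2" using \<open>e > 0\<close> assms(2) by (simp add: e1_def field_simps)
      finally show "norm ((\<Sum>(x, k)\<in>p. measure lborel k *\<^sub>R g' x) - (f b - f a)) < e" unfolding eq by simp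
    qed
  qed
  then have "(g has_integral (f b - f a)) (cbox a b)"
    by (rule has_integral_spike[OF N, rotated]) (auto simp: g'_def)
  then show ?thesis by (simp add: cbox_interval)
qed

text \<open>Truncation of \<open>norm g\<close> at a height \<open>n\<close>: the part above
  \<open>n\<close> has a small integral over the whole interval by monotone convergence, and the
  part below contributes at most \<open>n\<close> times the total length.\<close>

lemma abs_continuous_on_integral:
  fixes g :: "real \<Rightarrow> 'a::euclidean_space"
  assumes g: "g absolutely_integrable_on {a..b}"
  shows "abs_continuous_on a b (\<lambda>x. integral {a..x} g)"
  unfolding abs_continuous_on_def
proof (intro allI impI)
  fix e :: real assume "e > 0"
  define h where "h x = norm (g x)" for x
  define hn where "hn n x = min (h x) (real n)" for n x
  have h: "h absolutely_integrable_on {a..b}" unfolding h_def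
    using g absolutely_integrable_norm by (auto simp: o_def)
  have c: "(\<lambda>x. c) absolutely_integrable_on {a..b}" for c :: real
    using absolutely_integrable_on_const[of "{a..b}" c] by simp
  have hn: "hn n absolutely_integrable_on {a..b}" for n
    unfolding hn_def using absolutely_integrable_min_1[OF h c[of "real n"]] by simp
  have "(\<lambda>n. integral {a..b} (hn n)) \<longlonglongrightarrow> integral {a..b} h"
  proof (rule monotone_convergence_increasing[THEN conjunct2])
    show "hn n integrable_on {a..b}" for n using hn set_lebesgue_integral_eq_integral(1) by blast
    show "hn n x \<le> hn (Suc n) x" for n x by (auto simp: hn_def)
    show "(\<lambda>n. hn n x) \<longlonglongrightarrow> h x" for x
    proof (rule tendsto_eventually)
      obtain m where "h x \<le> real m" using real_arch_simple by blast
      then show "\<forall>\<^sub>F n in sequentially. hn n x = h x"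
        by (intro eventually_sequentiallyI[of m]) (auto simp: hn_def)
    qed
    have "norm (integral {a..b} (hn n)) \<le> integral {a..b} h" for n
      by (rule integral_norm_bound_integral) (use h hn in \<open>auto simp: hn_def h_def set_lebesgue_integral_eq_integral(1)\<close>)
    then show "bounded (range (\<lambda>n. integral {a..b} (hn n)))"
      by (auto simp: bounded_iff)
  qed
  from tendstoD[OF this, of "e/2"]
  have "\<forall>\<^sub>F n in sequentially. dist (integral {a..b} (hn n)) (integral {a..b} h) < e/2"
    using \<open>e > 0\<close> by simp
  then obtain n where "dist (integral {a..b} (hn n)) (integral {a..b} h) < e/2"
    by (meson eventually_sequentially order_refl)
  then have n: "integral {a..b} h - integral {a..b} (hn n) < e/2" unfolding dist_real_def by linarith
  show "\<exists>d>0. \<forall>D. D division_of \<Union> D \<and> \<Union> D \<subseteq> {a..b} \<and> (\<Sum>K\<in>D. Sup K - Inf K) < d \<longrightarrow>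
          (\<Sum>K\<in>D. norm (integral {a..Sup K} g - integral {a..Inf K} g)) < e"
  \<comment> \<open>Chosen so that \<open>n\<close> times the total length stays below
    \<open>e / 2\<close>; the added 1 covers \<open>n = 0\<close>.\<close>
  proof (intro exI[of _ "e / (2 * (real n + 1))"] conjI allI impI)
    show "0 < e / (2 * (real n + 1))" using \<open>e > 0\<close> by simp
    fix D assume "D division_of \<Union> D \<and> \<Union> D \<subseteq> {a..b} \<and> (\<Sum>K\<in>D. Sup K - Inf K) < e / (2 * (real n + 1))"
    then have D: "D division_of \<Union> D" "\<Union> D \<subseteq> {a..b}" "(\<Sum>K\<in>D. Sup K - Inf K) < e / (2 * (real n + 1))" by auto
    have sub: "f integrable_on {u..v}" if "f absolutely_integrable_on {a..b}" "{u..v} \<subseteq> {a..b}" for u v and f :: "real \<Rightarrow> 'b::euclidean_space"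
      using that by (metis integrable_subinterval_real set_lebesgue_integral_eq_integral(1))
    have diff: "(\<lambda>x. h x - hn n x) absolutely_integrable_on {a..b}"
      using h hn[of n] by (rule set_integral_diff(1))
    have "compact (\<Union>D)" using D(1) division_of_finite[OF D(1)] division_ofD(4)[OF D(1)] 
      by (metis compact_Union compact_cbox)
    then have Dm: "\<Union>D \<in> sets lebesgue" by (simp add: fmeasurableD lmeasurable_compact)
    have diffD: "(\<lambda>x. h x - hn n x) integrable_on \<Union>D"
      using set_integrable_subset[OF diff Dm D(2)] set_lebesgue_integral_eq_integral(1) by blast
    have "(\<Sum>K\<in>D. norm (integral {a..Sup K} g - integral {a..Inf K} g)) \<le> 
          (\<Sum>K\<in>D. integral K (\<lambda>x. h x - hn n x) + real n * (Sup K - Inf K))"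
    proof (rule sum_mono)
      fix K assume K: "K \<in> D"
      note E = division_of_real_element[OF D(1,2) K]
      define u v where "u = Inf K" and "v = Sup K"
      have uv: "u \<in> {a..b}" "v \<in> {a..b}" "u \<le> v" "K = {u..v}" using E by (auto simp: u_def v_def)
      have subK: "{u..v} \<subseteq> {a..b}" using uv by auto
      have "integral {a..u} g + integral {u..v} g = integral {a..v} g"
        using uv by (intro Henstock_Kurzweil_Integration.integral_combine sub[OF g]) auto
      then have "norm (integral {a..v} g - integral {a..u} g) = norm (integral {u..v} g)"
        by (metis add_diff_cancel_left')
      also have "\<dots> \<le> integral {u..v} h"
        by (rule integral_norm_bound_integral[OF sub[OF g subK] sub[OF h subK]]) (auto simp: h_def)
      also have "\<dots> = integral {u..v} (\<lambda>x. h x - hn n x) + integral {u..v} (hn n)"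
        using Henstock_Kurzweil_Integration.integral_diff[OF sub[OF h subK] sub[OF hn subK, of n]] by simp
      also have "integral {u..v} (hn n) \<le> integral {u..v} (\<lambda>x. real n)"
        by (rule integral_le[OF sub[OF hn subK]]) (auto simp: hn_def)
      also have "\<dots> = real n * (v - u)" using uv by simp
      finally show "norm (integral {a..Sup K} g - integral {a..Inf K} g) \<le> integral K (\<lambda>x. h x - hn n x) + real n * (Sup K - Inf K)"
        using uv(4) unfolding u_def[symmetric] v_def[symmetric] by simp
    qed
    also have "\<dots> = integral (\<Union>D) (\<lambda>x. h x - hn n x) + real n * (\<Sum>K\<in>D. Sup K - Inf K)"
      using integral_combine_division_topdown[OF diffD D(1)]
      by (simp add: sum.distrib sum_distrib_left[symmetric])
    also have "integral (\<Union>D) (\<lambda>x. h x - hn n x) \<le> integral {a..b} (\<lambda>x. h x - hn n x)"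
      using diff by (intro integral_subset_le[OF D(2) diffD]) (auto simp: hn_def set_lebesgue_integral_eq_integral(1))
    also have "integral {a..b} (\<lambda>x. h x - hn n x) = integral {a..b} h - integral {a..b} (hn n)"
      using h hn by (intro Henstock_Kurzweil_Integration.integral_diff) (auto simp: set_lebesgue_integral_eq_integral(1))
    also have "\<dots> < e/2" by fact
    also have "real n * (\<Sum>K\<in>D. Sup K - Inf K) \<le> real n * (e / (2 * (real n + 1)))"
      using D(3) by (intro mult_left_mono) auto
    also have "\<dots> \<le> e/2" using \<open>e > 0\<close> by (simp add: field_simps)
    finally show "(\<Sum>K\<in>D. norm (integral {a..Sup K} g - integral {a..Inf K} g)) < e" by simp
  qed
qed

text \<open>At a bad point \<open>x\<close> there are arbitrarily short intervals with end point \<open>x\<close> on which the difference quotient is off by more than \<open>1/(n+1)\<close>; by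
  Henstock's lemma a disjoint family of them has small total length, and by the Vitali covering
  lemma such a family, enlarged five times, covers the bad set.\<close>

lemma indefinite_integral_has_vector_derivative_ae:
  fixes g :: "real \<Rightarrow> 'a::euclidean_space"
  assumes g: "g integrable_on {a..b}"
  obtains N where "negligible N" 
    "\<And>x. x \<in> {a<..<b} - N \<Longrightarrow> ((\<lambda>x. integral {a..x} g) has_vector_derivative g x) (at x)"
proof -
  define bad where "bad n x u v \<longleftrightarrow> u < v \<and> (x = u \<or> x = v) \<and> {u..v} \<subseteq> {a..b} \<and>
      norm (integral {u..v} g - (v - u) *\<^sub>R g x) > (v - u) / (real n + 1)" for n x u v
  define S where "S n = {x \<in> {a<..<b}. \<forall>d>0. \<exists>u v. bad n x u v \<and> v - u < d}" for n
  have "negligible (S n)" for n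
    unfolding negligible_outer_le
  proof (intro allI impI)
    fix e :: real assume "e > 0"
    \<comment> \<open>Anticipates two factors: a bad interval has a Henstock error of more than its
      length divided by \<open>n + 1\<close>, and its enlargement is five times as long.\<close>
    then have e': "e / (5 * (real n + 1)) > 0" by simp
    obtain \<gamma> where \<gamma>: "gauge \<gamma>"
      "\<And>p. p tagged_partial_division_of (cbox a b) \<Longrightarrow> \<gamma> fine p \<Longrightarrow>
             sum (\<lambda>(x,k). norm(measure lborel k *\<^sub>R g x - integral k g)) p < e / (5 * (real n + 1))"
      using Henstock_lemma[of g a b, OF _ e'] g by (simp only: cbox_interval) blast
    have "\<exists>u v. bad n x u v \<and> {u..v} \<subseteq> \<gamma> x" if xS: "x \<in> S n" for x
    proof -
      obtain d where d: "d > 0" "ball x d \<subseteq> \<gamma> x" using \<gamma>(1) by (meson gauge_def open_contains_ball)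
      obtain u v where uv: "bad n x u v" "v - u < d" using xS d(1) unfolding S_def by blast
      then have "{u..v} \<subseteq> ball x d" by (auto simp: bad_def dist_real_def)
      then show ?thesis using uv d by blast
    qed
    then obtain u v where uv: "\<And>x. x \<in> S n \<Longrightarrow> bad n x (u x) (v x)" "\<And>x. x \<in> S n \<Longrightarrow> {u x..v x} \<subseteq> \<gamma> x"
      by metis
    define c r where "c x = (u x + v x) / 2" and "r x = (v x - u x) / 2" for x
    have cb: "cball (c x) (r x) = {u x..v x}" for x
      by (auto simp: c_def r_def dist_real_def abs_le_iff field_simps)
    have cov: "S n \<subseteq> (\<Union>i\<in>S n. cball (c i) (r i))"
    proof
      fix x assume "x \<in> S n"
      then have "x \<in> cball (c x) (r x)" using uv(1)[of x] unfolding cb bad_def by auto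
      then show "x \<in> (\<Union>i\<in>S n. cball (c i) (r i))" using \<open>x \<in> S n\<close> by blast
    qed
    have rb: "0 < r i \<and> r i \<le> b - a" if "i \<in> S n" for i
    proof -
      have "u i < v i" "{u i..v i} \<subseteq> {a..b}" using uv(1)[OF that] unfolding bad_def by simp_all
      then have "u i \<ge> a" "v i \<le> b" by auto
      with \<open>u i < v i\<close> show ?thesis by (auto simp: r_def field_simps)
    qed
    obtain C where C: "countable C" "C \<subseteq> S n"
      "pairwise (\<lambda>i j. disjnt (cball (c i) (r i)) (cball (c j) (r j))) C"
      "S n \<subseteq> (\<Union>i\<in>C. cball (c i) (5 * r i))"
      using Vitali_covering_lemma_cballs[OF cov rb] by blast
    have bound: "(\<Sum>i\<in>C'. measure lebesgue (cball (c i) (5 * r i))) \<le> e" if "C' \<subseteq> C" "finite C'" for C'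
    proof -
      let ?p = "(\<lambda>x. (x, {u x..v x})) ` C'"
      have C': "C' \<subseteq> S n" using that C by auto
      have inj: "inj_on (\<lambda>x. (x, {u x..v x})) C'" by (auto simp: inj_on_def)
      have "?p tagged_partial_division_of (cbox a b)"
        unfolding tagged_partial_division_of_def
      proof (intro conjI allI impI)
        show "finite ?p" using that by simp
        fix x K assume "(x, K) \<in> ?p"
        then have "x \<in> S n" "K = {u x..v x}" using C' by auto
        then show "x \<in> K" "K \<subseteq> cbox a b" "\<exists>a b. K = cbox a b" using uv(1)[of x]
          by (auto simp: bad_def cbox_interval) 
      next
        fix x1 K1 x2 K2 assume *: "(x1, K1) \<in> ?p \<and> (x2, K2) \<in> ?p \<and> (x1, K1) \<noteq> (x2, K2)"
        then have "x1 \<in> C" "x2 \<in> C" "K1 = cball (c x1) (r x1)" "K2 = cball (c x2) (r x2)" "x1 \<noteq> x2"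
          using that by (auto simp: cb)
        then have "disjnt K1 K2" using C(3) by (auto simp: pairwise_def)
        then show "interior K1 \<inter> interior K2 = {}" using interior_subset unfolding disjnt_def by blast
      qed
      moreover have "\<gamma> fine ?p" using uv(2) C' by (auto simp: fine_def)
      ultimately have "sum (\<lambda>(x,k). norm(measure lborel k *\<^sub>R g x - integral k g)) ?p < e / (5 * (real n + 1))"
        using \<gamma>(2) by blast
      then have sm: "(\<Sum>x\<in>C'. norm (measure lborel {u x..v x} *\<^sub>R g x - integral {u x..v x} g)) < e / (5 * (real n + 1))"
        using inj by (simp add: sum.reindex)
      have "(\<Sum>i\<in>C'. measure lebesgue (cball (c i) (5 * r i))) = (\<Sum>i\<in>C'. 5 * (v i - u i))"
      proof (intro sum.cong refl)
        fix i assume "i \<in> C'"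
        then have "r i > 0" using rb C' by auto
        have "cball (c i) (5 * r i) = {c i - 5 * r i..c i + 5 * r i}" by (rule cball_eq_atLeastAtMost)
        then have "measure lebesgue (cball (c i) (5 * r i)) = 10 * r i"
          using \<open>r i > 0\<close> by simp
        then show "measure lebesgue (cball (c i) (5 * r i)) = 5 * (v i - u i)"
          by (simp add: r_def)
      qed
      also have "\<dots> \<le> (\<Sum>x\<in>C'. 5 * (real n + 1) * norm (measure lborel {u x..v x} *\<^sub>R g x - integral {u x..v x} g))"
      proof (intro sum_mono)
        fix x assume "x \<in> C'"
        then have "bad n x (u x) (v x)" using uv(1) C' by auto
        then have "u x < v x" "norm (integral {u x..v x} g - (v x - u x) *\<^sub>R g x) > (v x - u x) / (real n + 1)"
          unfolding bad_def by auto
        then show "5 * (v x - u x) \<le> 5 * (real n + 1) * norm (measure lborel {u x..v x} *\<^sub>R g x - integral {u x..v x} g)"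
          by (simp add: norm_minus_commute field_simps)
      qed
      also have "\<dots> = 5 * (real n + 1) * (\<Sum>x\<in>C'. norm (measure lborel {u x..v x} *\<^sub>R g x - integral {u x..v x} g))"
        by (simp add: sum_distrib_left)
      also have "\<dots> \<le> 5 * (real n + 1) * (e / (5 * (real n + 1)))"
        using sm by (intro mult_left_mono) auto
      also have "\<dots> = e" by simp
      finally show ?thesis .
    qed
    have bound': "measure lebesgue (\<Union>i\<in>C'. cball (c i) (5 * r i)) \<le> e" if "C' \<subseteq> C" "finite C'" for C'
      by (rule order_trans[OF measure_UNION_le[OF that(2)] bound[OF that]]) auto
    have "(\<Union>i\<in>C. cball (c i) (5 * r i)) \<in> lmeasurable" "measure lebesgue (\<Union>i\<in>C. cball (c i) (5 * r i)) \<le> e"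
      using fmeasurable_UN_bound[OF C(1) _ bound'] measure_UN_bound[OF C(1) _ bound'] by auto
    then show "\<exists>T. S n \<subseteq> T \<and> T \<in> lmeasurable \<and> measure lebesgue T \<le> e" using C(4) by blast
  qed
  then have neg: "negligible (\<Union>n. S n)" by auto
  show ?thesis
  proof (rule that[OF neg])
    fix x assume x: "x \<in> {a<..<b} - (\<Union>n. S n)"
    show "((\<lambda>x. integral {a..x} g) has_vector_derivative g x) (at x)"
      unfolding has_vector_derivative_def has_derivative_at_alt
    proof (intro conjI allI impI)
      show "bounded_linear (\<lambda>xa. xa *\<^sub>R g x)" by (rule bounded_linear_scaleR_left)
      fix e :: real assume "e > 0"
      obtain n where n: "1 / (real n + 1) < e" using \<open>e > 0\<close>
        by (metis add.commute nat_approx_posE of_nat_Suc)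
      obtain d where d: "d > 0" "\<And>u v. bad n x u v \<Longrightarrow> \<not> v - u < d" using x by (auto simp: S_def) blast
      define d' where "d' = min d (min (x - a) (b - x))"
      show "\<exists>d>0. \<forall>y. norm (y - x) < d \<longrightarrow>
              norm (integral {a..y} g - integral {a..x} g - (y - x) *\<^sub>R g x) \<le> e * norm (y - x)"
      proof (intro exI[of _ d'] conjI allI impI)
        show "d' > 0" using d x by (auto simp: d'_def)
        fix y assume y: "norm (y - x) < d'"
        then have yab: "y \<in> {a..b}" "\<bar>y - x\<bar> < d" by (auto simp: d'_def)
        have main: "norm (integral {u..v} g - (v - u) *\<^sub>R g x) \<le> e * (v - u)"
          if "u < v" "x = u \<or> x = v" "{u..v} \<subseteq> {a..b}" "v - u < d" for u v
        proof -
          have "norm (integral {u..v} g - (v - u) *\<^sub>R g x) \<le> (v - u) / (real n + 1)"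
            using d(2)[of u v] that unfolding bad_def by (meson not_le)
          also have "\<dots> = (1 / (real n + 1)) * (v - u)" by simp
          also have "\<dots> \<le> e * (v - u)" using n that by (intro mult_right_mono) auto
          finally show ?thesis .
        qed
        have comb: "integral {a..v} g - integral {a..u} g = integral {u..v} g" if "u \<le> v" "u \<ge> a" "v \<le> b" for u v
          using Henstock_Kurzweil_Integration.integral_combine[of a u v g] integrable_subinterval_real[OF g, of a v] that
          by (metis add_diff_cancel_left' atLeastatMost_subset_iff order_refl)
        consider "y = x" | "x < y" | "y < x" by linarith
        then show "norm (integral {a..y} g - integral {a..x} g - (y - x) *\<^sub>R g x) \<le> e * norm (y - x)"
        proof cases
          case 2
          then show ?thesis using main[of x y] comb[of x y] yab x by auto
        next
          case 3
          have "integral {a..y} g - integral {a..x} g - (y - x) *\<^sub>R g x = - (integral {y..x} g - (x - y) *\<^sub>R g x)"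
            using comb[of y x] 3 yab x by (simp add: algebra_simps)
          then show ?thesis using main[of y x] 3 yab x by (simp add: norm_minus_commute)
        qed simp
      qed
    qed
  qed
qed

lemma ac_deriv_integral:
  fixes g :: "real \<Rightarrow> 'a::euclidean_space"
  assumes "g absolutely_integrable_on {a..b}"
  shows "ac_deriv a b (\<lambda>x. integral {a..x} g) g"
proof -
  have "g integrable_on {a..b}" using assms set_lebesgue_integral_eq_integral(1) by blast
  then show ?thesis
    using abs_continuous_on_integral[OF assms] indefinite_integral_has_vector_derivative_ae[of g a b]
    unfolding ac_deriv_def by metis
qed

section \<open>Calculus with almost everywhere derivatives\<close>

lemma ac_derivD:
  assumes "ac_deriv a b f g"
  obtains N where "negligible N" "\<And>x. x \<in> {a<..<b} - N \<Longrightarrow> (f has_vector_derivative g x) (at x)"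
  using assms unfolding ac_deriv_def by blast

lemma ac_deriv_abs_continuous: "ac_deriv a b f g \<Longrightarrow> abs_continuous_on a b f"
  by (simp add: ac_deriv_def)

lemma ac_derivI:
  assumes "abs_continuous_on a b f" "negligible N"
    "\<And>x. x \<in> {a<..<b} - N \<Longrightarrow> (f has_vector_derivative g x) (at x)"
  shows "ac_deriv a b f g"
  using assms unfolding ac_deriv_def by blast

lemma ac_deriv_spike:
  assumes "ac_deriv a b f g" "negligible N" "\<And>x. x \<in> {a<..<b} - N \<Longrightarrow> g x = g' x"
  shows "ac_deriv a b f g'"
proof -
  obtain N' where N': "negligible N'" "\<And>x. x \<in> {a<..<b} - N' \<Longrightarrow> (f has_vector_derivative g x) (at x)"
    using ac_derivD[OF assms(1)] by blast
  show ?thesis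
  proof (rule ac_derivI[OF ac_deriv_abs_continuous[OF assms(1)]])
    show "negligible (N \<union> N')" using assms N' by (simp add: negligible_Un)
    fix x assume "x \<in> {a<..<b} - (N \<union> N')"
    then show "(f has_vector_derivative g' x) (at x)" using assms(3)[of x] N'(2)[of x] by auto
  qed
qed

lemma ac_deriv_cong:
  assumes "ac_deriv a b f g" "\<And>x. x \<in> {a<..<b} \<Longrightarrow> g x = g' x"
  shows "ac_deriv a b f g'"
  using ac_deriv_spike[OF assms(1) negligible_empty] assms(2) by auto

lemma ac_deriv_transform:
  assumes "ac_deriv a b f g" "\<And>x. x \<in> {a..b} \<Longrightarrow> f x = f' x"
  shows "ac_deriv a b f' g"
proof -
  obtain N where N: "negligible N" "\<And>x. x \<in> {a<..<b} - N \<Longrightarrow> (f has_vector_derivative g x) (at x)"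
    using ac_derivD[OF assms(1)] by blast
  show ?thesis
  proof (rule ac_derivI[OF _ N(1)])
    show "abs_continuous_on a b f'"
      by (rule abs_continuous_on_dominated[of a b f f _ 1])
         (use ac_deriv_abs_continuous[OF assms(1)] assms(2) in auto)
    fix x assume x: "x \<in> {a<..<b} - N"
    then show "(f' has_vector_derivative g x) (at x)"
      using has_vector_derivative_transform_within_open[OF N(2)[OF x], of "{a<..<b}" f'] assms(2) by auto
  qed
qed

lemma abs_continuous_on_bounded:
  assumes "abs_continuous_on a b f"
  obtains B where "B > 0" "\<And>x. x \<in> {a..b} \<Longrightarrow> norm (f x) \<le> B"
proof -
  have "bounded (f ` {a..b})"
    using abs_continuous_on_imp_continuous_on[OF assms] by (simp add: compact_continuous_image compact_imp_bounded)
  then show ?thesis using that unfolding bounded_pos by auto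
qed

text \<open>One product rule serves all pairings that occur: real products, scalar times vector,
  matrix products, matrix times vector and the Hermitian form.\<close>

lemma ac_deriv_bilinear:
  fixes f :: "real \<Rightarrow> 'a::real_normed_vector" and g :: "real \<Rightarrow> 'b::real_normed_vector"
    and prod :: "'a \<Rightarrow> 'b \<Rightarrow> 'c::real_normed_vector"
  assumes p: "bounded_bilinear prod" and f: "ac_deriv a b f f'" and g: "ac_deriv a b g g'"
  shows "ac_deriv a b (\<lambda>x. prod (f x) (g x)) (\<lambda>x. prod (f x) (g' x) + prod (f' x) (g x))"
proof -
  interpret bounded_bilinear prod by (rule p)
  obtain N where N: "negligible N" "\<And>x. x \<in> {a<..<b} - N \<Longrightarrow> (f has_vector_derivative f' x) (at x)"
    using ac_derivD[OF f] by blast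
  obtain N' where N': "negligible N'" "\<And>x. x \<in> {a<..<b} - N' \<Longrightarrow> (g has_vector_derivative g' x) (at x)"
    using ac_derivD[OF g] by blast
  obtain B where B: "B > 0" "\<And>x. x \<in> {a..b} \<Longrightarrow> norm (f x) \<le> B"
    using abs_continuous_on_bounded[OF ac_deriv_abs_continuous[OF f]] by blast
  obtain C where C: "C > 0" "\<And>x. x \<in> {a..b} \<Longrightarrow> norm (g x) \<le> C"
    using abs_continuous_on_bounded[OF ac_deriv_abs_continuous[OF g]] by blast
  obtain K where K: "K > 0" "\<And>x y. norm (prod x y) \<le> norm x * norm y * K"
    using pos_bounded by blast
  show ?thesis
  proof (rule ac_derivI[of _ _ _ "N \<union> N'"])
    show "abs_continuous_on a b (\<lambda>x. prod (f x) (g x))"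
    proof (rule abs_continuous_on_dominated[OF ac_deriv_abs_continuous[OF f] ac_deriv_abs_continuous[OF g]])
      fix u v assume uv: "u \<in> {a..b}" "v \<in> {a..b}" "u \<le> v"
      have "prod (f v) (g v) - prod (f u) (g u) = prod (f v - f u) (g v) + prod (f u) (g v - g u)"
        by (simp add: diff_left diff_right)
      then have "norm (prod (f v) (g v) - prod (f u) (g u)) \<le> norm (f v - f u) * norm (g v) * K + norm (f u) * norm (g v - g u) * K"
        by (metis K(2) add_mono norm_triangle_le)
      also have "\<dots> \<le> norm (f v - f u) * C * K + B * norm (g v - g u) * K"
        using B C K uv by (intro add_mono mult_mono mult_right_mono mult_left_mono) auto
      also have "\<dots> \<le> (B + C) * K * (norm (f v - f u) + norm (g v - g u))"
        using B(1) C(1) K(1) by (simp add: algebra_simps)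
      finally show "norm (prod (f v) (g v) - prod (f u) (g u)) \<le> \<dots>" .
    qed
    show "negligible (N \<union> N')" using N N' by auto
    show "((\<lambda>x. prod (f x) (g x)) has_vector_derivative prod (f x) (g' x) + prod (f' x) (g x)) (at x)"
      if "x \<in> {a<..<b} - (N \<union> N')" for x
      using has_vector_derivative[OF N(2) N'(2)] that by auto
  qed
qed

lemma ac_deriv_linear:
  assumes h: "bounded_linear h" and f: "ac_deriv a b f f'"
  shows "ac_deriv a b (\<lambda>x. h (f x)) (\<lambda>x. h (f' x))"
proof -
  interpret bounded_linear h by (rule h)
  obtain N where N: "negligible N" "\<And>x. x \<in> {a<..<b} - N \<Longrightarrow> (f has_vector_derivative f' x) (at x)"
    using ac_derivD[OF f] by blast
  obtain K where K: "K > 0" "\<And>x. norm (h x) \<le> norm x * K"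
    using pos_bounded by blast
  show ?thesis
  proof (rule ac_derivI[OF _ N(1)])
    show "abs_continuous_on a b (\<lambda>x. h (f x))"
    proof (rule abs_continuous_on_dominated[OF ac_deriv_abs_continuous[OF f] ac_deriv_abs_continuous[OF f]])
      fix u v
      have "norm (h (f v) - h (f u)) \<le> norm (f v - f u) * K" using K(2)[of "f v - f u"] by (simp add: diff)
      also have "\<dots> \<le> K * (norm (f v - f u) + norm (f v - f u))" using K(1) by (simp add: algebra_simps)
      finally show "norm (h (f v) - h (f u)) \<le> \<dots>" .
    qed
    show "((\<lambda>x. h (f x)) has_vector_derivative h (f' x)) (at x)" if "x \<in> {a<..<b} - N" for x
      using has_vector_derivative[OF N(2)[OF that]] .
  qed
qed

lemma ac_deriv_add:
  assumes f: "ac_deriv a b f f'" and g: "ac_deriv a b g g'"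
  shows "ac_deriv a b (\<lambda>x. f x + g x) (\<lambda>x. f' x + g' x)"
proof -
  obtain N where N: "negligible N" "\<And>x. x \<in> {a<..<b} - N \<Longrightarrow> (f has_vector_derivative f' x) (at x)"
    using ac_derivD[OF f] by blast
  obtain N' where N': "negligible N'" "\<And>x. x \<in> {a<..<b} - N' \<Longrightarrow> (g has_vector_derivative g' x) (at x)"
    using ac_derivD[OF g] by blast
  show ?thesis
  proof (rule ac_derivI[of _ _ _ "N \<union> N'"])
    show "abs_continuous_on a b (\<lambda>x. f x + g x)"
      by (rule abs_continuous_on_dominated[OF ac_deriv_abs_continuous[OF f] ac_deriv_abs_continuous[OF g], of _ 1])
        (simp add: add_diff_add norm_triangle_ineq)
    show "negligible (N \<union> N')" using N N' by auto
    show "((\<lambda>x. f x + g x) has_vector_derivative f' x + g' x) (at x)"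
      if "x \<in> {a<..<b} - (N \<union> N')" for x
      using N N' that by (intro has_vector_derivative_add) auto
  qed
qed

lemma ac_deriv_minus: "ac_deriv a b f f' \<Longrightarrow> ac_deriv a b (\<lambda>x. - f x) (\<lambda>x. - f' x)"
  by (rule ac_deriv_linear[OF bounded_linear_minus[OF bounded_linear_ident]])

lemma ac_deriv_diff:
  assumes f: "ac_deriv a b f f'" and g: "ac_deriv a b g g'"
  shows "ac_deriv a b (\<lambda>x. f x - g x) (\<lambda>x. f' x - g' x)"
  using ac_deriv_add[OF f ac_deriv_minus[OF g]] by simp

lemma ac_deriv_const: "ac_deriv a b (\<lambda>x. c) (\<lambda>x. 0)"
proof (rule ac_derivI[OF _ negligible_empty])
  show "abs_continuous_on a b (\<lambda>x. c)" by (rule abs_continuous_on_lipschitz[of _ _ _ 0]) simp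
qed simp

lemma ac_deriv_C1:
  fixes f :: "real \<Rightarrow> 'a::real_normed_vector"
  assumes d: "\<And>x. (f has_vector_derivative g x) (at x)" and c: "continuous_on {a..b} g"
  shows "ac_deriv a b f g"
proof (rule ac_derivI[OF _ negligible_empty])
  have "bounded (g ` {a..b})" using c by (simp add: compact_continuous_image compact_imp_bounded)
  then obtain B where B: "\<And>x. x \<in> {a..b} \<Longrightarrow> norm (g x) \<le> B" unfolding bounded_pos by blast
  show "abs_continuous_on a b f"
  proof (rule abs_continuous_on_lipschitz)
    fix u v assume uv: "u \<in> {a..b}" "v \<in> {a..b}" "u \<le> v"
    have "norm (f v - f u) \<le> B * norm (v - u)"
    proof (rule differentiable_bound[of "{a..b}" f "\<lambda>x h. h *\<^sub>R g x"])
      show "(f has_derivative (\<lambda>h. h *\<^sub>R g x)) (at x within {a..b})" for x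
        using d has_derivative_at_withinI unfolding has_vector_derivative_def by blast
      show "onorm (\<lambda>h. h *\<^sub>R g x) \<le> B" if "x \<in> {a..b}" for x
        by (rule onorm_le) (use B[OF that] in \<open>auto intro: order_trans[OF mult_left_mono] simp: mult.commute\<close>)
    qed (use uv in auto)
    then show "norm (f v - f u) \<le> B * (v - u)" using uv by simp
  qed
qed (use d in auto)

text \<open>The continuous function \<open>f\<close> has bounded range, and \<open>h\<close> is
  Lipschitz on bounded intervals; that is what preserves absolute continuity.\<close>

lemma ac_deriv_compose:
  fixes f :: "real \<Rightarrow> real"
  assumes f: "ac_deriv a b f f'" and h: "\<And>y. (h has_real_derivative h' y) (at y)" and c: "continuous_on UNIV h'"
  shows "ac_deriv a b (\<lambda>x. h (f x)) (\<lambda>x. h' (f x) * f' x)"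
proof -
  obtain N where N: "negligible N" "\<And>x. x \<in> {a<..<b} - N \<Longrightarrow> (f has_vector_derivative f' x) (at x)"
    using ac_derivD[OF f] by blast
  obtain B where B: "B > 0" "\<And>x. x \<in> {a..b} \<Longrightarrow> norm (f x) \<le> B"
    using abs_continuous_on_bounded[OF ac_deriv_abs_continuous[OF f]] by blast
  have "bounded (h' ` {-B..B})" using c
    by (meson compact_continuous_image compact_imp_bounded compact_Icc continuous_on_subset subset_UNIV)
  then obtain C where C: "\<And>x. x \<in> {-B..B} \<Longrightarrow> norm (h' x) \<le> C" "C > 0" unfolding bounded_pos by blast
  show ?thesis
  proof (rule ac_derivI[OF _ N(1)])
    show "abs_continuous_on a b (\<lambda>x. h (f x))"
    proof (rule abs_continuous_on_dominated[OF ac_deriv_abs_continuous[OF f] ac_deriv_abs_continuous[OF f]])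
      fix u v assume uv: "u \<in> {a..b}" "v \<in> {a..b}" "u \<le> v"
      then have in': "f u \<in> {-B..B}" "f v \<in> {-B..B}" using B(2)[of u] B(2)[of v] by auto
      have "norm (h (f v) - h (f u)) \<le> C * norm (f v - f u)"
        by (rule field_differentiable_bound[of "{-B..B}" h h'])
           (use in' C h in \<open>auto intro: has_field_derivative_at_within\<close>)
      also have "\<dots> \<le> C * (norm (f v - f u) + norm (f v - f u))" using C(2) by (simp add: algebra_simps)
      finally show "norm (h (f v) - h (f u)) \<le> \<dots>" .
    qed
    show "((\<lambda>x. h (f x)) has_vector_derivative h' (f x) * f' x) (at x)" if "x \<in> {a<..<b} - N" for x
      using DERIV_chain2[OF h, of f "f' x" x] N(2)[OF that] by (simp add: has_real_derivative_iff_has_vector_derivative)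
  qed
qed

text \<open>Absolute continuity is decisive: the Cantor function also has derivative 0 almost
  everywhere.\<close>

lemma ac_deriv_zero_imp_const:
  fixes f :: "real \<Rightarrow> 'a::banach"
  assumes "ac_deriv a b f (\<lambda>x. 0)" "x \<in> {a..b}"
  shows "f x = f a"
proof -
  have "((\<lambda>x. 0 :: 'a) has_integral f x - f a) {a..x}"
    using assms by (intro ac_deriv_has_integral ac_deriv_subset[OF assms(1)]) auto
  then show ?thesis using has_integral_0 has_integral_unique by (metis eq_iff_diff_eq_0)
qed

lemma ac_deriv_nonpos:
  fixes f :: "real \<Rightarrow> real"
  assumes "ac_deriv a b f g" "a \<le> b" "\<And>x. x \<in> {a..b} \<Longrightarrow> g x \<le> 0"
  shows "f b \<le> f a"
proof -
  have "(g has_integral f b - f a) {a..b}" using ac_deriv_has_integral assms by blast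
  then have "f b - f a \<le> 0" using has_integral_le[OF _ has_integral_0] assms(3) by blast
  then show ?thesis by simp
qed

lemma ac_deriv_norm_bound:
  fixes f :: "real \<Rightarrow> 'a::euclidean_space"
  assumes "ac_deriv a b f g" "a \<le> b" "\<And>x. x \<in> {a..b} \<Longrightarrow> norm (g x) \<le> k x" "k integrable_on {a..b}"
  shows "norm (f b - f a) \<le> integral {a..b} k"
proof -
  have "(g has_integral f b - f a) {a..b}" using ac_deriv_has_integral assms by blast
  then show ?thesis using integral_norm_bound_integral[of g "{a..b}" k] assms(3,4)
    by (metis has_integral_iff)
qed

section \<open>Gronwall's inequality and bounded bilinear matrix operations\<close>

lemma absolutely_integrable_bilinear_continuous:
  fixes f :: "real \<Rightarrow> 'a::euclidean_space" and g :: "real \<Rightarrow> 'b::euclidean_space"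
    and prod :: "'a \<Rightarrow> 'b \<Rightarrow> 'c::euclidean_space"
  assumes "bounded_bilinear prod" "f absolutely_integrable_on {a..b}" "continuous_on {a..b} g"
  shows "(\<lambda>x. prod (f x) (g x)) absolutely_integrable_on {a..b}"
proof -
  have b: "bilinear (\<lambda>x y. prod y x)"
    using bounded_bilinear.flip[OF assms(1)] bilinear_conv_bounded_bilinear by blast
  have "g \<in> borel_measurable (lebesgue_on {a..b})"
    using assms(3) by (simp add: continuous_imp_measurable_on_sets_lebesgue)
  moreover have "bounded (g ` {a..b})" 
    using assms(3) by (simp add: compact_continuous_image compact_imp_bounded)
  ultimately show ?thesis
    using absolutely_integrable_bounded_measurable_product[OF b, of g "{a..b}" f] assms(2) by auto
qed

text \<open>\<open>W\<close> is the right-hand side of the integral inequality. Multiplied by the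
  integrating factor \<open>E\<close> it has derivative \<open>h * E * (u - W)\<close>, which is not
  positive.\<close>

lemma Gronwall:
  fixes u h :: "real \<Rightarrow> real"
  assumes h: "h absolutely_integrable_on {a..b}" "\<And>x. h x \<ge> 0"
    and u: "continuous_on {a..b} u" "\<And>x. x \<in> {a..b} \<Longrightarrow> u x \<le> c + integral {a..x} (\<lambda>t. h t * u t)"
    and x: "x \<in> {a..b}"
  shows "u x \<le> c * exp (integral {a..x} h)"
proof -
  define W where "W x = c + integral {a..x} (\<lambda>t. h t * u t)" for x
  define E where "E x = exp (- integral {a..x} h)" for x
  have hu: "(\<lambda>t. h t * u t) absolutely_integrable_on {a..b}"
    by (rule absolutely_integrable_bilinear_continuous[OF bounded_bilinear_mult h(1) u(1)])
  have W: "ac_deriv a b W (\<lambda>t. h t * u t)"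
    using ac_deriv_add[OF ac_deriv_const ac_deriv_integral[OF hu]] unfolding W_def by simp
  have E: "ac_deriv a b E (\<lambda>t. E t * - h t)"
    unfolding E_def
    by (rule ac_deriv_compose[OF ac_deriv_minus[OF ac_deriv_integral[OF h(1)]], of exp exp])
       (auto intro!: continuous_intros)
  have WE: "ac_deriv a x (\<lambda>t. W t * E t) (\<lambda>t. W t * (E t * - h t) + h t * u t * E t)"
    by (rule ac_deriv_subset[OF ac_deriv_bilinear[OF bounded_bilinear_mult W E]]) (use x in auto)
  have "W x * E x \<le> W a * E a"
  proof (rule ac_deriv_nonpos[OF WE])
    fix t assume "t \<in> {a..x}"
    then have "u t \<le> W t" using u(2)[of t] x by (auto simp: W_def)
    then have "h t * E t * (u t - W t) \<le> 0" using h(2)[of t] by (intro mult_nonneg_nonpos) (auto simp: E_def)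
    then show "W t * (E t * - h t) + h t * u t * E t \<le> 0" by (simp add: algebra_simps)
  qed (use x in auto)
  then have "W x * E x \<le> c" by (simp add: W_def E_def)
  then have "W x \<le> c * exp (integral {a..x} h)" by (simp add: E_def exp_minus field_simps)
  then show ?thesis using u(2)[OF x] unfolding W_def by linarith
qed

lemma bounded_bilinear_matrix_mult: "bounded_bilinear ((**) :: complex^'m^'n \<Rightarrow> complex^'k^'m \<Rightarrow> complex^'k^'n)"
  unfolding bilinear_conv_bounded_bilinear[symmetric] bilinear_def
  by (auto intro!: linearI simp: vec_eq_iff matrix_matrix_mult_def scaleR_sum_right
      sum.distrib distrib_left distrib_right)

lemma bounded_bilinear_matrix_vector_mult: "bounded_bilinear ((*v) :: complex^'m^'n \<Rightarrow> complex^'m \<Rightarrow> complex^'n)"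
  unfolding bilinear_conv_bounded_bilinear[symmetric] bilinear_def
  by (auto intro!: linearI simp: vec_eq_iff matrix_vector_mult_def
      scaleR_sum_right sum.distrib distrib_left distrib_right)

lemma bounded_bilinear_vector_smult: "bounded_bilinear ((*s) :: complex \<Rightarrow> complex^'m \<Rightarrow> complex^'m)"
  unfolding bilinear_conv_bounded_bilinear[symmetric] bilinear_def
  by (auto intro!: linearI simp: vec_eq_iff vector_smult_lid distrib_left distrib_right)

lemma bounded_linear_conj_transpose: "bounded_linear (conj_transpose :: complex^'m^'n \<Rightarrow> complex^'n^'m)"
  unfolding linear_conv_bounded_linear[symmetric]
  by (auto intro!: linearI simp: vec_eq_iff conj_transpose_def)

section \<open>Solutions of the matrix equation\<close>

notation conj_transpose ("(_\<^sup>\<dagger>)" [1000] 999)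

interpretation mm: bounded_bilinear "(**) :: complex^'m^'n \<Rightarrow> complex^'k^'m \<Rightarrow> complex^'k^'n"
  by (rule bounded_bilinear_matrix_mult)
interpretation mv: bounded_bilinear "(*v) :: complex^'m^'n \<Rightarrow> complex^'m \<Rightarrow> complex^'n"
  by (rule bounded_bilinear_matrix_vector_mult)
interpretation sv: bounded_bilinear "(*s) :: complex \<Rightarrow> complex^'m \<Rightarrow> complex^'m"
  by (rule bounded_bilinear_vector_smult)

lemma conj_transpose_add: "(A + B)\<^sup>\<dagger> = A\<^sup>\<dagger> + B\<^sup>\<dagger>"
  by (simp add: vec_eq_iff conj_transpose_def)

lemma conj_transpose_diff: "(A - B)\<^sup>\<dagger> = A\<^sup>\<dagger> - B\<^sup>\<dagger>"
  by (simp add: vec_eq_iff conj_transpose_def)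

lemma conj_transpose_zero [simp]: "0\<^sup>\<dagger> = 0"
  by (simp add: vec_eq_iff conj_transpose_def)

section \<open>Existence for linear systems with integrable coefficients\<close>

text \<open>Picard iteration. Measured against the weight \<open>exp (2 * H x)\<close>, with
  \<open>H\<close> the integral of a multiple of the coefficient's norm, each step contracts by 1/2
  on the whole interval at once, although the coefficient is merely integrable.\<close>

lemma linear_ode_exists:
  fixes A :: "real \<Rightarrow> 'b::euclidean_space" and prod :: "'b \<Rightarrow> 'a \<Rightarrow> 'a::euclidean_space" and c :: 'a
  assumes p: "bounded_bilinear prod" and A: "A absolutely_integrable_on {0..b}"
  shows "\<exists>U. continuous_on {0..b} U \<and> (\<forall>x\<in>{0..b}. U x = c + integral {0..x} (\<lambda>t. prod (A t) (U t)))"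
proof -
  interpret bounded_bilinear prod by (rule p)
  obtain K where K: "K > 0" "\<And>x y. norm (prod x y) \<le> norm x * norm y * K"
    using pos_bounded by blast
  define h where "h t = K * norm (A t)" for t
  have nA: "(\<lambda>t. norm (A t)) absolutely_integrable_on {0..b}"
    using absolutely_integrable_norm[OF A] by (simp add: o_def)
  have h: "h absolutely_integrable_on {0..b}" unfolding h_def
    using absolutely_integrable_bilinear_continuous[OF bounded_bilinear_mult nA, of "\<lambda>t. K"]
    by (simp add: mult.commute)
  have h0: "h t \<ge> 0" for t using K by (simp add: h_def)
  define H where "H x = integral {0..x} h" for x
  have H: "ac_deriv 0 b H h" unfolding H_def by (rule ac_deriv_integral[OF h])
  define w where "w x = exp (2 * H x)" for x
  have w: "ac_deriv 0 b w (\<lambda>x. 2 * w x * h x)" unfolding w_def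
    by (rule ac_deriv_compose[OF H, of "\<lambda>y. exp (2 * y)" "\<lambda>y. 2 * exp (2 * y)"])
       (auto intro!: derivative_eq_intros continuous_intros)
  have w0: "w 0 = 1" by (simp add: w_def H_def)
  \<comment> \<open>\<open>h * w\<close> is half of the derivative of \<open>w\<close>; here the
    factor 2 in the exponent turns into the contraction constant.\<close>
  have wint: "((\<lambda>t. h t * w t) has_integral (w x - 1) / 2) {0..x}" if "x \<in> {0..b}" for x
  proof -
    have "((\<lambda>x. 2 * w x * h x) has_integral w x - w 0) {0..x}"
      by (rule ac_deriv_has_integral[OF ac_deriv_subset[OF w]]) (use that in auto)
    from has_integral_mult_right[OF this, of "1/2"] show ?thesis by (simp add: w0 mult.commute mult.left_commute)
  qed
  have w1: "w x \<ge> 1" if "x \<in> {0..b}" for x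
  proof -
    have "0 \<le> integral {0..x} (\<lambda>t. h t * w t)" using wint[OF that] h0 by (intro integral_nonneg) (auto simp: w_def)
    then show ?thesis using wint[OF that] by (simp add: integral_unique)
  qed
  obtain wm where wm: "wm > 0" "\<And>x. x \<in> {0..b} \<Longrightarrow> norm (w x) \<le> wm"
    using abs_continuous_on_bounded[OF ac_deriv_abs_continuous[OF w]] by blast
  have pint: "(\<lambda>t. prod (A t) (V t)) absolutely_integrable_on {0..b}" if "continuous_on {0..b} V" for V
    by (rule absolutely_integrable_bilinear_continuous[OF p A that])
  \<comment> \<open>The terms of the Neumann series; their partial sums are the Picard
    iterates.\<close>
  define V where "V = rec_nat (\<lambda>x. c) (\<lambda>n V x. integral {0..x} (\<lambda>t. prod (A t) (V t)))"
  have V0: "V 0 x = c" and VS: "V (Suc n) x = integral {0..x} (\<lambda>t. prod (A t) (V n t))" for n x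
    by (simp_all add: V_def)
  have Vc: "continuous_on {0..b} (V n)" for n
  proof (induction n)
    case (Suc n)
    then show ?case unfolding VS using ac_derivD_continuous[OF ac_deriv_integral[OF pint]] by blast
  qed (simp add: V0)
  have pintx: "(\<lambda>t. prod (A t) (V t)) integrable_on {0..x}" if "continuous_on {0..b} V" "x \<in> {0..b}" for V x
    using integrable_subinterval_real[OF set_lebesgue_integral_eq_integral(1)[OF pint[OF that(1)]], of 0 x] that by auto
  have Vb: "norm (V n x) \<le> norm c * (1/2)^n * w x" if "x \<in> {0..b}" for n x
    using that
  proof (induction n arbitrary: x)
    case 0
    then show ?case using w1[OF 0] mult_left_mono[of 1 "w x" "norm c"] by (simp add: V0)
  next
    case (Suc n)
    have "norm (V (Suc n) x) \<le> integral {0..x} (\<lambda>t. norm c * (1/2)^n * (h t * w t))"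
      unfolding VS
    proof (rule integral_norm_bound_integral[OF pintx[OF Vc Suc.prems]])
      show "(\<lambda>t. norm c * (1/2)^n * (h t * w t)) integrable_on {0..x}"
        using wint[OF Suc.prems] by (intro integrable_on_mult_right) auto
      fix t assume "t \<in> {0..x}"
      then have t: "t \<in> {0..b}" using Suc.prems by auto
      have "norm (prod (A t) (V n t)) \<le> h t * norm (V n t)" using K(2)[of "A t" "V n t"]
        by (simp add: h_def mult_ac)
      also have "\<dots> \<le> h t * (norm c * (1/2)^n * w t)" using Suc.IH[OF t] h0 by (intro mult_left_mono)
      finally show "norm (prod (A t) (V n t)) \<le> norm c * (1/2)^n * (h t * w t)" by (simp add: mult_ac)
    qed
    also have "\<dots> = norm c * (1/2)^n * ((w x - 1) / 2)"
      using wint[OF Suc.prems] by (simp add: integral_unique)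
    also have "\<dots> \<le> norm c * (1/2)^n * (w x / 2)"
      by (intro mult_left_mono) auto
    finally show ?case by simp
  qed
  have lim: "uniform_limit {0..b} (\<lambda>n x. \<Sum>i<n. V i x) (\<lambda>x. \<Sum>i. V i x) sequentially"
  proof (rule Weierstrass_m_test)
    show "norm (V n x) \<le> norm c * wm * (1/2)^n" if "x \<in> {0..b}" for n x
    proof -
      have "norm c * (1/2)^n * w x \<le> norm c * (1/2)^n * wm"
        using wm(2)[OF that] by (intro mult_left_mono) auto
      then show ?thesis using Vb[OF that, of n] by (simp add: mult_ac)
    qed
    show "summable (\<lambda>n. norm c * wm * (1/2)^n)" by (intro summable_mult summable_geometric) simp
  qed
  define U where "U x = (\<Sum>i. V i x)" for x
  have Sc: "continuous_on {0..b} (\<lambda>x. \<Sum>i<n. V i x)" for n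
    using Vc by (intro continuous_on_sum) auto
  have Uc: "continuous_on {0..b} U" unfolding U_def
    by (rule uniform_limit_theorem[OF _ lim]) (use Sc in auto)
  show ?thesis
  proof (intro exI[of _ U] conjI ballI Uc)
    fix x assume x: "x \<in> {0..b}"
    have eqn: "(\<Sum>i<Suc n. V i x) = c + integral {0..x} (\<lambda>t. prod (A t) (\<Sum>i<n. V i t))" for n
    proof -
      have "(\<Sum>i<Suc n. V i x) = c + (\<Sum>i<n. V (Suc i) x)" by (subst sum.lessThan_Suc_shift) (simp add: V0)
      also have "(\<Sum>i<n. V (Suc i) x) = integral {0..x} (\<lambda>t. \<Sum>i<n. prod (A t) (V i t))"
        unfolding VS by (rule integral_sum[symmetric]) (use pintx[OF Vc x] in auto)
      finally show ?thesis by (simp add: sum_right)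
    qed
    have l1: "(\<lambda>n. \<Sum>i<Suc n. V i x) \<longlonglongrightarrow> U x"
      using tendsto_uniform_limitI[OF lim x] unfolding U_def by (rule LIMSEQ_Suc)
    have hx: "h integrable_on {0..x}" using integrable_subinterval_real[OF set_lebesgue_integral_eq_integral(1)[OF h], of 0 x] x by auto
    have "(\<lambda>n. integral {0..x} (\<lambda>t. prod (A t) (\<Sum>i<n. V i t))) \<longlonglongrightarrow> integral {0..x} (\<lambda>t. prod (A t) (U t))"
      unfolding LIMSEQ_def
    proof (intro allI impI)
      fix e :: real assume "e > 0"
      have Hx: "H x \<ge> 0" unfolding H_def using h0 hx by (intro integral_nonneg) auto
      define d where "d = e / (H x + 1) / 2"
      have d: "d > 0" using \<open>e > 0\<close> Hx by (simp add: d_def)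
      obtain N where N: "\<And>n t. n \<ge> N \<Longrightarrow> t \<in> {0..b} \<Longrightarrow> dist (\<Sum>i<n. V i t) (U t) < d"
        using lim d unfolding uniform_limit_iff eventually_sequentially U_def by meson
      show "\<exists>no. \<forall>n\<ge>no. dist (integral {0..x} (\<lambda>t. prod (A t) (\<Sum>i<n. V i t))) (integral {0..x} (\<lambda>t. prod (A t) (U t))) < e"
      proof (intro exI[of _ N] allI impI)
        fix n assume n: "n \<ge> N"
        have "dist (integral {0..x} (\<lambda>t. prod (A t) (\<Sum>i<n. V i t))) (integral {0..x} (\<lambda>t. prod (A t) (U t)))
           = norm (integral {0..x} (\<lambda>t. prod (A t) (\<Sum>i<n. V i t) - prod (A t) (U t)))"
          unfolding dist_norm by (subst Henstock_Kurzweil_Integration.integral_diff) (use pintx[OF Sc x] pintx[OF Uc x] in auto)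
        also have "\<dots> \<le> integral {0..x} (\<lambda>t. h t * d)"
        proof (rule integral_norm_bound_integral)
          show "(\<lambda>t. prod (A t) (\<Sum>i<n. V i t) - prod (A t) (U t)) integrable_on {0..x}"
            using pintx[OF Sc x] pintx[OF Uc x] by (rule Henstock_Kurzweil_Integration.integrable_diff)
          show "(\<lambda>t. h t * d) integrable_on {0..x}" using hx by (rule integrable_on_mult_left)
          fix t assume "t \<in> {0..x}"
          then have t: "t \<in> {0..b}" using x by auto
          have "norm (prod (A t) (\<Sum>i<n. V i t) - prod (A t) (U t)) \<le> h t * norm ((\<Sum>i<n. V i t) - U t)"
            using K(2)[of "A t" "(\<Sum>i<n. V i t) - U t"] by (simp add: h_def diff_right mult_ac)
          also have "\<dots> \<le> h t * d" using N[OF n t] h0 by (intro mult_left_mono) (auto simp: dist_norm)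
          finally show "norm (prod (A t) (\<Sum>i<n. V i t) - prod (A t) (U t)) \<le> h t * d" .
        qed
        also have "\<dots> = H x * d" by (simp add: H_def)
        also have "\<dots> < (H x + 1) * d * 2" using mult_nonneg_nonneg[OF Hx less_imp_le[OF d]] d by (simp add: algebra_simps)
        also have "\<dots> = e" using Hx unfolding d_def by (simp add: divide_simps)
        finally show "dist (integral {0..x} (\<lambda>t. prod (A t) (\<Sum>i<n. V i t))) (integral {0..x} (\<lambda>t. prod (A t) (U t))) < e" .
      qed
    qed
    then have "(\<lambda>n. \<Sum>i<Suc n. V i x) \<longlonglongrightarrow> c + integral {0..x} (\<lambda>t. prod (A t) (U t))"
      unfolding eqn by (intro tendsto_intros)
    then show "U x = c + integral {0..x} (\<lambda>t. prod (A t) (U t))" using l1 LIMSEQ_unique by blast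
  qed
qed

lemma mat_mult_scale: "mat lam ** (A :: complex^'m^'n) = (\<chi> i j. lam * A $ i $ j)"
  by (simp add: vec_eq_iff matrix_matrix_mult_def mat_def if_distrib[of "\<lambda>x. x * _"] cong: if_cong)

lemma mat_mult_vec_scale: "mat lam *v (v :: complex^'n) = lam *s v"
  by (simp add: vec_eq_iff matrix_vector_mult_def mat_def if_distrib[of "\<lambda>x. x * _"] cong: if_cong)

lemma conj_transpose_mult: "(A ** B)\<^sup>\<dagger> = B\<^sup>\<dagger> ** A\<^sup>\<dagger>"
  by (simp add: vec_eq_iff conj_transpose_def matrix_matrix_mult_def mult.commute)

lemma conj_transpose_mat [simp]: "(mat c)\<^sup>\<dagger> = mat (cnj c)"
  by (auto simp: vec_eq_iff conj_transpose_def mat_def)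

section \<open>The second order equation as a pair of first order ones\<close>

text \<open>The equation determines the second derivative, so the existential quantifier goes away,
  and the vector and matrix equations take the form of \<open>ac_deriv\<close>.\<close>

lemma AE_solution_iff:
  fixes DY :: "real \<Rightarrow> 'a::real_normed_vector" and F G :: "real \<Rightarrow> 'a"
  shows "(AE x in lebesgue_on {0<..<pi}. \<exists>D2. (DY has_vector_derivative D2) (at x) \<and> - D2 + F x = G x)
     \<longleftrightarrow> (\<exists>N. negligible N \<and> (\<forall>x\<in>{0<..<pi} - N. (DY has_vector_derivative (F x - G x)) (at x)))"
proof -
  have "(\<exists>D2. (DY has_vector_derivative D2) (at x) \<and> - D2 + F x = G x) \<longleftrightarrow> (DY has_vector_derivative (F x - G x)) (at x)" for x
  proof
    assume "\<exists>D2. (DY has_vector_derivative D2) (at x) \<and> - D2 + F x = G x"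
    then obtain D2 where D2: "(DY has_vector_derivative D2) (at x)" "- D2 + F x = G x" by blast
    then have "D2 = F x - G x" by (simp add: algebra_simps)
    then show "(DY has_vector_derivative (F x - G x)) (at x)" using D2 by simp
  qed (auto intro!: exI[of _ "F x - G x"])
  then show ?thesis by (simp add: AE_lebesgue_on_iff_negligible)
qed

lemma matrix_solution_iff:
  "matrix_solution Q lam Y DY \<longleftrightarrow> 
    (\<forall>x\<in>{0..pi}. (Y has_vector_derivative DY x) (at x within {0..pi})) \<and>
    ac_deriv 0 pi Y DY \<and> ac_deriv 0 pi DY (\<lambda>x. Q x ** Y x - mat lam ** Y x)"
proof -
  have "(Y has_vector_derivative DY x) (at x)" if "\<forall>x\<in>{0..pi}. (Y has_vector_derivative DY x) (at x within {0..pi})" "x \<in> {0<..<pi}" for x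
    using that(1)[rule_format, of x] that(2) at_within_Icc_at[of 0 x pi] by simp
  then have "(\<forall>x\<in>{0..pi}. (Y has_vector_derivative DY x) (at x within {0..pi})) \<Longrightarrow> abs_continuous_on 0 pi Y \<longleftrightarrow> ac_deriv 0 pi Y DY"
    using ac_derivI[OF _ negligible_empty, of 0 pi Y DY] ac_deriv_abs_continuous by auto
  then show ?thesis
    unfolding matrix_solution_def AE_solution_iff ac_deriv_def[of 0 pi DY] by blast
qed

lemma vector_solution_iff:
  "vector_solution Q lam Y DY \<longleftrightarrow> 
    (\<forall>x\<in>{0..pi}. (Y has_vector_derivative DY x) (at x within {0..pi})) \<and>
    ac_deriv 0 pi Y DY \<and> ac_deriv 0 pi DY (\<lambda>x. Q x *v Y x - lam *s Y x)"
proof -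
  have "(Y has_vector_derivative DY x) (at x)" if "\<forall>x\<in>{0..pi}. (Y has_vector_derivative DY x) (at x within {0..pi})" "x \<in> {0<..<pi}" for x
    using that(1)[rule_format, of x] that(2) at_within_Icc_at[of 0 x pi] by simp
  then have "(\<forall>x\<in>{0..pi}. (Y has_vector_derivative DY x) (at x within {0..pi})) \<Longrightarrow> abs_continuous_on 0 pi Y \<longleftrightarrow> ac_deriv 0 pi Y DY"
    using ac_derivI[OF _ negligible_empty, of 0 pi Y DY] ac_deriv_abs_continuous by auto
  then show ?thesis
    unfolding vector_solution_def AE_solution_iff ac_deriv_def[of 0 pi DY] by blast
qed

lemma matrix_solutionD:
  assumes "matrix_solution Q lam Y DY"
  shows "\<And>x. x \<in> {0..pi} \<Longrightarrow> (Y has_vector_derivative DY x) (at x within {0..pi})"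
    "ac_deriv 0 pi Y DY" "ac_deriv 0 pi DY (\<lambda>x. Q x ** Y x - mat lam ** Y x)"
  using assms unfolding matrix_solution_iff by blast+

lemma matrix_solutionI:
  assumes "\<And>x. x \<in> {0..pi} \<Longrightarrow> (Y has_vector_derivative DY x) (at x within {0..pi})"
    "ac_deriv 0 pi Y DY" "ac_deriv 0 pi DY (\<lambda>x. Q x ** Y x - mat lam ** Y x)"
  shows "matrix_solution Q lam Y DY"
  using assms unfolding matrix_solution_iff by blast

lemma vector_solutionD:
  assumes "vector_solution Q lam Y DY"
  shows "\<And>x. x \<in> {0..pi} \<Longrightarrow> (Y has_vector_derivative DY x) (at x within {0..pi})"
    "ac_deriv 0 pi Y DY" "ac_deriv 0 pi DY (\<lambda>x. Q x *v Y x - lam *s Y x)"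
  using assms unfolding vector_solution_iff by blast+

lemma vector_solutionI:
  assumes "\<And>x. x \<in> {0..pi} \<Longrightarrow> (Y has_vector_derivative DY x) (at x within {0..pi})"
    "ac_deriv 0 pi Y DY" "ac_deriv 0 pi DY (\<lambda>x. Q x *v Y x - lam *s Y x)"
  shows "vector_solution Q lam Y DY"
  using assms unfolding vector_solution_iff by blast

lemma matrix_solution_mult_vec:
  assumes "matrix_solution Q lam Y DY"
  shows "vector_solution Q lam (\<lambda>x. Y x *v v) (\<lambda>x. DY x *v v)"
proof (rule vector_solutionI)
  note b = mv.bounded_linear_left[of v] and D = matrix_solutionD[OF assms]
  have "(Q x ** Y x - mat lam ** Y x) *v v = Q x *v (Y x *v v) - lam *s (Y x *v v)" for x
    by (simp add: mv.diff_left matrix_vector_mul_assoc[symmetric] mat_mult_vec_scale)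
  with ac_deriv_linear[OF b D(3)]
  show "ac_deriv 0 pi (\<lambda>x. DY x *v v) (\<lambda>x. Q x *v (Y x *v v) - lam *s (Y x *v v))" by simp
  show "ac_deriv 0 pi (\<lambda>x. Y x *v v) (\<lambda>x. DY x *v v)" by (rule ac_deriv_linear[OF b D(2)])
  show "((\<lambda>x. Y x *v v) has_vector_derivative DY x *v v) (at x within {0..pi})" if "x \<in> {0..pi}" for x
    by (rule bounded_linear.has_vector_derivative[OF b D(1)[OF that]])
qed

lemma matrix_solution_mult_right:
  assumes "matrix_solution Q lam Y DY"
  shows "matrix_solution Q lam (\<lambda>x. Y x ** B) (\<lambda>x. DY x ** B)"
proof (rule matrix_solutionI)
  note b = mm.bounded_linear_left[of B] and D = matrix_solutionD[OF assms]
  have "(Q x ** Y x - mat lam ** Y x) ** B = Q x ** (Y x ** B) - mat lam ** (Y x ** B)" for x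
    by (simp add: mm.diff_left matrix_mul_assoc)
  with ac_deriv_linear[OF b D(3)]
  show "ac_deriv 0 pi (\<lambda>x. DY x ** B) (\<lambda>x. Q x ** (Y x ** B) - mat lam ** (Y x ** B))" by simp
  show "ac_deriv 0 pi (\<lambda>x. Y x ** B) (\<lambda>x. DY x ** B)" by (rule ac_deriv_linear[OF b D(2)])
  show "((\<lambda>x. Y x ** B) has_vector_derivative DY x ** B) (at x within {0..pi})" if "x \<in> {0..pi}" for x
    by (rule bounded_linear.has_vector_derivative[OF b D(1)[OF that]])
qed

lemma matrix_solution_add:
  assumes Y: "matrix_solution Q lam Y DY" and Z: "matrix_solution Q lam Z DZ"
  shows "matrix_solution Q lam (\<lambda>x. Y x + Z x) (\<lambda>x. DY x + DZ x)"
proof (rule matrix_solutionI)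
  note Y = matrix_solutionD[OF Y] and Z = matrix_solutionD[OF Z]
  have "(Q x ** Y x - mat lam ** Y x) + (Q x ** Z x - mat lam ** Z x) = Q x ** (Y x + Z x) - mat lam ** (Y x + Z x)" for x
    by (simp add: mm.add_right)
  with ac_deriv_add[OF Y(3) Z(3)]
  show "ac_deriv 0 pi (\<lambda>x. DY x + DZ x) (\<lambda>x. Q x ** (Y x + Z x) - mat lam ** (Y x + Z x))" by simp
  show "ac_deriv 0 pi (\<lambda>x. Y x + Z x) (\<lambda>x. DY x + DZ x)" by (rule ac_deriv_add[OF Y(2) Z(2)])
  show "((\<lambda>x. Y x + Z x) has_vector_derivative DY x + DZ x) (at x within {0..pi})" if "x \<in> {0..pi}" for x
    by (rule has_vector_derivative_add[OF Y(1)[OF that] Z(1)[OF that]])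
qed

section \<open>Hermitian potentials and the existence of solutions\<close>

locale hermitian_potential =
  fixes Q :: "real \<Rightarrow> complex^'m^'m"
  assumes integrable: "Q absolutely_integrable_on {0<..<pi}"
    and hermitian: "AE x in lebesgue_on {0<..<pi}. Q x = (Q x)\<^sup>\<dagger>"
begin

lemma integrable': "Q absolutely_integrable_on {0..pi}"
proof -
  have "Q absolutely_integrable_on box 0 pi" using integrable by (simp add: box_real)
  then have "Q absolutely_integrable_on cbox 0 pi" by (simp only: absolutely_integrable_on_open_interval)
  then show ?thesis by (simp add: cbox_interval)
qed

definition qn :: "real \<Rightarrow> real" where "qn x = norm (Q x)"

lemma qn_integrable: "qn absolutely_integrable_on {0..pi}"
  using absolutely_integrable_norm[OF integrable'] by (simp add: o_def qn_def[abs_def])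

lemma qn_nonneg: "qn x \<ge> 0" by (simp add: qn_def)

lemma solution_exists:
  "\<exists>Y DY. matrix_solution Q lam Y DY \<and> Y 0 = c1 \<and> DY 0 = c2"
proof -
  \<comment> \<open>The constant component 1 carries the equation for \<open>Y'\<close>, so that the
    right-hand side of the first order system is bilinear in coefficient and unknown.\<close>
  define A where "A t = (Q t - mat lam, 1 :: real)" for t
  define prod :: "(complex^'m^'m) \<times> real \<Rightarrow> (complex^'m^'m) \<times> (complex^'m^'m) \<Rightarrow> (complex^'m^'m) \<times> (complex^'m^'m)"
    where "prod p U = (snd p *\<^sub>R snd U, fst p ** fst U)" for p U
  have prod: "bounded_bilinear prod"
    unfolding bilinear_conv_bounded_bilinear[symmetric] bilinear_def prod_def
    by (auto intro!: linearI simp: mm.add_left mm.add_right mm.scaleR_left mm.scaleR_right algebra_simps)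
  have A: "A absolutely_integrable_on {0..pi}"
  proof -
    have 1: "(\<lambda>t. Q t - mat lam) absolutely_integrable_on {0..pi}"
      by (intro set_integral_diff(1) integrable' absolutely_integrable_continuous_real continuous_on_const)
    have "(\<lambda>t. (Q t - mat lam, 0 :: real)) absolutely_integrable_on {0..pi}"
      using absolutely_integrable_linear[OF 1, of "\<lambda>x. (x, 0::real)"] 
      by (simp add: o_def bounded_linear_Pair bounded_linear_ident)
    moreover have "(\<lambda>t. (0 :: complex^'m^'m, 1 :: real)) absolutely_integrable_on {0..pi}"
      by (intro absolutely_integrable_continuous_real continuous_on_const)
    ultimately have "(\<lambda>t. (Q t - mat lam, 0 :: real) + (0, 1)) absolutely_integrable_on {0..pi}"
      by (rule set_integral_add(1))
    then show ?thesis by (simp add: A_def[abs_def])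
  qed
  obtain U where U: "continuous_on {0..pi} U" 
    "\<And>x. x \<in> {0..pi} \<Longrightarrow> U x = (c1, c2) + integral {0..x} (\<lambda>t. prod (A t) (U t))"
    using linear_ode_exists[OF prod A, of "(c1, c2)"] by blast
  define Y DY where "Y x = fst (U x)" and "DY x = snd (U x)" for x
  have int: "(\<lambda>t. prod (A t) (U t)) absolutely_integrable_on {0..pi}"
    by (rule absolutely_integrable_bilinear_continuous[OF prod A U(1)])
  have pe: "prod (A t) (U t) = (DY t, (Q t - mat lam) ** Y t)" for t by (simp add: prod_def A_def Y_def DY_def)
  have acU: "ac_deriv 0 pi U (\<lambda>t. prod (A t) (U t))"
  proof -
    have *: "ac_deriv 0 pi (\<lambda>x. (c1, c2) + integral {0..x} (\<lambda>t. prod (A t) (U t))) (\<lambda>t. prod (A t) (U t))"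
      using ac_deriv_add[OF ac_deriv_const ac_deriv_integral[OF int]] by simp
    show ?thesis by (rule ac_deriv_transform[OF *]) (use U(2) in auto)
  qed
  have acY: "ac_deriv 0 pi Y DY"
    using ac_deriv_linear[OF bounded_linear_fst acU] unfolding pe Y_def[symmetric] by simp
  have acDY: "ac_deriv 0 pi DY (\<lambda>t. (Q t - mat lam) ** Y t)"
    using ac_deriv_linear[OF bounded_linear_snd acU] unfolding pe DY_def[symmetric] by simp
  have DYc: "continuous_on {0..pi} DY" by (rule ac_derivD_continuous[OF acDY])
  have "matrix_solution Q lam Y DY"
  proof (rule matrix_solutionI)
    \<comment> \<open>\<open>ac_deriv\<close> yields the derivative of \<open>Y\<close> only almost
      everywhere; as an integral of the continuous \<open>DY\<close>, \<open>Y\<close> is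
      differentiable everywhere, one-sidedly at the ends.\<close>
    fix x assume x: "x \<in> {0..pi}"
    have "((\<lambda>u. integral {0..u} DY) has_vector_derivative DY x) (at x within {0..pi})"
      by (rule integral_has_vector_derivative[OF DYc x])
    then have "((\<lambda>u. c1 + integral {0..u} DY) has_vector_derivative DY x) (at x within {0..pi})"
      by (auto intro!: derivative_eq_intros)
    moreover have "c1 + integral {0..u} DY = Y u" if "u \<in> {0..pi}" for u
    proof -
      have "(DY has_integral Y u - Y 0) {0..u}"
        by (rule ac_deriv_has_integral[OF ac_deriv_subset[OF acY]]) (use that in auto)
      moreover have "Y 0 = c1" using U(2)[of 0] by (simp add: Y_def)
      ultimately show ?thesis by (simp add: integral_unique)
    qed
    ultimately show "(Y has_vector_derivative DY x) (at x within {0..pi})"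
      using has_vector_derivative_transform[OF x] by (metis (no_types, lifting))
  qed (use acY acDY in \<open>simp_all add: mm.diff_left\<close>)
  moreover have "Y 0 = c1" "DY 0 = c2" using U(2)[of 0] by (simp_all add: Y_def DY_def)
  ultimately show ?thesis by blast
qed

end

lemma mat_commute: "(A :: complex^'m^'m) ** mat c = mat c ** A"
  by (simp add: vec_eq_iff matrix_matrix_mult_def mat_def if_distrib[of "\<lambda>x. x * _"] if_distrib[of "\<lambda>x. _ * x"] mult.commute cong: if_cong)

lemma mat_mult_entry: "(mat c ** (A :: complex^'m^'n)) $ i $ j = c * A $ i $ j"
  by (simp add: mat_mult_scale)

lemma mat_diff: "mat (c - d) = (mat c - mat d :: complex^'m^'m)"
  by (simp add: vec_eq_iff mat_def)

section \<open>The Lagrange identity and Wronskians\<close>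

context hermitian_potential
begin

lemma hermitianE:
  obtains N where "negligible N" "\<And>x. x \<in> {0<..<pi} - N \<Longrightarrow> Q x = (Q x)\<^sup>\<dagger>"
  using hermitian by (subst (asm) AE_lebesgue_on_iff_negligible) auto

text \<open>For Hermitian \<open>Q\<close> the conjugate transpose of \<open>Z\<close> solves the
  equation with \<open>Q\<close> on the right, so the potential drops out of the derivative off a
  null set. Only the difference of the spectral parameters survives, the one of \<open>Z\<close>
  being conjugated.\<close>

lemma lagrange_vector:
  assumes Z: "matrix_solution Q mu Z DZ" and y: "vector_solution Q lam y dy"
  shows "ac_deriv 0 pi (\<lambda>x. (Z x)\<^sup>\<dagger> *v dy x - (DZ x)\<^sup>\<dagger> *v y x) (\<lambda>x. (cnj mu - lam) *s ((Z x)\<^sup>\<dagger> *v y x))"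
proof -
  note Z = matrix_solutionD[OF Z] and y = vector_solutionD[OF y]
  note ct = bounded_linear_conj_transpose and mv = bounded_bilinear_matrix_vector_mult
  obtain N where N: "negligible N" "\<And>x. x \<in> {0<..<pi} - N \<Longrightarrow> Q x = (Q x)\<^sup>\<dagger>" using hermitianE by blast
  note * = ac_deriv_diff[OF ac_deriv_bilinear[OF mv ac_deriv_linear[OF ct Z(2)] y(3)]
                           ac_deriv_bilinear[OF mv ac_deriv_linear[OF ct Z(3)] y(2)]]
  show ?thesis
  proof (rule ac_deriv_spike[OF * N(1)])
    fix x assume "x \<in> {0<..<pi} - N"
    then have Q: "(Q x)\<^sup>\<dagger> = Q x" using N(2) by simp
    show "(Z x)\<^sup>\<dagger> *v (Q x *v y x - lam *s y x) + (DZ x)\<^sup>\<dagger> *v dy x -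
         ((DZ x)\<^sup>\<dagger> *v dy x + (Q x ** Z x - mat mu ** Z x)\<^sup>\<dagger> *v y x) = (cnj mu - lam) *s ((Z x)\<^sup>\<dagger> *v y x)"
      by (simp add: conj_transpose_diff conj_transpose_mult Q mv.diff_left mv.diff_right matrix_vector_mul_assoc[symmetric]
         mat_mult_vec_scale vector_scalar_commute sv.diff_left)
  qed
qed

lemma lagrange_matrix:
  assumes Z: "matrix_solution Q mu Z DZ" and Y: "matrix_solution Q lam Y DY"
  shows "ac_deriv 0 pi (\<lambda>x. (Z x)\<^sup>\<dagger> ** DY x - (DZ x)\<^sup>\<dagger> ** Y x) (\<lambda>x. mat (cnj mu - lam) ** ((Z x)\<^sup>\<dagger> ** Y x))"
proof -
  note Z = matrix_solutionD[OF Z] and Y = matrix_solutionD[OF Y]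
  note ct = bounded_linear_conj_transpose and mm = bounded_bilinear_matrix_mult
  obtain N where N: "negligible N" "\<And>x. x \<in> {0<..<pi} - N \<Longrightarrow> Q x = (Q x)\<^sup>\<dagger>" using hermitianE by blast
  note * = ac_deriv_diff[OF ac_deriv_bilinear[OF mm ac_deriv_linear[OF ct Z(2)] Y(3)]
                           ac_deriv_bilinear[OF mm ac_deriv_linear[OF ct Z(3)] Y(2)]]
  show ?thesis
  proof (rule ac_deriv_spike[OF * N(1)])
    fix x assume "x \<in> {0<..<pi} - N"
    then have Q: "(Q x)\<^sup>\<dagger> = Q x" using N(2) by simp
    have "(Z x)\<^sup>\<dagger> ** (mat lam ** Y x) = mat lam ** ((Z x)\<^sup>\<dagger> ** Y x)"
      by (simp add: matrix_mul_assoc mat_commute)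
    moreover have "(Z x)\<^sup>\<dagger> ** mat (cnj mu) ** Y x = mat (cnj mu) ** ((Z x)\<^sup>\<dagger> ** Y x)"
      by (simp add: matrix_mul_assoc mat_commute)
    ultimately show "(Z x)\<^sup>\<dagger> ** (Q x ** Y x - mat lam ** Y x) + (DZ x)\<^sup>\<dagger> ** DY x -
         ((DZ x)\<^sup>\<dagger> ** DY x + (Q x ** Z x - mat mu ** Z x)\<^sup>\<dagger> ** Y x) = mat (cnj mu - lam) ** ((Z x)\<^sup>\<dagger> ** Y x)"
      by (simp add: conj_transpose_diff conj_transpose_mult Q mm.diff_left mm.diff_right
           mat_diff matrix_mul_assoc[symmetric])
  qed
qed

text \<open>At conjugate parameters the right-hand side of the Lagrange identity is 0.\<close>

lemma wronskian_vector:
  assumes Z: "matrix_solution Q (cnj lam) Z DZ" and y: "vector_solution Q lam y dy" and x: "x \<in> {0..pi}"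
  shows "(Z x)\<^sup>\<dagger> *v dy x - (DZ x)\<^sup>\<dagger> *v y x = (Z 0)\<^sup>\<dagger> *v dy 0 - (DZ 0)\<^sup>\<dagger> *v y 0"
  using ac_deriv_zero_imp_const[of 0 pi, OF _ x] lagrange_vector[OF Z y] by (simp add: sv.zero_left)

lemma wronskian_matrix:
  assumes Z: "matrix_solution Q (cnj lam) Z DZ" and Y: "matrix_solution Q lam Y DY" and x: "x \<in> {0..pi}"
  shows "(Z x)\<^sup>\<dagger> ** DY x - (DZ x)\<^sup>\<dagger> ** Y x = (Z 0)\<^sup>\<dagger> ** DY 0 - (DZ 0)\<^sup>\<dagger> ** Y 0"
proof -
  have m0: "mat 0 = (0 :: complex^'m^'m)" by (simp add: vec_eq_iff mat_def)
  show ?thesis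
    using ac_deriv_zero_imp_const[of 0 pi, OF _ x] lagrange_matrix[OF Z Y] by (simp add: m0 mm.zero_left)
qed

text \<open>Uniqueness is not at hand yet, hence the choice; it follows in
  \<open>vector_solution_unique\<close>.\<close>

definition sol :: "complex^'m^'m \<Rightarrow> complex^'m^'m \<Rightarrow> complex \<Rightarrow> real \<Rightarrow> complex^'m^'m"
  where "sol c1 c2 lam = fst (SOME p. matrix_solution Q lam (fst p) (snd p) \<and> fst p 0 = c1 \<and> snd p 0 = c2)"

definition dsol :: "complex^'m^'m \<Rightarrow> complex^'m^'m \<Rightarrow> complex \<Rightarrow> real \<Rightarrow> complex^'m^'m"
  where "dsol c1 c2 lam = snd (SOME p. matrix_solution Q lam (fst p) (snd p) \<and> fst p 0 = c1 \<and> snd p 0 = c2)"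

lemma sol: "matrix_solution Q lam (sol c1 c2 lam) (dsol c1 c2 lam)"
  and sol_0 [simp]: "sol c1 c2 lam 0 = c1" and dsol_0 [simp]: "dsol c1 c2 lam 0 = c2"
proof -
  have "\<exists>p. matrix_solution Q lam (fst p) (snd p) \<and> fst p 0 = c1 \<and> snd p 0 = c2"
    using solution_exists[of lam c1 c2] by simp
  from someI_ex[OF this] show "matrix_solution Q lam (sol c1 c2 lam) (dsol c1 c2 lam)"
    "sol c1 c2 lam 0 = c1" "dsol c1 c2 lam 0 = c2" unfolding sol_def dsol_def by auto
qed

abbreviation C where "C \<equiv> sol (mat 1) 0"
abbreviation C' where "C' \<equiv> dsol (mat 1) 0"
abbreviation S where "S \<equiv> sol 0 (mat 1)"
abbreviation S' where "S' \<equiv> dsol 0 (mat 1)"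

text \<open>By the constancy of the Wronskians, the fundamental matrix has an explicit left inverse; a left
  inverse of a square matrix is a right inverse.\<close>

lemma fundamental_right_inverse:
  assumes x: "x \<in> {0..pi}"
  shows "C lam x *v ((S' (cnj lam) x)\<^sup>\<dagger> *v p - (S (cnj lam) x)\<^sup>\<dagger> *v q)
       + S lam x *v ((C (cnj lam) x)\<^sup>\<dagger> *v q - (C' (cnj lam) x)\<^sup>\<dagger> *v p) = p"
    and "C' lam x *v ((S' (cnj lam) x)\<^sup>\<dagger> *v p - (S (cnj lam) x)\<^sup>\<dagger> *v q)
       + S' lam x *v ((C (cnj lam) x)\<^sup>\<dagger> *v q - (C' (cnj lam) x)\<^sup>\<dagger> *v p) = q"
proof -
  define F where "F = (\<lambda>(u, v). (C lam x *v u + S lam x *v v, C' lam x *v u + S' lam x *v v))"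
  define G where "G = (\<lambda>(p, q). ((S' (cnj lam) x)\<^sup>\<dagger> *v p - (S (cnj lam) x)\<^sup>\<dagger> *v q,
                                (C (cnj lam) x)\<^sup>\<dagger> *v q - (C' (cnj lam) x)\<^sup>\<dagger> *v p))"
  have lin: "linear F" "linear G" unfolding F_def G_def
    by (auto intro!: linearI simp: mv.add_right mv.scaleR_right algebra_simps)
  have w1: "(S' (cnj lam) x)\<^sup>\<dagger> ** C lam x - (S (cnj lam) x)\<^sup>\<dagger> ** C' lam x = mat 1"
    using wronskian_matrix[OF sol sol x, of 0 "mat 1" lam "mat 1" 0] by (simp add: algebra_simps)
  have w2: "(S' (cnj lam) x)\<^sup>\<dagger> ** S lam x - (S (cnj lam) x)\<^sup>\<dagger> ** S' lam x = 0"
    using wronskian_matrix[OF sol sol x, of 0 "mat 1" lam 0 "mat 1"] by (simp add: algebra_simps mm.zero_left mm.zero_right)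
  have w3: "(C (cnj lam) x)\<^sup>\<dagger> ** C' lam x - (C' (cnj lam) x)\<^sup>\<dagger> ** C lam x = 0"
    using wronskian_matrix[OF sol sol x, of "mat 1" 0 lam "mat 1" 0] by (simp add: algebra_simps mm.zero_left mm.zero_right)
  have w4: "(C (cnj lam) x)\<^sup>\<dagger> ** S' lam x - (C' (cnj lam) x)\<^sup>\<dagger> ** S lam x = mat 1"
    using wronskian_matrix[OF sol sol x, of "mat 1" 0 lam 0 "mat 1"] by (simp add: algebra_simps mm.zero_left mm.zero_right)
  have "G (F w) = w" for w
  proof -
    obtain u v where w: "w = (u, v)" by (cases w)
    have "fst (G (F w)) = ((S' (cnj lam) x)\<^sup>\<dagger> ** C lam x - (S (cnj lam) x)\<^sup>\<dagger> ** C' lam x) *v u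
        + ((S' (cnj lam) x)\<^sup>\<dagger> ** S lam x - (S (cnj lam) x)\<^sup>\<dagger> ** S' lam x) *v v"
      unfolding w F_def G_def by (simp add: mv.add_right mv.diff_left matrix_vector_mul_assoc algebra_simps)
    moreover have "snd (G (F w)) = ((C (cnj lam) x)\<^sup>\<dagger> ** C' lam x - (C' (cnj lam) x)\<^sup>\<dagger> ** C lam x) *v u
        + ((C (cnj lam) x)\<^sup>\<dagger> ** S' lam x - (C' (cnj lam) x)\<^sup>\<dagger> ** S lam x) *v v"
      unfolding w F_def G_def by (simp add: mv.add_right mv.diff_left matrix_vector_mul_assoc algebra_simps)
    ultimately show ?thesis unfolding w1 w2 w3 w4 w by (simp add: prod_eq_iff mv.zero_left)
  qed
  then have "G \<circ> F = id" by auto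
  then have "F \<circ> G = id" using linear_inverse_left[OF lin(2,1)] by simp
  then have "F (G (p, q)) = (p, q)" by (metis comp_apply id_apply)
  then show "C lam x *v ((S' (cnj lam) x)\<^sup>\<dagger> *v p - (S (cnj lam) x)\<^sup>\<dagger> *v q)
       + S lam x *v ((C (cnj lam) x)\<^sup>\<dagger> *v q - (C' (cnj lam) x)\<^sup>\<dagger> *v p) = p"
    "C' lam x *v ((S' (cnj lam) x)\<^sup>\<dagger> *v p - (S (cnj lam) x)\<^sup>\<dagger> *v q)
       + S' lam x *v ((C (cnj lam) x)\<^sup>\<dagger> *v q - (C' (cnj lam) x)\<^sup>\<dagger> *v p) = q"
    by (simp_all add: F_def G_def)
qed

lemma fundamental_right_inverse_matrix:
  assumes x: "x \<in> {0..pi}"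
  shows "C lam x ** ((S' (cnj lam) x)\<^sup>\<dagger> ** P - (S (cnj lam) x)\<^sup>\<dagger> ** R)
       + S lam x ** ((C (cnj lam) x)\<^sup>\<dagger> ** R - (C' (cnj lam) x)\<^sup>\<dagger> ** P) = P"
    and "C' lam x ** ((S' (cnj lam) x)\<^sup>\<dagger> ** P - (S (cnj lam) x)\<^sup>\<dagger> ** R)
       + S' lam x ** ((C (cnj lam) x)\<^sup>\<dagger> ** R - (C' (cnj lam) x)\<^sup>\<dagger> ** P) = R"
  using fundamental_right_inverse[OF x, of lam "P *v _" "R *v _"]
  by (simp_all add: matrix_eq mv.add_left mv.diff_left matrix_vector_mul_assoc[symmetric])

text \<open>Uniqueness by algebra: the Wronskians with \<open>S\<close> and \<open>C\<close> at the
  conjugate parameter recover the initial values from the values at \<open>x\<close>, and the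
  fundamental matrix carries them back to \<open>x\<close>.\<close>

lemma vector_solution_unique:
  assumes y: "vector_solution Q lam y dy" and x: "x \<in> {0..pi}"
  shows "y x = C lam x *v y 0 + S lam x *v dy 0" "dy x = C' lam x *v y 0 + S' lam x *v dy 0"
proof -
  have "(S (cnj lam) x)\<^sup>\<dagger> *v dy x - (S' (cnj lam) x)\<^sup>\<dagger> *v y x = - y 0"
    using wronskian_vector[OF sol y x, of 0 "mat 1"] by (simp add: mv.zero_left)
  then have 1: "(S' (cnj lam) x)\<^sup>\<dagger> *v y x - (S (cnj lam) x)\<^sup>\<dagger> *v dy x = y 0"
    by (metis minus_diff_eq neg_equal_iff_equal)
  have 2: "(C (cnj lam) x)\<^sup>\<dagger> *v dy x - (C' (cnj lam) x)\<^sup>\<dagger> *v y x = dy 0"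
    using wronskian_vector[OF sol y x, of "mat 1" 0] by (simp add: mv.zero_left)
  show "y x = C lam x *v y 0 + S lam x *v dy 0" "dy x = C' lam x *v y 0 + S' lam x *v dy 0"
    using fundamental_right_inverse[OF x, of lam "y x" "dy x"] unfolding 1 2 by auto
qed

section \<open>Dependence of the solutions on the spectral parameter\<close>

lemma sol_continuous: "continuous_on {0..pi} (sol c1 c2 lam)" "continuous_on {0..pi} (dsol c1 c2 lam)"
  using matrix_solutionD[OF sol] ac_derivD_continuous by blast+

lemma continuous_ct: "continuous_on A f \<Longrightarrow> continuous_on A (\<lambda>x. (f x :: complex^'m^'m)\<^sup>\<dagger>)"
  by (rule bounded_linear.continuous_on[OF bounded_linear_conj_transpose])

lemma continuous_mm: "continuous_on A f \<Longrightarrow> continuous_on A g \<Longrightarrow> continuous_on A (\<lambda>x. (f x :: complex^'m^'m) ** (g x :: complex^'m^'m))"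
  by (rule bounded_bilinear.continuous_on[OF bounded_bilinear_matrix_mult])

text \<open>Variation of constants. The integrated Lagrange identity gives the Wronskians of the
  difference with \<open>C\<close> and \<open>S\<close>, and the inverse of the fundamental matrix
  recovers the difference itself. The explicit factor \<open>lam - mu\<close> prepares
  differentiation in the parameter.\<close>

lemma sol_difference:
  fixes c1 c2 :: "complex^'m^'m"
  assumes x: "x \<in> {0..pi}"
  defines "I Z lam \<equiv> integral {0..x} (\<lambda>t. (Z t)\<^sup>\<dagger> ** sol c1 c2 lam t)"
  shows "sol c1 c2 lam x - sol c1 c2 mu x
       = mat (lam - mu) ** (C mu x ** I (S (cnj mu)) lam - S mu x ** I (C (cnj mu)) lam)"
    "dsol c1 c2 lam x - dsol c1 c2 mu x
       = mat (lam - mu) ** (C' mu x ** I (S (cnj mu)) lam - S' mu x ** I (C (cnj mu)) lam)"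
proof -
  define D D' where "D = sol c1 c2 lam x - sol c1 c2 mu x" and "D' = dsol c1 c2 lam x - dsol c1 c2 mu x"
  have W: "(sol a b (cnj mu) x)\<^sup>\<dagger> ** D' - (dsol a b (cnj mu) x)\<^sup>\<dagger> ** D = mat (mu - lam) ** I (sol a b (cnj mu)) lam" for a b
  proof -
    let ?Z = "sol a b (cnj mu)" and ?Z' = "dsol a b (cnj mu)"
    have "continuous_on {0..x} (\<lambda>t. (?Z t)\<^sup>\<dagger> ** sol c1 c2 lam t)"
      using x by (intro continuous_mm continuous_ct continuous_on_subset[OF sol_continuous(1)]) auto
    then have "((\<lambda>t. (?Z t)\<^sup>\<dagger> ** sol c1 c2 lam t) has_integral I ?Z lam) {0..x}"
      unfolding I_def by (intro integrable_integral integrable_continuous_real)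
    from has_integral_linear[OF this mm.bounded_linear_right[of "mat (mu - lam)"]]
    have 1: "((\<lambda>t. mat (mu - lam) ** ((?Z t)\<^sup>\<dagger> ** sol c1 c2 lam t)) has_integral mat (mu - lam) ** I ?Z lam) {0..x}"
      by (simp add: o_def)
    have "ac_deriv 0 x (\<lambda>x. (?Z x)\<^sup>\<dagger> ** dsol c1 c2 lam x - (?Z' x)\<^sup>\<dagger> ** sol c1 c2 lam x) (\<lambda>t. mat (mu - lam) ** ((?Z t)\<^sup>\<dagger> ** sol c1 c2 lam t))"
      using lagrange_matrix[OF sol sol, of a b "cnj mu" c1 c2 lam] x by (auto intro: ac_deriv_subset)
    from has_integral_unique[OF ac_deriv_has_integral[OF this] 1] x
    have e: "((?Z x)\<^sup>\<dagger> ** dsol c1 c2 lam x - (?Z' x)\<^sup>\<dagger> ** sol c1 c2 lam x) - (a\<^sup>\<dagger> ** c2 - b\<^sup>\<dagger> ** c1) = mat (mu - lam) ** I ?Z lam"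
      by simp
    \<comment> \<open>The Wronskian with the solution at \<open>mu\<close> is constant; subtracting
      it replaces the solution at \<open>lam\<close> by the difference and removes the boundary term
      at 0.\<close>
    have "(?Z x)\<^sup>\<dagger> ** dsol c1 c2 mu x - (?Z' x)\<^sup>\<dagger> ** sol c1 c2 mu x = a\<^sup>\<dagger> ** c2 - b\<^sup>\<dagger> ** c1"
      using wronskian_matrix[OF sol sol x, of a b mu c1 c2] by simp
    from e[folded this] show ?thesis
      by (simp add: D_def D'_def mm.diff_right algebra_simps)
  qed
  have W': "(dsol a b (cnj mu) x)\<^sup>\<dagger> ** D - (sol a b (cnj mu) x)\<^sup>\<dagger> ** D' = mat (lam - mu) ** I (sol a b (cnj mu)) lam" for a b
    using arg_cong[OF W[of a b], of uminus] by (simp add: mm.minus_left[symmetric] mat_diff)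
  have com: "(A :: complex^'m^'m) ** (mat c ** B) = mat c ** (A ** B)" for A B c by (simp add: matrix_mul_assoc mat_commute)
  have neg: "mat (mu - lam) ** B = - (mat (lam - mu) ** B)" for B :: "complex^'m^'m"
    by (simp add: mat_diff mm.diff_left)
  show "sol c1 c2 lam x - sol c1 c2 mu x
       = mat (lam - mu) ** (C mu x ** I (S (cnj mu)) lam - S mu x ** I (C (cnj mu)) lam)"
    using fundamental_right_inverse_matrix(1)[OF x, of mu D D'] unfolding W W' D_def[symmetric]
    by (simp add: com neg mm.diff_right mm.minus_right)
  show "dsol c1 c2 lam x - dsol c1 c2 mu x
       = mat (lam - mu) ** (C' mu x ** I (S (cnj mu)) lam - S' mu x ** I (C (cnj mu)) lam)"
    using fundamental_right_inverse_matrix(2)[OF x, of mu D D'] unfolding W W' D'_def[symmetric]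
    by (simp add: com neg mm.diff_right mm.minus_right)
qed

lemma norm_mat_mult: "norm (mat c ** (A :: complex^'m^'m)) = norm c * norm A"
  by (simp add: norm_vec_def mat_mult_scale norm_mult L2_set_right_distrib)

lemma integral_product_bound:
  fixes Z :: "real \<Rightarrow> complex^'m^'m"
  assumes Z: "continuous_on {0..pi} Z"
  shows "\<exists>K>0. \<forall>(Y :: real \<Rightarrow> complex^'m^'m) x m. continuous_on {0..pi} Y \<and> x \<in> {0..pi} \<and> (\<forall>t\<in>{0..pi}. norm (Y t) \<le> m)
    \<longrightarrow> norm (integral {0..x} (\<lambda>t. (Z t)\<^sup>\<dagger> ** Y t)) \<le> K * m"
proof -
  have "bounded ((\<lambda>t. (Z t)\<^sup>\<dagger>) ` {0..pi})"
    using continuous_ct[OF Z] by (simp add: compact_continuous_image compact_imp_bounded)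
  then obtain B where B: "B > 0" "\<And>t. t \<in> {0..pi} \<Longrightarrow> norm ((Z t)\<^sup>\<dagger>) \<le> B" unfolding bounded_pos by blast
  obtain k where k: "k > 0" "\<And>(A :: complex^'m^'m) (B :: complex^'m^'m). norm (A ** B) \<le> norm A * norm B * k" using mm.pos_bounded by blast
  show ?thesis
  proof (intro exI[of _ "B * k * pi"] conjI allI impI)
    show "B * k * pi > 0" using B k by simp
    fix Y :: "real \<Rightarrow> complex^'m^'m" and x m
    assume "continuous_on {0..pi} Y \<and> x \<in> {0..pi} \<and> (\<forall>t\<in>{0..pi}. norm (Y t) \<le> m)"
    then have Y: "continuous_on {0..pi} Y" and x: "x \<in> {0..pi}" and m: "\<And>t. t \<in> {0..pi} \<Longrightarrow> norm (Y t) \<le> m" by blast+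
    have m0: "m \<ge> 0" using m[OF x] norm_ge_zero order_trans by blast
    have sub: "{0..x} \<subseteq> {0..pi}" using x by auto
    have "norm (integral {0..x} (\<lambda>t. (Z t)\<^sup>\<dagger> ** Y t)) \<le> integral {0..x} (\<lambda>t. B * m * k)"
    proof (rule integral_norm_bound_integral)
      show "(\<lambda>t. (Z t)\<^sup>\<dagger> ** Y t) integrable_on {0..x}"
        by (intro integrable_continuous_real continuous_mm continuous_ct continuous_on_subset[OF Z sub] continuous_on_subset[OF Y sub])
      fix t assume "t \<in> {0..x}"
      then have t: "t \<in> {0..pi}" using sub by auto
      have "norm ((Z t)\<^sup>\<dagger> ** Y t) \<le> norm ((Z t)\<^sup>\<dagger>) * norm (Y t) * k" by (rule k)
      also have "\<dots> \<le> B * m * k" using B(1) B(2)[OF t] m[OF t] k(1) by (intro mult_mono mult_right_mono) auto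
      finally show "norm ((Z t)\<^sup>\<dagger> ** Y t) \<le> B * m * k" .
    qed (rule integrable_continuous_real, rule continuous_on_const)
    also have "\<dots> = B * m * k * x" using x by simp
    also have "\<dots> \<le> B * m * k * pi" using x B k m0 by (intro mult_left_mono) auto
    finally show "norm (integral {0..x} (\<lambda>t. (Z t)\<^sup>\<dagger> ** Y t)) \<le> B * k * pi * m" by (simp add: mult_ac)
  qed
qed

text \<open>The difference is bounded by a multiple of \<open>norm (lam - mu)\<close> times the
  maximum of the solution at \<open>lam\<close>, which is itself unknown. Within distance
  \<open>1 / (2 * K)\<close> it can be absorbed and is at most twice the bound at
  \<open>mu\<close>.\<close>

lemma sol_lipschitz:
  obtains K d where "K > 0" "d > 0" 
    "\<And>lam x. norm (lam - mu) < d \<Longrightarrow> x \<in> {0..pi} \<Longrightarrow> norm (sol c1 c2 lam x - sol c1 c2 mu x) \<le> K * norm (lam - mu)"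
proof -
  obtain k where k: "k > 0" "\<And>(A :: complex^'m^'m) (B :: complex^'m^'m). norm (A ** B) \<le> norm A * norm B * k" using mm.pos_bounded by blast
  have bd: "\<exists>B>0. \<forall>x\<in>{0..pi}. norm (sol a b lam x) \<le> B" for a b lam
  proof -
    have "bounded (sol a b lam ` {0..pi})" using sol_continuous by (simp add: compact_continuous_image compact_imp_bounded)
    then show ?thesis unfolding bounded_pos by blast
  qed
  obtain B1 where B1: "B1 > 0" "\<And>x. x \<in> {0..pi} \<Longrightarrow> norm (C mu x) \<le> B1" using bd by metis
  obtain B2 where B2: "B2 > 0" "\<And>x. x \<in> {0..pi} \<Longrightarrow> norm (S mu x) \<le> B2" using bd by metis
  obtain B where B: "B > 0" "\<And>x. x \<in> {0..pi} \<Longrightarrow> norm (sol c1 c2 mu x) \<le> B" using bd by metis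
  obtain K1 where K1: "K1 > 0" "\<And>(Y :: real \<Rightarrow> complex^'m^'m) x m. continuous_on {0..pi} Y \<Longrightarrow> x \<in> {0..pi} \<Longrightarrow> (\<And>t. t \<in> {0..pi} \<Longrightarrow> norm (Y t) \<le> m)
    \<Longrightarrow> norm (integral {0..x} (\<lambda>t. (S (cnj mu) t)\<^sup>\<dagger> ** Y t)) \<le> K1 * m"
    using integral_product_bound[of "S (cnj mu)"] sol_continuous(1) by blast
  obtain K2 where K2: "K2 > 0" "\<And>(Y :: real \<Rightarrow> complex^'m^'m) x m. continuous_on {0..pi} Y \<Longrightarrow> x \<in> {0..pi} \<Longrightarrow> (\<And>t. t \<in> {0..pi} \<Longrightarrow> norm (Y t) \<le> m)
    \<Longrightarrow> norm (integral {0..x} (\<lambda>t. (C (cnj mu) t)\<^sup>\<dagger> ** Y t)) \<le> K2 * m"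
    using integral_product_bound[of "C (cnj mu)"] sol_continuous(1) by blast
  define K where "K = (B1 * K1 + B2 * K2) * k"
  have K: "K > 0" using B1 B2 K1 K2 k by (simp add: K_def add_pos_pos)
  have *: "norm (sol c1 c2 lam x - sol c1 c2 mu x) \<le> norm (lam - mu) * (K * m)" 
    if m: "\<And>t. t \<in> {0..pi} \<Longrightarrow> norm (sol c1 c2 lam t) \<le> m" and x: "x \<in> {0..pi}" for lam x m
  proof -
    let ?I1 = "integral {0..x} (\<lambda>t. (S (cnj mu) t)\<^sup>\<dagger> ** sol c1 c2 lam t)"
    let ?I2 = "integral {0..x} (\<lambda>t. (C (cnj mu) t)\<^sup>\<dagger> ** sol c1 c2 lam t)"
    have m0: "m \<ge> 0" using m[OF x] norm_ge_zero order_trans by blast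
    have "norm (C mu x ** ?I1) \<le> B1 * (K1 * m) * k"
      by (rule order_trans[OF k(2)]) (use B1 K1(1) K1(2)[OF sol_continuous(1) x m] x k m0 in \<open>auto intro!: mult_mono mult_right_mono\<close>)
    moreover have "norm (S mu x ** ?I2) \<le> B2 * (K2 * m) * k"
      by (rule order_trans[OF k(2)]) (use B2 K2(1) K2(2)[OF sol_continuous(1) x m] x k m0 in \<open>auto intro!: mult_mono mult_right_mono\<close>)
    ultimately have "norm (C mu x ** ?I1 - S mu x ** ?I2) \<le> K * m"
      unfolding K_def by (intro order_trans[OF norm_triangle_ineq4]) (simp add: algebra_simps)
    then show ?thesis
      unfolding sol_difference(1)[OF x] norm_mat_mult by (rule mult_left_mono) simp
  qed
  show ?thesis
  proof (rule that[of "K * (2 * B)" "1 / (2 * K)"])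
    fix lam x assume lam: "norm (lam - mu) < 1 / (2 * K)" and x: "x \<in> {0..pi}"
    have "continuous_on {0..pi} (\<lambda>t. norm (sol c1 c2 lam t))" by (intro continuous_on_norm sol_continuous)
    then obtain x0 where x0: "x0 \<in> {0..pi}" "\<And>t. t \<in> {0..pi} \<Longrightarrow> norm (sol c1 c2 lam t) \<le> norm (sol c1 c2 lam x0)"
      using continuous_attains_sup[of "{0..pi}" "\<lambda>t. norm (sol c1 c2 lam t)"] by auto
    define m where "m = norm (sol c1 c2 lam x0)"
    have "m \<le> norm (sol c1 c2 mu x0) + norm (sol c1 c2 lam x0 - sol c1 c2 mu x0)"
      unfolding m_def by (metis add.commute diff_add_cancel norm_triangle_ineq)
    also have "\<dots> \<le> B + norm (lam - mu) * (K * m)"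
      using B(2)[OF x0(1)] *[OF x0(2) x0(1)] by (simp add: m_def)
    also have "norm (lam - mu) * (K * m) \<le> 1 / (2 * K) * (K * m)"
      using lam K by (intro mult_right_mono) (auto simp: m_def)
    also have "\<dots> = m / 2" using K by simp
    finally have "m \<le> 2 * B" by simp
    then have "norm (sol c1 c2 lam t) \<le> 2 * B" if "t \<in> {0..pi}" for t using x0(2)[OF that] by (simp add: m_def)
    from *[OF this x] show "norm (sol c1 c2 lam x - sol c1 c2 mu x) \<le> K * (2 * B) * norm (lam - mu)"
      by (simp add: mult_ac)
  qed (use K B in auto)
qed

lemma sol_integral_isCont:
  fixes Z :: "real \<Rightarrow> complex^'m^'m"
  assumes x: "x \<in> {0..pi}" and Z: "continuous_on {0..pi} Z"
  shows "isCont (\<lambda>lam. integral {0..x} (\<lambda>t. (Z t)\<^sup>\<dagger> ** sol c1 c2 lam t)) mu"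
proof -
  let ?I = "\<lambda>lam. integral {0..x} (\<lambda>t. (Z t)\<^sup>\<dagger> ** sol c1 c2 lam t)"
  obtain L d where L: "L > 0" "d > 0" 
    "\<And>lam x. norm (lam - mu) < d \<Longrightarrow> x \<in> {0..pi} \<Longrightarrow> norm (sol c1 c2 lam x - sol c1 c2 mu x) \<le> L * norm (lam - mu)"
    by (rule sol_lipschitz[of mu c1 c2]) blast
  obtain K where K: "K > 0" "\<And>(Y :: real \<Rightarrow> complex^'m^'m) x m. continuous_on {0..pi} Y \<Longrightarrow> x \<in> {0..pi} \<Longrightarrow> (\<And>t. t \<in> {0..pi} \<Longrightarrow> norm (Y t) \<le> m)
    \<Longrightarrow> norm (integral {0..x} (\<lambda>t. (Z t)\<^sup>\<dagger> ** Y t)) \<le> K * m"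
    using integral_product_bound[of "Z"] Z by blast
  have sub: "{0..x} \<subseteq> {0..pi}" using x by auto
  have int: "(\<lambda>t. (Z t)\<^sup>\<dagger> ** sol c1 c2 lam t) integrable_on {0..x}" for lam
    by (intro integrable_continuous_real continuous_mm continuous_ct continuous_on_subset[OF Z sub] continuous_on_subset[OF sol_continuous(1) sub])
  have bound: "norm (?I lam - ?I mu) \<le> K * (L * norm (lam - mu))" if "norm (lam - mu) < d" for lam
  proof -
    have "?I lam - ?I mu = integral {0..x} (\<lambda>t. (Z t)\<^sup>\<dagger> ** (sol c1 c2 lam t - sol c1 c2 mu t))"
      by (subst Henstock_Kurzweil_Integration.integral_diff[OF int int, symmetric]) (simp add: mm.diff_right)
    then show ?thesis
      using K(2)[of "\<lambda>t. sol c1 c2 lam t - sol c1 c2 mu t" x "L * norm (lam - mu)"] L(3)[OF that] x sol_continuous(1)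
      by (simp add: continuous_on_diff)
  qed
  have "((\<lambda>lam. ?I lam - ?I mu) \<longlongrightarrow> 0) (at mu)"
  proof (rule Lim_null_comparison)
    show "\<forall>\<^sub>F lam in at mu. norm (?I lam - ?I mu) \<le> K * (L * norm (lam - mu))"
      unfolding eventually_at by (rule exI[of _ d]) (use bound L(2) in \<open>auto simp: dist_norm\<close>)
    have "((\<lambda>lam. K * (L * norm (lam - mu))) \<longlongrightarrow> K * (L * norm (mu - mu))) (at mu)"
      by (intro tendsto_intros)
    then show "((\<lambda>lam. K * (L * norm (lam - mu))) \<longlongrightarrow> 0) (at mu)" by simp
  qed
  then show ?thesis unfolding isCont_def using Lim_null by blast
qed

text \<open>The difference formula has Caratheodory's form: \<open>z - mu\<close> times a factor
  that is continuous at \<open>mu\<close>.\<close>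

lemma sol_holomorphic:
  assumes x: "x \<in> {0..pi}"
  shows "(\<lambda>lam. sol c1 c2 lam x $ i $ j) holomorphic_on A"
    "(\<lambda>lam. dsol c1 c2 lam x $ i $ j) holomorphic_on A"
proof -
  have *: "isCont (\<lambda>lam. (P ** integral {0..x} (\<lambda>t. (S (cnj mu) t)\<^sup>\<dagger> ** sol c1 c2 lam t) 
            - R ** integral {0..x} (\<lambda>t. (C (cnj mu) t)\<^sup>\<dagger> ** sol c1 c2 lam t)) $ i $ j) mu" for P R mu
    by (intro continuous_intros bounded_bilinear.continuous[OF bounded_bilinear_matrix_mult]
      sol_integral_isCont[OF x sol_continuous(1)])
  have "(\<lambda>lam. sol c1 c2 lam x $ i $ j) field_differentiable (at mu)" for mu
    unfolding field_differentiable_def CARAT_DERIV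
  proof (intro exI conjI allI)
    fix z show "sol c1 c2 z x $ i $ j - sol c1 c2 mu x $ i $ j = 
      ((C mu x ** integral {0..x} (\<lambda>t. (S (cnj mu) t)\<^sup>\<dagger> ** sol c1 c2 z t) 
            - S mu x ** integral {0..x} (\<lambda>t. (C (cnj mu) t)\<^sup>\<dagger> ** sol c1 c2 z t)) $ i $ j) * (z - mu)"
      using arg_cong[OF sol_difference(1)[OF x, of c1 c2 z mu], of "\<lambda>A. A $ i $ j"]
      by (simp only: vector_minus_component mat_mult_entry mult.commute)
  qed (rule * refl)+
  then show "(\<lambda>lam. sol c1 c2 lam x $ i $ j) holomorphic_on A"
    by (simp add: holomorphic_on_def field_differentiable_at_within)
  have "(\<lambda>lam. dsol c1 c2 lam x $ i $ j) field_differentiable (at mu)" for mu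
    unfolding field_differentiable_def CARAT_DERIV
  proof (intro exI conjI allI)
    fix z show "dsol c1 c2 z x $ i $ j - dsol c1 c2 mu x $ i $ j = 
      ((C' mu x ** integral {0..x} (\<lambda>t. (S (cnj mu) t)\<^sup>\<dagger> ** sol c1 c2 z t) 
            - S' mu x ** integral {0..x} (\<lambda>t. (C (cnj mu) t)\<^sup>\<dagger> ** sol c1 c2 z t)) $ i $ j) * (z - mu)"
      using arg_cong[OF sol_difference(2)[OF x, of c1 c2 z mu], of "\<lambda>A. A $ i $ j"]
      by (simp only: vector_minus_component mat_mult_entry mult.commute)
  qed (rule * refl)+
  then show "(\<lambda>lam. dsol c1 c2 lam x $ i $ j) holomorphic_on A"
    by (simp add: holomorphic_on_def field_differentiable_at_within)
qed

end

section \<open>Large spectral parameter\<close>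

lemma norm_vector_smult: "norm (c *s (v :: complex^'m)) = norm c * norm v"
  by (simp add: norm_vec_def norm_mult L2_set_right_distrib)

text \<open>With \<open>a\<close> and \<open>b\<close> the two functions below, a solution is \<open>y = a + b\<close> and \<open>y' = i \<rho> (a - b)\<close>; for
  \<open>Q = 0\<close> these are its components along \<open>exp (i \<rho> x)\<close> and \<open>exp (- i \<rho> x)\<close>.\<close>

definition wave_in :: "complex \<Rightarrow> complex^'m \<Rightarrow> complex^'m \<Rightarrow> complex^'m"
  where "wave_in rho u w = (1/2) *s (u + (1 / (\<i> * rho)) *s w)"

definition wave_out :: "complex \<Rightarrow> complex^'m \<Rightarrow> complex^'m \<Rightarrow> complex^'m"
  where "wave_out rho u w = (1/2) *s (u - (1 / (\<i> * rho)) *s w)"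

lemma wave_sum: "wave_in rho u w + wave_out rho u w = u"
  by (simp add: wave_in_def wave_out_def vec_eq_iff field_simps)

lemma wave_diff: "rho \<noteq> 0 \<Longrightarrow> (\<i> * rho) *s (wave_in rho u w - wave_out rho u w) = w"
  by (simp add: wave_in_def wave_out_def vec_eq_iff field_simps)

lemma wave_norm:
  "norm (wave_in rho u w) \<le> norm u + norm w / norm rho" 
  "norm (wave_out rho u w) \<le> norm u + norm w / norm rho"
proof -
  have n: "norm ((1 / (\<i> * rho)) *s w) = norm w / norm rho" by (simp add: norm_vector_smult norm_divide norm_mult)
  have "norm (wave_in rho u w) = 1/2 * norm (u + (1 / (\<i> * rho)) *s w)" unfolding wave_in_def norm_vector_smult by (simp add: norm_divide)
  also have "\<dots> \<le> norm u + norm w / norm rho"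
    using norm_triangle_ineq[of u "(1 / (\<i> * rho)) *s w"] norm_ge_zero[of "u + (1 / (\<i> * rho)) *s w"] unfolding n by linarith
  finally show "norm (wave_in rho u w) \<le> norm u + norm w / norm rho" .
  have "norm (wave_out rho u w) = 1/2 * norm (u - (1 / (\<i> * rho)) *s w)" unfolding wave_out_def norm_vector_smult by (simp add: norm_divide)
  also have "\<dots> \<le> norm u + norm w / norm rho"
    using norm_triangle_ineq4[of u "(1 / (\<i> * rho)) *s w"] norm_ge_zero[of "u - (1 / (\<i> * rho)) *s w"] unfolding n by linarith
  finally show "norm (wave_out rho u w) \<le> norm u + norm w / norm rho" .
qed

lemma ac_deriv_smult_exp:
  fixes y :: "real \<Rightarrow> complex^'m"
  assumes "ac_deriv a b y dy"
  shows "ac_deriv a b (\<lambda>x. exp (c * of_real x) *s y x) (\<lambda>x. exp (c * of_real x) *s (dy x + c *s y x))"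
proof -
  have "ac_deriv a b (\<lambda>x. exp (c * of_real x)) (\<lambda>x. c * exp (c * of_real x))"
  proof (rule ac_deriv_C1)
    show "((\<lambda>x. exp (c * complex_of_real x)) has_vector_derivative c * exp (c * complex_of_real x)) (at x)" for x
      by (rule has_vector_derivative_real_field) (auto intro!: derivative_eq_intros)
  qed (intro continuous_intros)
  from ac_deriv_bilinear[OF bounded_bilinear_vector_smult this assms]
  show ?thesis by (simp add: vector_add_ldistrib mult.commute)
qed

section \<open>Estimates of the two wave components\<close>

context hermitian_potential
begin

text \<open>Any constant of continuity of the product of matrix and vector would do; it is fixed
  once so that \<open>q x\<close> dominates the operator \<open>Q x\<close>, with \<open>q0\<close>
  as the total size of the potential.\<close>

definition kq :: real where "kq = (SOME k. k > 0 \<and> (\<forall>(A :: complex^'m^'m) v. norm (A *v v) \<le> norm A * norm v * k))"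

definition q :: "real \<Rightarrow> real" where "q x = kq * qn x"

definition q0 :: real where "q0 = integral {0..pi} q"

lemma kq: "kq > 0" "norm ((A :: complex^'m^'m) *v v) \<le> norm A * norm v * kq"
proof -
  have "\<exists>k. k > 0 \<and> (\<forall>(A :: complex^'m^'m) v. norm (A *v v) \<le> norm A * norm v * k)"
    using mv.pos_bounded by blast
  from someI_ex[OF this] show "kq > 0" "norm (A *v v) \<le> norm A * norm v * kq"
    unfolding kq_def by blast+
qed

lemma q_integrable: "q absolutely_integrable_on {0..pi}"
  using absolutely_integrable_bilinear_continuous[OF bounded_bilinear_mult qn_integrable, of "\<lambda>_. kq"]
  by (simp add: q_def[abs_def] mult.commute)

lemma q_nonneg: "q x \<ge> 0" using kq qn_nonneg by (simp add: q_def)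

lemma q_bound: "norm (Q x *v v) \<le> q x * norm v"
  using kq(2)[of "Q x" v] by (simp add: q_def qn_def mult_ac)

lemma q0_nonneg: "q0 \<ge> 0"
  unfolding q0_def using q_nonneg set_lebesgue_integral_eq_integral(1)[OF q_integrable] by (intro integral_nonneg) auto

lemma q_times_integrable:
  fixes f :: "real \<Rightarrow> real"
  assumes "continuous_on {0..pi} f" "{u..v} \<subseteq> {0..pi}"
  shows "(\<lambda>t. q t * f t) integrable_on {u..v}"
  using integrable_subinterval_real[OF set_lebesgue_integral_eq_integral(1)[OF 
      absolutely_integrable_bilinear_continuous[OF bounded_bilinear_mult q_integrable assms(1)]] assms(2)] .

text \<open>The exponential removes the free oscillation exactly; what drives the component is the
  potential alone, with the small factor \<open>1 / (2 * \<i> * rho)\<close>.\<close>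

lemma wave_in_ac_deriv:
  assumes y: "vector_solution Q (rho^2) y dy" and rho: "rho \<noteq> 0"
  shows "ac_deriv 0 pi (\<lambda>x. exp (- \<i> * rho * of_real x) *s wave_in rho (y x) (dy x))
           (\<lambda>x. exp (- \<i> * rho * of_real x) *s ((1 / (2 * \<i> * rho)) *s (Q x *v y x)))"
proof -
  note y = vector_solutionD[OF y]
  have "ac_deriv 0 pi (\<lambda>x. wave_in rho (y x) (dy x)) (\<lambda>x. wave_in rho (dy x) (Q x *v y x - rho^2 *s y x))"
    unfolding wave_in_def
    by (intro ac_deriv_linear[OF sv.bounded_linear_right] ac_deriv_add y ac_deriv_linear[OF sv.bounded_linear_right, of _ _ dy])
  from ac_deriv_smult_exp[OF this, of "- \<i> * rho"]
  show ?thesis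
  proof (rule ac_deriv_cong)
    fix x
    have "wave_in rho (dy x) (Q x *v y x - rho^2 *s y x) + (- \<i> * rho) *s wave_in rho (y x) (dy x) = (1 / (2 * \<i> * rho)) *s (Q x *v y x)"
      using rho by (simp add: wave_in_def vec_eq_iff field_simps power2_eq_square)
    then show "exp (- \<i> * rho * of_real x) *s (wave_in rho (dy x) (Q x *v y x - rho^2 *s y x) + (- \<i> * rho) *s wave_in rho (y x) (dy x))
        = exp (- \<i> * rho * of_real x) *s ((1 / (2 * \<i> * rho)) *s (Q x *v y x))" by simp
  qed
qed

lemma wave_out_ac_deriv:
  assumes y: "vector_solution Q (rho^2) y dy" and rho: "rho \<noteq> 0"
  shows "ac_deriv 0 pi (\<lambda>x. exp (\<i> * rho * of_real x) *s wave_out rho (y x) (dy x))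
           (\<lambda>x. exp (\<i> * rho * of_real x) *s ((- 1 / (2 * \<i> * rho)) *s (Q x *v y x)))"
proof -
  note y = vector_solutionD[OF y]
  have "ac_deriv 0 pi (\<lambda>x. wave_out rho (y x) (dy x)) (\<lambda>x. wave_out rho (dy x) (Q x *v y x - rho^2 *s y x))"
    unfolding wave_out_def
    by (intro ac_deriv_linear[OF sv.bounded_linear_right] ac_deriv_diff y ac_deriv_linear[OF sv.bounded_linear_right, of _ _ dy])
  from ac_deriv_smult_exp[OF this, of "\<i> * rho"]
  show ?thesis
  proof (rule ac_deriv_cong)
    fix x
    have "wave_out rho (dy x) (Q x *v y x - rho^2 *s y x) + (\<i> * rho) *s wave_out rho (y x) (dy x) = (- 1 / (2 * \<i> * rho)) *s (Q x *v y x)"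
      using rho by (simp add: wave_out_def vec_eq_iff field_simps power2_eq_square)
    then show "exp (\<i> * rho * of_real x) *s (wave_out rho (dy x) (Q x *v y x - rho^2 *s y x) + (\<i> * rho) *s wave_out rho (y x) (dy x))
        = exp (\<i> * rho * of_real x) *s ((- 1 / (2 * \<i> * rho)) *s (Q x *v y x))" by simp
  qed
qed

lemma vector_solution_continuous:
  assumes "vector_solution Q lam y dy"
  shows "continuous_on {0..pi} y" "continuous_on {0..pi} dy"
  using vector_solutionD[OF assms] ac_derivD_continuous by blast+

lemma wave_in_bound:
  assumes y: "vector_solution Q (rho^2) y dy" and rho: "rho \<noteq> 0" and x: "x \<in> {0..pi}"
  shows "exp (Im rho * x) * norm (wave_in rho (y x) (dy x)) \<le> norm (wave_in rho (y 0) (dy 0))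
     + integral {0..x} (\<lambda>t. q t * (exp (Im rho * t) * norm (y t) / (2 * norm rho)))"
proof -
  let ?A = "\<lambda>x. exp (- \<i> * rho * of_real x) *s wave_in rho (y x) (dy x)"
  have "norm (?A x - ?A 0) \<le> integral {0..x} (\<lambda>t. q t * (exp (Im rho * t) * norm (y t) / (2 * norm rho)))"
  proof (rule ac_deriv_norm_bound[OF ac_deriv_subset[OF wave_in_ac_deriv[OF y rho]]])
    fix t
    have "norm (exp (- \<i> * rho * of_real t) *s ((1 / (2 * \<i> * rho)) *s (Q t *v y t))) 
        = exp (Im rho * t) * (norm (Q t *v y t) / (2 * norm rho))"
      by (simp add: norm_vector_smult norm_mult norm_divide)
    also have "\<dots> \<le> exp (Im rho * t) * (q t * norm (y t) / (2 * norm rho))"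
      by (intro mult_left_mono divide_right_mono q_bound) auto
    finally show "norm (exp (- \<i> * rho * of_real t) *s ((1 / (2 * \<i> * rho)) *s (Q t *v y t))) \<le> q t * (exp (Im rho * t) * norm (y t) / (2 * norm rho))"
      by (simp add: mult_ac)
  next
    show "(\<lambda>t. q t * (exp (Im rho * t) * norm (y t) / (2 * norm rho))) integrable_on {0..x}"
      using x rho by (intro q_times_integrable continuous_intros vector_solution_continuous[OF y]) auto
  qed (use x in auto)
  moreover have "norm (?A x) = exp (Im rho * x) * norm (wave_in rho (y x) (dy x))" by (simp add: norm_vector_smult)
  moreover have "norm (?A 0) = norm (wave_in rho (y 0) (dy 0))" by simp
  ultimately show ?thesis using norm_triangle_ineq2[of "?A x" "?A 0"] by linarith
qed

text \<open>Two-sided and between arbitrary points, because this component is followed forwards from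
  0 in \<open>solution_growth\<close> and backwards from \<pi> in
  \<open>solution_decay\<close>.\<close>

lemma wave_out_bound:
  assumes y: "vector_solution Q (rho^2) y dy" and rho: "rho \<noteq> 0" and uv: "{u..v} \<subseteq> {0..pi}" "u \<le> v"
  shows "\<bar>exp (- Im rho * u) * norm (wave_out rho (y u) (dy u)) - exp (- Im rho * v) * norm (wave_out rho (y v) (dy v))\<bar>
     \<le> integral {u..v} (\<lambda>t. q t * (exp (- Im rho * t) * norm (y t) / (2 * norm rho)))"
proof -
  let ?A = "\<lambda>x. exp (\<i> * rho * of_real x) *s wave_out rho (y x) (dy x)"
  have "norm (?A v - ?A u) \<le> integral {u..v} (\<lambda>t. q t * (exp (- Im rho * t) * norm (y t) / (2 * norm rho)))"
  proof (rule ac_deriv_norm_bound[OF ac_deriv_subset[OF wave_out_ac_deriv[OF y rho]]])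
    fix t
    have "norm (exp (\<i> * rho * of_real t) *s ((- 1 / (2 * \<i> * rho)) *s (Q t *v y t))) 
        = exp (- Im rho * t) * (norm (Q t *v y t) / (2 * norm rho))"
      by (simp add: norm_vector_smult norm_mult norm_divide)
    also have "\<dots> \<le> exp (- Im rho * t) * (q t * norm (y t) / (2 * norm rho))"
      by (intro mult_left_mono divide_right_mono q_bound) auto
    finally show "norm (exp (\<i> * rho * of_real t) *s ((- 1 / (2 * \<i> * rho)) *s (Q t *v y t))) \<le> q t * (exp (- Im rho * t) * norm (y t) / (2 * norm rho))"
      by (simp add: mult_ac)
  next
    show "(\<lambda>t. q t * (exp (- Im rho * t) * norm (y t) / (2 * norm rho))) integrable_on {u..v}"
      using uv rho by (intro q_times_integrable continuous_intros vector_solution_continuous[OF y]) auto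
  qed (use uv in auto)
  moreover have "norm (?A x) = exp (- Im rho * x) * norm (wave_out rho (y x) (dy x))" for x by (simp add: norm_vector_smult)
  ultimately show ?thesis using norm_triangle_ineq3[of "?A u" "?A v"] by (simp add: norm_minus_commute)
qed

text \<open>The sum of the norms of both components, weighted by \<open>exp (- Im rho * t)\<close>,
  satisfies a Gronwall inequality with kernel \<open>q t / norm rho\<close>. For large
  \<open>rho\<close> the potential thus changes the free growth by a bounded factor only.\<close>

lemma solution_growth:
  assumes y: "vector_solution Q (rho^2) y dy" and rho: "rho \<noteq> 0" "Im rho \<ge> 0" and x: "x \<in> {0..pi}"
  defines "N \<equiv> \<lambda>t. norm (wave_in rho (y t) (dy t)) + norm (wave_out rho (y t) (dy t))"
  shows "N x \<le> exp (Im rho * x) * (exp (q0 / norm rho) * N 0)"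
proof -
  define tau where "tau = Im rho"
  define u where "u t = exp (- tau * t) * N t" for t
  define h where "h t = q t / norm rho" for t
  have Nc: "continuous_on {0..pi} N" unfolding N_def wave_in_def wave_out_def
    by (intro continuous_intros vector_solution_continuous[OF y] 
       bounded_linear.continuous_on[OF sv.bounded_linear_right])
  have h: "h absolutely_integrable_on {0..pi}"
    using absolutely_integrable_bilinear_continuous[OF bounded_bilinear_mult q_integrable, of "\<lambda>_. 1 / norm rho"]
    by (simp add: h_def[abs_def])
  have yN: "norm (y t) \<le> N t" for t
    unfolding N_def by (metis norm_triangle_ineq wave_sum)
  have uc: "continuous_on {0..pi} u" unfolding u_def by (intro continuous_intros Nc)
  have gron: "u x \<le> N 0 + integral {0..x} (\<lambda>t. h t * u t)" if x: "x \<in> {0..pi}" for x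
  proof -
    have sub: "{0..x} \<subseteq> {0..pi}" using x by auto
    let ?k = "\<lambda>t. q t * (exp (- tau * t) * N t / (2 * norm rho))"
    have ki: "?k integrable_on {0..x}"
      using rho by (intro q_times_integrable[OF _ sub] continuous_intros Nc) auto
    have 1: "exp (- tau * x) * norm (wave_in rho (y x) (dy x)) \<le> norm (wave_in rho (y 0) (dy 0)) + integral {0..x} ?k"
    proof -
      let ?J = "\<lambda>t. q t * (exp (tau * t) * norm (y t) / (2 * norm rho))"
      have Ji: "?J integrable_on {0..x}"
        using rho by (intro q_times_integrable[OF _ sub] continuous_intros vector_solution_continuous[OF y]) auto
      \<comment> \<open>\<open>wave_in_bound\<close> carries the weight with the opposite sign; the
        correction \<open>exp (- 2 * tau * x)\<close> is harmless since \<open>t \<le> x\<close> and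
        \<open>tau \<ge> 0\<close>.\<close>
      have e: "exp (- tau * x) = exp (- 2 * tau * x) * exp (tau * x)" by (simp add: exp_add[symmetric])
      have "exp (- tau * x) * norm (wave_in rho (y x) (dy x)) = exp (- 2 * tau * x) * (exp (tau * x) * norm (wave_in rho (y x) (dy x)))"
        by (simp only: e mult.assoc)
      also have "\<dots> \<le> exp (- 2 * tau * x) * (norm (wave_in rho (y 0) (dy 0)) + integral {0..x} ?J)"
        using wave_in_bound[OF y rho(1) x] by (intro mult_left_mono) (auto simp: tau_def)
      also have "\<dots> = exp (- 2 * tau * x) * norm (wave_in rho (y 0) (dy 0)) + integral {0..x} (\<lambda>t. exp (- 2 * tau * x) * ?J t)"
        by (simp add: distrib_left)
      also have "exp (- 2 * tau * x) * norm (wave_in rho (y 0) (dy 0)) \<le> 1 * norm (wave_in rho (y 0) (dy 0))"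
        using rho x by (intro mult_right_mono) (auto simp: tau_def)
      also have "integral {0..x} (\<lambda>t. exp (- 2 * tau * x) * ?J t) \<le> integral {0..x} ?k"
      proof (rule integral_le[OF _ ki])
        show "(\<lambda>t. exp (- 2 * tau * x) * ?J t) integrable_on {0..x}" using Ji by (rule integrable_on_mult_right)
        fix t assume t: "t \<in> {0..x}"
        have "exp (- 2 * tau * x) * exp (tau * t) = exp (tau * (t - 2 * x))" by (simp add: exp_add[symmetric] algebra_simps)
        also have "\<dots> \<le> exp (- tau * t)" 
        proof -
          have "tau * (t - 2 * x) \<le> tau * (- t)" using rho t by (intro mult_left_mono) (auto simp: tau_def)
          then show ?thesis by simp
        qed
        finally have e: "exp (- 2 * tau * x) * exp (tau * t) \<le> exp (- tau * t)" .
        have "exp (- 2 * tau * x) * ?J t = q t / (2 * norm rho) * ((exp (- 2 * tau * x) * exp (tau * t)) * norm (y t))" by (simp add: mult_ac)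
        also have "\<dots> \<le> q t / (2 * norm rho) * (exp (- tau * t) * N t)"
          using q_nonneg[of t] by (intro mult_left_mono mult_mono e yN) auto
        finally show "exp (- 2 * tau * x) * ?J t \<le> ?k t" by (simp add: mult_ac)
      qed
      finally show ?thesis by simp
    qed
    have 2: "exp (- tau * x) * norm (wave_out rho (y x) (dy x)) \<le> norm (wave_out rho (y 0) (dy 0)) + integral {0..x} ?k"
    proof -
      have "exp (- tau * x) * norm (wave_out rho (y x) (dy x)) - norm (wave_out rho (y 0) (dy 0)) \<le>
         integral {0..x} (\<lambda>t. q t * (exp (- Im rho * t) * norm (y t) / (2 * norm rho)))"
        using wave_out_bound[OF y rho(1) sub] x by (simp add: tau_def)
      also have "\<dots> \<le> integral {0..x} ?k"
      proof (rule integral_le[OF _ ki])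
        show "(\<lambda>t. q t * (exp (- Im rho * t) * norm (y t) / (2 * norm rho))) integrable_on {0..x}"
          using rho by (intro q_times_integrable[OF _ sub] continuous_intros vector_solution_continuous[OF y]) auto
        show "q t * (exp (- Im rho * t) * norm (y t) / (2 * norm rho)) \<le> ?k t" for t
          unfolding tau_def using q_nonneg[of t] yN[of t] by (intro mult_left_mono divide_right_mono) auto
      qed
      finally show ?thesis by simp
    qed
    have "u x \<le> N 0 + 2 * integral {0..x} ?k" using 1 2 unfolding u_def N_def by (simp add: distrib_left)
    also have "2 * integral {0..x} ?k = integral {0..x} (\<lambda>t. h t * u t)"
      by (subst integral_mult_right[symmetric]) (simp add: h_def u_def mult_ac)
    finally show ?thesis .
  qed
  have "u x \<le> N 0 * exp (integral {0..x} h)"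
    by (rule Gronwall[OF h _ uc gron x]) (use q_nonneg in \<open>auto simp: h_def\<close>)
  note ux = this
  have "integral {0..x} h \<le> integral {0..pi} h"
    using x q_nonneg set_lebesgue_integral_eq_integral(1)[OF h] integrable_subinterval_real[of h 0 pi 0 x]
    by (intro integral_subset_le) (auto simp: h_def)
  also have "integral {0..pi} h = q0 / norm rho" unfolding h_def q0_def by simp
  finally have "N 0 * exp (integral {0..x} h) \<le> N 0 * exp (q0 / norm rho)"
    by (intro mult_left_mono) (auto simp: N_def)
  with ux have "u x \<le> N 0 * exp (q0 / norm rho)" by simp
  then have "exp (tau * x) * u x \<le> exp (tau * x) * (N 0 * exp (q0 / norm rho))" by (intro mult_left_mono) auto
  moreover have "exp (tau * x) * u x = N x" by (simp add: u_def exp_minus)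
  ultimately have "N x \<le> exp (tau * x) * (N 0 * exp (q0 / norm rho))" by metis
  then show ?thesis by (simp only: tau_def mult.commute[of "N 0"])
qed

lemma solution_growth':
  assumes y: "vector_solution Q (rho^2) y dy" and rho: "rho \<noteq> 0" "Im rho \<ge> 0" and x: "x \<in> {0..pi}"
  defines "K \<equiv> 2 * exp (q0 / norm rho) * exp (Im rho * x) * (norm (y 0) + norm (dy 0) / norm rho)"
  shows "norm (y x) \<le> K" "norm (dy x) \<le> norm rho * K"
proof -
  define N where "N = (\<lambda>t. norm (wave_in rho (y t) (dy t)) + norm (wave_out rho (y t) (dy t)))"
  have "N 0 \<le> 2 * (norm (y 0) + norm (dy 0) / norm rho)"
    using add_mono[OF wave_norm[of rho "y 0" "dy 0"]] unfolding N_def mult_2 by simp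
  have "N x \<le> exp (Im rho * x) * (exp (q0 / norm rho) * N 0)"
    using solution_growth[OF y rho x] unfolding N_def .
  also have "\<dots> \<le> exp (Im rho * x) * (exp (q0 / norm rho) * (2 * (norm (y 0) + norm (dy 0) / norm rho)))"
    by (intro mult_left_mono) (use \<open>N 0 \<le> _\<close> in auto)
  also have "\<dots> = K" by (simp add: K_def)
  finally have NK: "N x \<le> K" .
  have "norm (y x) \<le> N x" unfolding N_def by (metis norm_triangle_ineq wave_sum)
  then show "norm (y x) \<le> K" using NK by simp
  have "norm (dy x) = norm rho * norm (wave_in rho (y x) (dy x) - wave_out rho (y x) (dy x))"
    by (subst wave_diff[OF rho(1), symmetric, of "dy x" "y x"], subst norm_vector_smult) (simp add: norm_mult)
  also have "\<dots> \<le> norm rho * N x" unfolding N_def by (intro mult_left_mono norm_triangle_ineq4) auto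
  also have "\<dots> \<le> norm rho * K" using NK by (intro mult_left_mono) auto
  finally show "norm (dy x) \<le> norm rho * K" .
qed

end

section \<open>Decay of the solutions that satisfy the condition at \<pi>\<close>

locale boundary_value =
  fixes Q :: "real \<Rightarrow> complex^'m^'m" and T1 T2 G1 G2 :: "complex^'m^'m"
  assumes bvp: "boundary_value_problem Q T1 T2 G1 G2"
begin

sublocale hermitian_potential Q
  by unfold_locales (use bvp in \<open>auto simp: boundary_value_problem_def\<close>)

lemma T1: "T1\<^sup>\<dagger> = T1" "T1 ** T1 = T1" and T2: "T2\<^sup>\<dagger> = T2" "T2 ** T2 = T2"
  and G1: "G1\<^sup>\<dagger> = G1" "T1 ** G1 = G1" "G1 ** T1 = G1" and G2: "G2\<^sup>\<dagger> = G2" "T2 ** G2 = G2" "G2 ** T2 = G2"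
proof -
  have t: "T1 = T1\<^sup>\<dagger>" "T1 = T1 ** T1" "T2 = T2\<^sup>\<dagger>" "T2 = T2 ** T2" "G1 = G1\<^sup>\<dagger>" "G1 = T1 ** G1 ** T1" "G2 = G2\<^sup>\<dagger>" "G2 = T2 ** G2 ** T2"
    using bvp unfolding boundary_value_problem_def by blast+
  show "T1\<^sup>\<dagger> = T1" "T1 ** T1 = T1" "T2\<^sup>\<dagger> = T2" "T2 ** T2 = T2" "G1\<^sup>\<dagger> = G1" "G2\<^sup>\<dagger> = G2"
    using t by simp_all
  show "T1 ** G1 = G1" "G1 ** T1 = G1" "T2 ** G2 = G2" "G2 ** T2 = G2"
    by (metis t matrix_mul_assoc)+
qed

text \<open>The two summands of the form lie in the ranges of \<open>T\<close> and of
  \<open>mat 1 - T\<close>, so that each has to vanish separately.\<close>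

lemma boundary_form_vector_split:
  assumes "T ** T = T" "T ** G = (G :: complex^'m^'m)"
  shows "boundary_form_vector T G u w = 0 \<longleftrightarrow> T *v u = u \<and> T *v w = G *v u"
proof
  assume 0: "boundary_form_vector T G u w = 0"
  then have "T *v boundary_form_vector T G u w = 0" by (simp add: mv.zero_right)
  moreover have "T *v boundary_form_vector T G u w = T *v w - G *v u"
    using assms by (simp add: boundary_form_vector_def mv.diff_left mv.diff_right matrix_vector_mul_assoc)
  ultimately have 1: "T *v w = G *v u" by simp
  have "boundary_form_vector T G u w = T *v w - G *v u - (u - T *v u)"
    using assms by (simp add: boundary_form_vector_def mv.diff_left mv.diff_right matrix_vector_mul_assoc)
  then have "u - T *v u = 0" using 0 1 by simp
  then show "T *v u = u \<and> T *v w = G *v u" using 1 by simp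
next
  assume "T *v u = u \<and> T *v w = G *v u"
  then show "boundary_form_vector T G u w = 0"
    using assms by (simp add: boundary_form_vector_def mv.diff_left mv.diff_right matrix_vector_mul_assoc)
qed

text \<open>Scaled size of the wave returning to 0: the first summand is the reflection at \<pi>,
  the second the scattering by the potential at depth \<open>t\<close>. A way of length
  \<open>t\<close> and back costs \<open>exp (- 2 * Im rho * t)\<close>.\<close>

definition remainder :: "complex \<Rightarrow> real"
  where "remainder rho = norm rho * exp (- 2 * Im rho * pi) + integral {0..pi} (\<lambda>t. q t * exp (- 2 * Im rho * t))"

text \<open>In terms of the components \<open>a\<close> and \<open>b\<close> the condition reads
  \<open>b = 2 *s (T2 *v a) - a\<close> up to a term bounded by a multiple of
  \<open>norm u / norm rho\<close>. For large \<open>rho\<close> that term is at most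
  \<open>norm u / 2\<close> and can be absorbed.\<close>

lemma reflection_bound:
  obtains k R where "k \<ge> 0" "R > 0" "\<And>rho u w. norm rho \<ge> R \<Longrightarrow> boundary_form_vector T2 G2 u w = 0 \<Longrightarrow>
     norm (wave_out rho u w) \<le> k * norm (wave_in rho u w)"
proof -
  define g where "g = norm G2 * kq + 1"
  define c where "c = norm T2 * kq"
  have g: "g > 0" "c \<ge> 0" using kq(1) by (auto simp: g_def c_def intro: add_nonneg_pos)
  show ?thesis
  proof (rule that[of "4 * c + 3" "2 * g"])
    fix rho :: complex and u w :: "complex^'m"
    assume rho: "norm rho \<ge> 2 * g" and bc: "boundary_form_vector T2 G2 u w = 0"
    have r0: "rho \<noteq> 0" using rho g by auto
    define a b where "a = wave_in rho u w" and "b = wave_out rho u w"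
    have u: "u = a + b" and w: "w = (\<i> * rho) *s (a - b)"
      using wave_sum[of rho u w] wave_diff[OF r0, of u w] by (simp_all add: a_def b_def)
    have bc': "T2 *v u = u" "T2 *v w = G2 *v u" using bc boundary_form_vector_split T2(2) G2(2) by blast+
    have "(\<i> * rho) *s (T2 *v a - T2 *v b) = G2 *v u"
      using bc'(2) by (simp add: w mv.diff_right vector_scalar_commute[symmetric])
    then have "T2 *v a - T2 *v b = (1 / (\<i> * rho)) *s (G2 *v u)"
      using r0 by (metis (no_types, lifting) divide_self_if mult_eq_0_iff times_divide_eq_left vector_smult_assoc vector_smult_lid mult_1 complex_i_not_zero)
    moreover have "T2 *v a + T2 *v b = a + b" using bc'(1) by (simp add: u mv.add_right)
    ultimately have b: "b = 2 *s (T2 *v a) - a - (1 / (\<i> * rho)) *s (G2 *v u)"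
      by (simp add: vec_eq_iff algebra_simps)
    have "norm ((1 / (\<i> * rho)) *s (G2 *v u)) = norm (G2 *v u) / norm rho"
      by (simp add: norm_vector_smult norm_divide norm_mult)
    also have "\<dots> \<le> (norm G2 * norm u * kq) / (2 * g)"
      using rho g kq by (intro frac_le) auto
    also have "\<dots> \<le> (norm u * g) / (2 * g)"
      using g kq(1) by (intro divide_right_mono) (auto simp: g_def algebra_simps)
    also have "\<dots> = norm u / 2" using g by simp
    finally have 1: "norm ((1 / (\<i> * rho)) *s (G2 *v u)) \<le> norm u / 2" .
    have 2: "norm (2 *s (T2 *v a)) \<le> 2 * (c * norm a)"
      using kq(2)[of T2 a] by (simp only: norm_vector_smult) (simp add: c_def mult_ac)
    have "norm b \<le> norm (2 *s (T2 *v a)) + norm a + norm ((1 / (\<i> * rho)) *s (G2 *v u))"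
      by (subst b) (meson norm_triangle_ineq4 order_trans add_mono order_refl)
    also have "\<dots> \<le> 2 * (c * norm a) + norm a + norm u / 2" using 1 2 by linarith
    also have "norm u \<le> norm a + norm b" unfolding u by (rule norm_triangle_ineq)
    finally have "norm b \<le> 2 * (c * norm a) + norm a + (norm a + norm b) / 2" by simp
    then have "norm b \<le> 4 * (c * norm a) + 3 * norm a" by (simp add: field_simps)
    then show "norm (wave_out rho u w) \<le> (4 * c + 3) * norm (wave_in rho u w)"
      by (simp add: a_def b_def algebra_simps)
  qed (use g in auto)
qed

lemma remainder_bound:
  assumes "Im rho \<ge> norm rho / 2"
  shows "remainder rho \<le> 1 + q0" "remainder rho \<ge> 0"
proof -
  have Im0: "Im rho \<ge> 0" using assms norm_ge_zero[of rho] by linarith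
  have "norm rho * exp (- 2 * Im rho * pi) \<le> norm rho * exp (- norm rho)"
  proof (intro mult_left_mono)
    have "norm rho * 1 \<le> 2 * Im rho * pi" using assms pi_gt3 Im0 by (intro mult_mono) auto
    then show "exp (- 2 * Im rho * pi) \<le> exp (- norm rho)" by simp
  qed simp
  also have "\<dots> \<le> 1"
  proof -
    have "norm rho \<le> exp (norm rho)" using exp_ge_add_one_self[of "norm rho"] by linarith
    then show ?thesis by (simp add: exp_minus field_simps)
  qed
  finally have 1: "norm rho * exp (- 2 * Im rho * pi) \<le> 1" .
  have "Im rho \<ge> 0" using assms norm_ge_zero[of rho] by linarith
  have i: "(\<lambda>t. q t * exp (- 2 * Im rho * t)) integrable_on {0..pi}"
    by (intro q_times_integrable continuous_intros) auto
  have "integral {0..pi} (\<lambda>t. q t * exp (- 2 * Im rho * t)) \<le> q0"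
    unfolding q0_def
  proof (rule integral_le[OF i])
    show "q integrable_on {0..pi}" using set_lebesgue_integral_eq_integral(1)[OF q_integrable] .
    fix t assume "t \<in> {0..pi}"
    then have "exp (- 2 * Im rho * t) \<le> 1" using \<open>Im rho \<ge> 0\<close> by simp
    then show "q t * exp (- 2 * Im rho * t) \<le> q t" using q_nonneg[of t] by (simp add: mult_left_le)
  qed
  with 1 show "remainder rho \<le> 1 + q0" by (simp add: remainder_def)
  have "integral {0..pi} (\<lambda>t. q t * exp (- 2 * Im rho * t)) \<ge> 0"
    using i q_nonneg by (intro integral_nonneg) auto
  then show "remainder rho \<ge> 0" by (simp add: remainder_def)
qed

text \<open>An integrable potential allows no rate, so dominated convergence takes its place; the
  limit of the integrand is 0 except at \<open>t = 0\<close>.\<close>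

lemma remainder_tendsto_0: "(\<lambda>n. remainder (\<i> * of_nat n)) \<longlonglongrightarrow> 0"
proof -
  have 1: "(\<lambda>n. real n * exp (- 2 * real n * pi)) \<longlonglongrightarrow> 0"
  proof (rule Lim_null_comparison)
    show "\<forall>\<^sub>F n in sequentially. norm (real n * exp (- 2 * real n * pi)) \<le> inverse (real n)"
    proof (intro eventually_sequentiallyI[of 1])
      fix n :: nat assume n: "n \<ge> 1"
      have "real n * real n \<le> (1 + real n * pi)\<^sup>2" 
        unfolding power2_eq_square using pi_gt3 by (intro mult_mono) (auto intro!: add_nonneg_nonneg simp: add_increasing mult_le_cancel_left1)
      also have "\<dots> \<le> (exp (real n * pi))\<^sup>2"
        by (intro power_mono exp_ge_add_one_self) (auto intro: add_nonneg_nonneg)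
      also have "\<dots> = exp (2 * real n * pi)" by (simp add: power2_eq_square exp_add[symmetric])
      finally have "real n * real n \<le> exp (2 * real n * pi)" .
      then show "norm (real n * exp (- 2 * real n * pi)) \<le> inverse (real n)"
        using n by (simp add: exp_minus field_simps)
    qed
    show "(\<lambda>n. inverse (real n)) \<longlonglongrightarrow> 0" by (rule lim_inverse_n)
  qed
  have qi: "q integrable_on {0..pi}" using set_lebesgue_integral_eq_integral(1)[OF q_integrable] .
  have "(\<lambda>n. integral {0..pi} (\<lambda>t. q t * exp (- 2 * real n * t))) \<longlonglongrightarrow> integral {0..pi} (\<lambda>t. if t = 0 then q 0 else 0)"
  proof (rule dominated_convergence(2)[where h = q])
    show "(\<lambda>t. q t * exp (- 2 * real n * t)) integrable_on {0..pi}" for n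
      by (intro q_times_integrable continuous_intros) auto
    show "norm (q t * exp (- 2 * real n * t)) \<le> q t" if "t \<in> {0..pi}" for n t
      using q_nonneg[of t] that by (auto simp: abs_mult mult_left_le)
    show "(\<lambda>n. q t * exp (- 2 * real n * t)) \<longlonglongrightarrow> (if t = 0 then q 0 else 0)" if "t \<in> {0..pi}" for t
    proof (cases "t = 0")
      case False
      then have "exp (- 2 * t) < 1" using that by simp
      then have "(\<lambda>n. q t * exp (- 2 * t) ^ n) \<longlonglongrightarrow> q t * 0"
        by (intro tendsto_intros LIMSEQ_power_zero) auto
      then show ?thesis using False by (simp add: exp_of_nat_mult[symmetric] mult_ac)
    qed auto
  qed (rule qi)
  moreover have "integral {0..pi} (\<lambda>t. if t = 0 then q 0 else 0) = 0"
    by (rule integral_unique, rule has_integral_spike_finite[OF _ _ has_integral_0, of "{0}"]) auto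
  ultimately have "(\<lambda>n. integral {0..pi} (\<lambda>t. q t * exp (- 2 * real n * t))) \<longlonglongrightarrow> 0" by simp
  from tendsto_add[OF 1 this] show ?thesis by (simp add: remainder_def norm_mult)
qed

text \<open>A solution satisfying the boundary condition at \<open>\<pi>\<close> is, for large \<open>\<rho>\<close>, dominated by its
  component along \<open>exp (i \<rho> x)\<close>: the suprema of both components, weighted by \<open>exp (x Im \<rho>)\<close>, bound
  each other up to a factor \<open>O(1/\<rho>)\<close>, the reflection at \<open>\<pi>\<close> being a bounded operator.\<close>

lemma solution_decay:
  obtains K R where "K > 0" "R > 0"
    "\<And>rho y dy. norm rho \<ge> R \<Longrightarrow> Im rho \<ge> 0 \<Longrightarrow> vector_solution Q (rho^2) y dy \<Longrightarrow>
       boundary_form_vector T2 G2 (y pi) (dy pi) = 0 \<Longrightarrow>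
       (\<forall>x\<in>{0..pi}. exp (Im rho * x) * (norm (wave_in rho (y x) (dy x)) + norm (wave_out rho (y x) (dy x))) \<le> K * norm (wave_in rho (y 0) (dy 0))) \<and>
       norm rho * norm (wave_out rho (y 0) (dy 0)) \<le> K * remainder rho * norm (wave_in rho (y 0) (dy 0))"
proof -
  obtain k R where kR: "k \<ge> 0" "R > 0" "\<And>rho u w. norm rho \<ge> R \<Longrightarrow> boundary_form_vector T2 G2 u w = 0 \<Longrightarrow>
     norm (wave_out rho u w) \<le> k * norm (wave_in rho u w)"
    by (rule reflection_bound) blast
  \<comment> \<open>Makes \<open>(2 + k) * e\<close> at most 1/2 below, where
    \<open>e = q0 / (2 * norm rho)\<close>.\<close>
  define R' where "R' = max R ((2 + k) * (q0 + 1))"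
  define K where "K = 2 * (1 + k)"
  show ?thesis
  proof (rule that[of K R'])
    fix rho :: complex and y dy :: "real \<Rightarrow> complex^'m"
    assume rho: "norm rho \<ge> R'" "Im rho \<ge> 0" and y: "vector_solution Q (rho^2) y dy"
      and bc: "boundary_form_vector T2 G2 (y pi) (dy pi) = 0"
    have R: "norm rho \<ge> R" and R2: "(2 + k) * (q0 + 1) \<le> norm rho" using rho by (auto simp: R'_def)
    have r0: "rho \<noteq> 0" using R kR by auto
    define tau where "tau = Im rho"
    have tau: "tau \<ge> 0" using rho by (simp add: tau_def)
    define a b where "a x = norm (wave_in rho (y x) (dy x))" and "b x = norm (wave_out rho (y x) (dy x))" for x
    have yab: "norm (y t) \<le> a t + b t" for t
      unfolding a_def b_def by (metis norm_triangle_ineq wave_sum)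
    have ac: "continuous_on {0..pi} (\<lambda>x. exp (tau * x) * a x)" "continuous_on {0..pi} (\<lambda>x. exp (tau * x) * b x)"
      unfolding a_def b_def wave_in_def wave_out_def
      by (intro continuous_intros vector_solution_continuous[OF y] 
         bounded_linear.continuous_on[OF sv.bounded_linear_right])+
    obtain x1 where x1: "x1 \<in> {0..pi}" "\<And>x. x \<in> {0..pi} \<Longrightarrow> exp (tau * x) * a x \<le> exp (tau * x1) * a x1"
      using continuous_attains_sup[OF _ _ ac(1)] by auto
    obtain x2 where x2: "x2 \<in> {0..pi}" "\<And>x. x \<in> {0..pi} \<Longrightarrow> exp (tau * x) * b x \<le> exp (tau * x2) * b x2"
      using continuous_attains_sup[OF _ _ ac(2)] by auto
    define A B where "A = exp (tau * x1) * a x1" and "B = exp (tau * x2) * b x2"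
    have AB0: "A \<ge> 0" "B \<ge> 0" by (auto simp: A_def B_def a_def b_def)
    have yAB: "exp (tau * t) * norm (y t) \<le> A + B" if "t \<in> {0..pi}" for t
    proof -
      have "exp (tau * t) * norm (y t) \<le> exp (tau * t) * (a t + b t)" by (intro mult_left_mono yab) auto
      then show ?thesis using x1(2)[OF that] x2(2)[OF that] by (simp add: A_def B_def distrib_left)
    qed
    define e where "e = q0 / (2 * norm rho)"
    have qi: "q integrable_on {0..pi}" using set_lebesgue_integral_eq_integral(1)[OF q_integrable] .
    have sub_q: "integral {u..v} q \<le> q0" if "{u..v} \<subseteq> {0..pi}" for u v
      unfolding q0_def by (rule integral_subset_le[OF that integrable_subinterval_real[OF qi that] qi]) (use q_nonneg in auto)
    have A: "A \<le> a 0 + e * (A + B)"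
    proof -
      have sub: "{0..x1} \<subseteq> {0..pi}" using x1 by auto
      have "A \<le> a 0 + integral {0..x1} (\<lambda>t. q t * (exp (tau * t) * norm (y t) / (2 * norm rho)))"
        using wave_in_bound[OF y r0 x1(1)] by (simp add: A_def a_def tau_def)
      also have "integral {0..x1} (\<lambda>t. q t * (exp (tau * t) * norm (y t) / (2 * norm rho))) \<le> integral {0..x1} (\<lambda>t. q t * ((A + B) / (2 * norm rho)))"
      proof (rule integral_le)
        show "(\<lambda>t. q t * (exp (tau * t) * norm (y t) / (2 * norm rho))) integrable_on {0..x1}"
          using r0 by (intro q_times_integrable[OF _ sub] continuous_intros vector_solution_continuous[OF y]) auto
        show "(\<lambda>t. q t * ((A + B) / (2 * norm rho))) integrable_on {0..x1}"
          by (intro q_times_integrable[OF _ sub] continuous_intros)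
        fix t assume "t \<in> {0..x1}"
        then have "t \<in> {0..pi}" using sub by auto
        then show "q t * (exp (tau * t) * norm (y t) / (2 * norm rho)) \<le> q t * ((A + B) / (2 * norm rho))"
          using q_nonneg[of t] yAB by (intro mult_left_mono divide_right_mono) auto
      qed
      also have "\<dots> = integral {0..x1} q * ((A + B) / (2 * norm rho))" by simp
      also have "\<dots> \<le> q0 * ((A + B) / (2 * norm rho))" using sub_q[OF sub] AB0 by (intro mult_right_mono) auto
      finally show ?thesis by (simp add: e_def)
    qed
    have bpi: "b pi \<le> k * a pi" using kR(3)[OF R bc] by (simp add: a_def b_def)
    have out: "b u \<le> exp (tau * u) * (exp (- tau * pi) * b pi + integral {u..pi} (\<lambda>t. q t * (exp (- tau * t) * norm (y t) / (2 * norm rho))))"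
      if "u \<in> {0..pi}" for u
    proof -
      have 1: "exp (- tau * u) * b u \<le> exp (- tau * pi) * b pi + integral {u..pi} (\<lambda>t. q t * (exp (- tau * t) * norm (y t) / (2 * norm rho)))"
        using wave_out_bound[OF y r0, of u pi] that by (simp add: b_def tau_def)
      have eq: "exp (tau * u) * (exp (- tau * u) * b u) = b u" by (simp add: exp_minus)
      show ?thesis by (rule mult_left_mono[OF 1 exp_ge_zero[of "tau * u"], unfolded eq])
    qed
    \<comment> \<open>The component is followed backwards from \<pi>: on \<open>{x2..pi}\<close> the
      exponent \<open>2 * tau * x2 - tau * t\<close> does not exceed \<open>tau * t\<close>, so the
      weighted bound for \<open>y\<close> applies.\<close>
    have B: "B \<le> k * A + e * (A + B)"
    proof -
      have sub: "{x2..pi} \<subseteq> {0..pi}" using x2 by auto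
      let ?J = "\<lambda>t. q t * (exp (- tau * t) * norm (y t) / (2 * norm rho))"
      have Ji: "?J integrable_on {x2..pi}"
        using r0 by (intro q_times_integrable[OF _ sub] continuous_intros vector_solution_continuous[OF y]) auto
      have ee: "exp (tau * x2) * (exp (tau * x2) * z) = exp (2 * tau * x2) * z" for z :: real
      proof -
        have "exp (tau * x2) * exp (tau * x2) = exp (2 * tau * x2)" by (simp add: exp_add[symmetric])
        then show ?thesis by (metis mult.assoc)
      qed
      have "B \<le> exp (tau * x2) * (exp (tau * x2) * (exp (- tau * pi) * b pi + integral {x2..pi} ?J))"
        unfolding B_def by (intro mult_left_mono out x2) auto
      also have "\<dots> = exp (2 * tau * x2) * (exp (- tau * pi) * b pi) + integral {x2..pi} (\<lambda>t. exp (2 * tau * x2) * ?J t)"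
        unfolding ee by (simp add: distrib_left)
      also have "exp (2 * tau * x2) * (exp (- tau * pi) * b pi) \<le> k * A"
      proof -
        have "exp (2 * tau * x2) * exp (- tau * pi) \<le> exp (tau * pi)"
        proof -
          have "tau * x2 \<le> tau * pi" using tau x2 by (intro mult_left_mono) auto
          then have "2 * tau * x2 - tau * pi \<le> tau * pi" by linarith
          then show ?thesis by (simp add: exp_add[symmetric])
        qed
        then have "exp (2 * tau * x2) * exp (- tau * pi) * b pi \<le> exp (tau * pi) * (k * a pi)"
          using bpi by (intro mult_mono) (auto simp: b_def)
        also have "\<dots> \<le> k * A" using x1(2)[of pi] kR(1) mult_left_mono[of "exp (tau * pi) * a pi" A k] by (simp add: A_def mult_ac)
        finally show ?thesis by (simp add: mult.assoc)
      qed
      also have "integral {x2..pi} (\<lambda>t. exp (2 * tau * x2) * ?J t) \<le> integral {x2..pi} (\<lambda>t. q t * ((A + B) / (2 * norm rho)))"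
      proof (rule integral_le)
        show "(\<lambda>t. exp (2 * tau * x2) * ?J t) integrable_on {x2..pi}" using Ji by (rule integrable_on_mult_right)
        show "(\<lambda>t. q t * ((A + B) / (2 * norm rho))) integrable_on {x2..pi}"
          by (intro q_times_integrable[OF _ sub] continuous_intros)
        fix t assume t: "t \<in> {x2..pi}"
        then have t': "t \<in> {0..pi}" using sub by auto
        have "tau * x2 \<le> tau * t" using tau t by (intro mult_left_mono) auto
        then have "2 * tau * x2 - tau * t \<le> tau * t" by linarith
        then have "exp (2 * tau * x2) * exp (- tau * t) \<le> exp (tau * t)" by (simp add: exp_add[symmetric])
        then have "exp (2 * tau * x2) * exp (- tau * t) * norm (y t) \<le> exp (tau * t) * norm (y t)" by (intro mult_right_mono) auto
        also have "\<dots> \<le> A + B" using yAB[OF t'] .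
        finally have "q t / (2 * norm rho) * (exp (2 * tau * x2) * exp (- tau * t) * norm (y t)) \<le> q t / (2 * norm rho) * (A + B)"
          using q_nonneg[of t] by (intro mult_left_mono) auto
        then show "exp (2 * tau * x2) * ?J t \<le> q t * ((A + B) / (2 * norm rho))" by (simp add: mult_ac)
      qed
      also have "\<dots> = integral {x2..pi} q * ((A + B) / (2 * norm rho))" by simp
      also have "\<dots> \<le> q0 * ((A + B) / (2 * norm rho))" using sub_q[OF sub] AB0 by (intro mult_right_mono) auto
      finally show ?thesis by (simp add: e_def)
    qed
    have "(2 + k) * e \<le> 1 / 2"
    proof -
      have "(2 + k) * q0 \<le> (2 + k) * (q0 + 1)" using kR(1) by (intro mult_left_mono) auto
      then have "(2 + k) * q0 \<le> norm rho" using R2 by linarith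
      then show ?thesis using r0 by (simp add: e_def field_simps)
    qed
    then have small: "(2 + k) * e * (A + B) \<le> 1 / 2 * (A + B)" using AB0 by (intro mult_right_mono) auto
    \<comment> \<open>The bound for \<open>A\<close> is inserted into the term \<open>k * A\<close>;
      then half of \<open>A + B\<close> is absorbed, which explains
      \<open>K = 2 * (1 + k)\<close>.\<close>
    have "k * A \<le> k * a 0 + k * (e * (A + B))" using mult_left_mono[OF A kR(1)] by (simp add: distrib_left)
    then have "A + B \<le> (1 + k) * a 0 + (2 + k) * e * (A + B)" using A B by (simp add: algebra_simps)
    then have AB: "A + B \<le> K * a 0" using small by (simp add: K_def algebra_simps)
    show "(\<forall>x\<in>{0..pi}. exp (Im rho * x) * (norm (wave_in rho (y x) (dy x)) + norm (wave_out rho (y x) (dy x))) \<le> K * norm (wave_in rho (y 0) (dy 0))) \<and>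
       norm rho * norm (wave_out rho (y 0) (dy 0)) \<le> K * remainder rho * norm (wave_in rho (y 0) (dy 0))"
    proof
      show "\<forall>x\<in>{0..pi}. exp (Im rho * x) * (norm (wave_in rho (y x) (dy x)) + norm (wave_out rho (y x) (dy x))) \<le> K * norm (wave_in rho (y 0) (dy 0))"
      proof
        fix x assume x: "x \<in> {0..pi}"
        have "exp (tau * x) * (a x + b x) \<le> A + B" using x1(2)[OF x] x2(2)[OF x] by (simp add: A_def B_def distrib_left)
        then show "exp (Im rho * x) * (norm (wave_in rho (y x) (dy x)) + norm (wave_out rho (y x) (dy x))) \<le> K * norm (wave_in rho (y 0) (dy 0))"
          using AB by (simp add: a_def b_def tau_def)
      qed
      let ?J = "\<lambda>t. q t * (exp (- tau * t) * norm (y t) / (2 * norm rho))"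
      \<comment> \<open>At 0 the component is estimated anew, keeping
        \<open>exp (- 2 * tau * t)\<close> under the integral instead of bounding it by a constant;
        this produces \<open>remainder\<close>.\<close>
      have "b 0 \<le> exp (- tau * pi) * b pi + integral {0..pi} ?J" using out[of 0] by simp
      also have "exp (- tau * pi) * b pi \<le> exp (- 2 * tau * pi) * (A + B)"
      proof -
        have "exp (- tau * pi) * b pi = exp (- 2 * tau * pi) * (exp (tau * pi) * b pi)"
          unfolding mult.assoc[symmetric] exp_add[symmetric] by (simp add: algebra_simps)
        also have "\<dots> \<le> exp (- 2 * tau * pi) * (A + B)"
          using x2(2)[of pi] AB0 by (intro mult_left_mono) (auto simp: B_def)
        finally show ?thesis .
      qed
      also have "integral {0..pi} ?J \<le> integral {0..pi} (\<lambda>t. (A + B) / (2 * norm rho) * (q t * exp (- 2 * tau * t)))"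
      proof (rule integral_le)
        show "?J integrable_on {0..pi}"
          using r0 by (intro q_times_integrable continuous_intros vector_solution_continuous[OF y]) auto
        show "(\<lambda>t. (A + B) / (2 * norm rho) * (q t * exp (- 2 * tau * t))) integrable_on {0..pi}"
          by (intro integrable_on_mult_right q_times_integrable continuous_intros) auto
        fix t assume t: "t \<in> {0..pi}"
        have "exp (- tau * t) * norm (y t) = exp (- 2 * tau * t) * (exp (tau * t) * norm (y t))"
          unfolding mult.assoc[symmetric] exp_add[symmetric] by (simp add: algebra_simps)
        also have "\<dots> \<le> exp (- 2 * tau * t) * (A + B)" using yAB[OF t] by (intro mult_left_mono) auto
        finally have "q t / (2 * norm rho) * (exp (- tau * t) * norm (y t)) \<le> q t / (2 * norm rho) * (exp (- 2 * tau * t) * (A + B))"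
          using q_nonneg[of t] by (intro mult_left_mono) auto
        then show "?J t \<le> (A + B) / (2 * norm rho) * (q t * exp (- 2 * tau * t))" by (simp add: mult_ac)
      qed
      also have "\<dots> = (A + B) / (2 * norm rho) * integral {0..pi} (\<lambda>t. q t * exp (- 2 * tau * t))" by simp
      finally have "norm rho * b 0 \<le> norm rho * (exp (- 2 * tau * pi) * (A + B) + (A + B) / (2 * norm rho) * integral {0..pi} (\<lambda>t. q t * exp (- 2 * tau * t)))"
        by (intro mult_left_mono) auto
      also have "\<dots> = (A + B) * (norm rho * exp (- 2 * tau * pi) + 1/2 * integral {0..pi} (\<lambda>t. q t * exp (- 2 * tau * t)))"
        using r0 by (simp add: field_simps)
      also have "\<dots> \<le> (A + B) * remainder rho"
      proof -
        have "integral {0..pi} (\<lambda>t. q t * exp (- 2 * tau * t)) \<ge> 0"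
          using q_nonneg by (intro integral_nonneg q_times_integrable continuous_intros) auto
        then show ?thesis using AB0 unfolding remainder_def tau_def by (intro mult_left_mono) auto
      qed
      also have "\<dots> \<le> K * a 0 * remainder rho"
      proof -
        have "remainder rho \<ge> 0"
          unfolding remainder_def using q_nonneg by (intro add_nonneg_nonneg integral_nonneg q_times_integrable continuous_intros) auto
        then show ?thesis using AB by (intro mult_right_mono)
      qed
      finally show "norm rho * norm (wave_out rho (y 0) (dy 0)) \<le> K * remainder rho * norm (wave_in rho (y 0) (dy 0))"
        by (simp add: a_def b_def mult_ac)
    qed
  qed (use kR in \<open>auto simp: K_def R'_def\<close>)
qed

end

section \<open>The Weyl matrix\<close>

lemma vector_solution_diff:
  assumes y: "vector_solution Q lam y dy" and z: "vector_solution Q lam z dz"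
  shows "vector_solution Q lam (\<lambda>x. y x - z x) (\<lambda>x. dy x - dz x)"
proof (rule vector_solutionI)
  note y = vector_solutionD[OF y] and z = vector_solutionD[OF z]
  have "(Q x *v y x - lam *s y x) - (Q x *v z x - lam *s z x) = Q x *v (y x - z x) - lam *s (y x - z x)" for x
    by (simp add: mv.diff_right sv.diff_right)
  with ac_deriv_diff[OF y(3) z(3)]
  show "ac_deriv 0 pi (\<lambda>x. dy x - dz x) (\<lambda>x. Q x *v (y x - z x) - lam *s (y x - z x))" by simp
  show "ac_deriv 0 pi (\<lambda>x. y x - z x) (\<lambda>x. dy x - dz x)" by (rule ac_deriv_diff[OF y(2) z(2)])
  show "((\<lambda>x. y x - z x) has_vector_derivative dy x - dz x) (at x within {0..pi})" if "x \<in> {0..pi}" for x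
    by (rule has_vector_derivative_diff[OF y(1)[OF that] z(1)[OF that]])
qed

lemma vector_solution_transform:
  assumes y: "vector_solution Q lam y dy" and eq: "\<And>x. x \<in> {0..pi} \<Longrightarrow> y x = z x"
  shows "vector_solution Q lam z dy"
proof (rule vector_solutionI)
  note y = vector_solutionD[OF y]
  show "ac_deriv 0 pi z dy" by (rule ac_deriv_transform[OF y(2) eq])
  show "ac_deriv 0 pi dy (\<lambda>x. Q x *v z x - lam *s z x)"
    by (rule ac_deriv_cong[OF y(3)]) (use eq in auto)
  show "(z has_vector_derivative dy x) (at x within {0..pi})" if "x \<in> {0..pi}" for x
    by (rule has_vector_derivative_transform[OF that _ y(1)[OF that]]) (use eq in auto)
qed

lemma boundary_form_vector_diff:
  "boundary_form_vector T G (u - v) (w - z) = boundary_form_vector T G u w - boundary_form_vector T G (v :: complex^'m) z"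
  by (simp add: boundary_form_vector_def mv.diff_right mv.diff_left algebra_simps)

lemma boundary_form_matrix_mult_vec:
  "boundary_form_matrix T G A B *v v = boundary_form_vector T G (A *v v) (B *v (v :: complex^'m))"
  by (simp add: boundary_form_matrix_def boundary_form_vector_def mv.diff_left mv.diff_right matrix_vector_mul_assoc[symmetric])

section \<open>Eigenspaces and multiplicities\<close>

lemma sum_fun_apply: "(\<Sum>i\<in>A. f i) x = (\<Sum>i\<in>A. (f i x :: 'a::comm_monoid_add))"
  by (induction A rule: infinite_finite_induct) auto

interpretation fun_space: vector_space "\<lambda>(c::complex) (Y :: real \<Rightarrow> complex^'m) x. c *s Y x"
  by unfold_locales (auto simp: fun_eq_iff vec_eq_iff algebra_simps)

context hermitian_potential
begin

text \<open>The dimension of an infinite-dimensional space would be \<open>0\<close> as well, so that finite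
  dimensionality has to be established first.\<close>

lemma eigenspace_trivial:
  assumes "eigenvalue_multiplicity Q T1 T2 G1 G2 lam = 0"
  shows "eigenspace Q T1 T2 G1 G2 lam \<subseteq> {0}"
proof -
  define c where "c i = (\<lambda>x. if x \<in> {0..pi} then column i (C lam x) else 0)" for i
  define s where "s i = (\<lambda>x. if x \<in> {0..pi} then column i (S lam x) else 0)" for i
  let ?B = "range c \<union> range s"
  have sub: "eigenspace Q T1 T2 G1 G2 lam \<subseteq> fun_space.span ?B"
  proof
    fix Y assume "Y \<in> eigenspace Q T1 T2 G1 G2 lam"
    then obtain DY where Y: "\<And>x. x \<notin> {0..pi} \<Longrightarrow> Y x = 0" "vector_solution Q lam Y DY"
      unfolding eigenspace_def by blast
    have "Y = (\<Sum>i\<in>UNIV. (\<lambda>x. (Y 0 $ i) *s c i x)) + (\<Sum>i\<in>UNIV. (\<lambda>x. (DY 0 $ i) *s s i x))"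
    proof
      fix x show "Y x = ((\<Sum>i\<in>UNIV. (\<lambda>x. (Y 0 $ i) *s c i x)) + (\<Sum>i\<in>UNIV. (\<lambda>x. (DY 0 $ i) *s s i x))) x"
      proof (cases "x \<in> {0..pi}")
        case True
        then show ?thesis using vector_solution_unique(1)[OF Y(2) True]
          by (simp add: sum_fun_apply c_def s_def matrix_mult_sum)
      next
        case False
        then show ?thesis using Y(1)[OF False] by (simp add: sum_fun_apply c_def s_def del: atLeastAtMost_iff)
      qed
    qed
    also have "\<dots> \<in> fun_space.span ?B"
      by (intro fun_space.span_add fun_space.span_sum fun_space.span_scale fun_space.span_base) auto
    finally show "Y \<in> fun_space.span ?B" .
  qed
  obtain B where B: "B \<subseteq> eigenspace Q T1 T2 G1 G2 lam" "fun_space.independent B"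
    "eigenspace Q T1 T2 G1 G2 lam \<subseteq> fun_space.span B" "card B = fun_space.dim (eigenspace Q T1 T2 G1 G2 lam)"
    using fun_space.basis_exists[of "eigenspace Q T1 T2 G1 G2 lam"] by blast
  have "finite B"
    using fun_space.independent_span_bound[of ?B B] B(1,2) sub by auto
  moreover have "card B = 0" using B(4) assms by (simp add: eigenvalue_multiplicity_def)
  ultimately have "B = {}" by simp
  then show ?thesis using B(3) by (simp add: zero_fun_def)
qed

text \<open>\<open>y\<close> is first extended by zero, as \<open>eigenspace\<close> demands. That
  \<open>dy 0\<close> vanishes follows from the uniqueness of one-sided derivatives at 0.\<close>

lemma eigenfunction_zero:
  assumes mult: "eigenvalue_multiplicity Q T1 T2 G1 G2 lam = 0" and y: "vector_solution Q lam y dy"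
    and bc: "boundary_form_vector T1 G1 (y 0) (dy 0) = 0" "boundary_form_vector T2 G2 (y pi) (dy pi) = 0"
  shows "x \<in> {0..pi} \<Longrightarrow> y x = 0" "dy 0 = 0"
proof -
  define Y where "Y x = (if x \<in> {0..pi} then y x else 0)" for x
  have "vector_solution Q lam Y dy" by (rule vector_solution_transform[OF y]) (simp add: Y_def)
  then have "Y \<in> eigenspace Q T1 T2 G1 G2 lam"
    unfolding eigenspace_def using bc by (auto simp: Y_def)
  then have "Y = 0" using eigenspace_trivial[OF mult] by blast
  then have y0: "y x = 0" if "x \<in> {0..pi}" for x using that by (metis Y_def zero_fun_apply)
  then show "x \<in> {0..pi} \<Longrightarrow> y x = 0" .
  have "((\<lambda>x. 0) has_vector_derivative dy 0) (at 0 within {0..pi})"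
    by (rule has_vector_derivative_transform[OF _ _ vector_solutionD(1)[OF y]]) (use y0 in auto)
  then show "dy 0 = 0"
    using vector_derivative_unique_within_closed_interval[of 0 pi 0 "\<lambda>x. 0" "dy 0" 0] by (auto simp: cbox_interval)
qed

end

section \<open>The Weyl solution\<close>

context boundary_value
begin

text \<open>Passes from the component \<open>wave_in\<close> at 0 to the value \<open>y 0\<close>.
  In the sector the remainder is bounded, so that for large \<open>rho\<close> the component
  \<open>wave_out\<close> at 0 is at most half of \<open>wave_in\<close>; the last estimate says
  that \<open>y\<close> leaves 0 almost like \<open>exp (\<i> * rho * x)\<close>.\<close>

lemma weyl_bounds:
  obtains K R where "K > 0" "R > 0"
    "\<And>rho y dy. norm rho \<ge> R \<Longrightarrow> Im rho \<ge> norm rho / 2 \<Longrightarrow> vector_solution Q (rho^2) y dy \<Longrightarrow>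
       boundary_form_vector T2 G2 (y pi) (dy pi) = 0 \<Longrightarrow>
       (\<forall>x\<in>{0..pi}. norm (y x) \<le> K * exp (- Im rho * x) * norm (y 0) \<and> norm (dy x) \<le> K * norm rho * exp (- Im rho * x) * norm (y 0)) \<and>
       norm (dy 0 - (\<i> * rho) *s y 0) \<le> K * remainder rho * norm (y 0)"
proof -
  obtain K R where KR: "K > 0" "R > 0"
    "\<And>rho y dy. norm rho \<ge> R \<Longrightarrow> Im rho \<ge> 0 \<Longrightarrow> vector_solution Q (rho^2) y dy \<Longrightarrow>
       boundary_form_vector T2 G2 (y pi) (dy pi) = 0 \<Longrightarrow>
       (\<forall>x\<in>{0..pi}. exp (Im rho * x) * (norm (wave_in rho (y x) (dy x)) + norm (wave_out rho (y x) (dy x))) \<le> K * norm (wave_in rho (y 0) (dy 0))) \<and>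
       norm rho * norm (wave_out rho (y 0) (dy 0)) \<le> K * remainder rho * norm (wave_in rho (y 0) (dy 0))"
    by (rule solution_decay) blast
  show ?thesis
  \<comment> \<open>One factor 2 comes from \<open>norm (a 0) \<le> 2 * norm (y 0)\<close>, the
    other from \<open>dy 0 - (\<i> * rho) *s y 0 = (- 2 * \<i> * rho) *s b 0\<close>. The bound on
    \<open>rho\<close> gives \<open>K * (1 + q0) \<le> norm rho / 2\<close>.\<close>
  proof (rule that[of "4 * K" "max R (2 * K * (1 + q0))"])
    fix rho :: complex and y dy :: "real \<Rightarrow> complex^'m"
    assume rho: "norm rho \<ge> max R (2 * K * (1 + q0))" "Im rho \<ge> norm rho / 2" and y: "vector_solution Q (rho^2) y dy"
      and bc: "boundary_form_vector T2 G2 (y pi) (dy pi) = 0"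
    have Im0: "Im rho \<ge> 0" using rho norm_ge_zero[of rho] by linarith
    have r0: "rho \<noteq> 0" using rho KR by auto
    define a b where "a x = wave_in rho (y x) (dy x)" and "b x = wave_out rho (y x) (dy x)" for x
    have main: "\<And>x. x \<in> {0..pi} \<Longrightarrow> exp (Im rho * x) * (norm (a x) + norm (b x)) \<le> K * norm (a 0)"
      "norm rho * norm (b 0) \<le> K * remainder rho * norm (a 0)"
      using KR(3)[OF _ Im0 y bc] rho by (auto simp: a_def b_def)
    have yab: "y x = a x + b x" "dy x = (\<i> * rho) *s (a x - b x)" for x
      using wave_sum[of rho "y x" "dy x"] wave_diff[OF r0, of "y x" "dy x"] by (simp_all add: a_def b_def)
    have "norm rho * norm (b 0) \<le> K * (1 + q0) * norm (a 0)"
      using main(2) KR(1) remainder_bound[OF rho(2)] by (meson mult_left_mono mult_right_mono norm_ge_zero order_trans less_imp_le)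
    also have "\<dots> \<le> norm rho / 2 * norm (a 0)" using rho by (intro mult_right_mono) auto
    finally have "norm (b 0) \<le> norm (a 0) / 2" using r0 by (simp add: field_simps)
    moreover have "norm (a 0) \<le> norm (y 0) + norm (b 0)" unfolding yab by (metis add_diff_cancel norm_triangle_ineq4)
    ultimately have a0: "norm (a 0) \<le> 2 * norm (y 0)" by linarith
    have sum: "norm (a x) + norm (b x) \<le> 4 * K * exp (- Im rho * x) * norm (y 0)" if "x \<in> {0..pi}" for x
    proof -
      have "exp (Im rho * x) * (norm (a x) + norm (b x)) \<le> K * (2 * norm (y 0))"
        using main(1)[OF that] mult_left_mono[OF a0, of K] KR(1) by linarith
      then have "norm (a x) + norm (b x) \<le> K * (2 * norm (y 0)) * exp (- Im rho * x)"
        by (simp add: exp_minus field_simps)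
      also have "\<dots> \<le> 4 * K * exp (- Im rho * x) * norm (y 0)" using KR(1) by simp
      finally show ?thesis .
    qed
    show "(\<forall>x\<in>{0..pi}. norm (y x) \<le> 4 * K * exp (- Im rho * x) * norm (y 0) \<and> norm (dy x) \<le> 4 * K * norm rho * exp (- Im rho * x) * norm (y 0)) \<and>
       norm (dy 0 - (\<i> * rho) *s y 0) \<le> 4 * K * remainder rho * norm (y 0)"
    proof (intro conjI ballI)
      fix x assume x: "x \<in> {0..pi}"
      show "norm (y x) \<le> 4 * K * exp (- Im rho * x) * norm (y 0)"
        using norm_triangle_ineq[of "a x" "b x"] sum[OF x] unfolding yab(1)[of x] by linarith
      have "norm (dy x) = norm rho * norm (a x - b x)" unfolding yab(2)[of x] norm_vector_smult by (simp add: norm_mult)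
      also have "\<dots> \<le> norm rho * (4 * K * exp (- Im rho * x) * norm (y 0))"
        using norm_triangle_ineq4[of "a x" "b x"] sum[OF x] by (intro mult_left_mono) auto
      finally show "norm (dy x) \<le> 4 * K * norm rho * exp (- Im rho * x) * norm (y 0)" by (simp add: mult_ac)
    next
      have "dy 0 - (\<i> * rho) *s y 0 = (- 2 * \<i> * rho) *s b 0"
        unfolding yab by (simp add: vec_eq_iff algebra_simps)
      then have "norm (dy 0 - (\<i> * rho) *s y 0) = 2 * (norm rho * norm (b 0))" by (simp add: norm_vector_smult norm_mult)
      also have "\<dots> \<le> 2 * (K * remainder rho * norm (a 0))" using main(2) by simp
      also have "\<dots> \<le> 2 * (K * remainder rho * (2 * norm (y 0)))"
        using a0 KR(1) remainder_bound(2)[OF rho(2)] by (intro mult_left_mono) auto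
      finally show "norm (dy 0 - (\<i> * rho) *s y 0) \<le> 4 * K * remainder rho * norm (y 0)" by simp
    qed
  qed (use KR in auto)
qed

text \<open>The initial values make the boundary form at 0 equal to 0 for \<open>phi\<close> and 1
  for \<open>psi\<close>, and the complementary form \<open>(mat 1 - T1) ** DY 0 + T1 ** Y 0\<close>
  equal to 1 and 0, respectively.\<close>

definition phi where "phi = sol T1 (mat 1 - T1 + G1)"
definition dphi where "dphi = dsol T1 (mat 1 - T1 + G1)"
definition psi where "psi = sol (T1 - mat 1) T1"
definition dpsi where "dpsi = dsol (T1 - mat 1) T1"

lemma phi: "matrix_solution Q lam (phi lam) (dphi lam)" "phi lam 0 = T1" "dphi lam 0 = mat 1 - T1 + G1"
  and psi: "matrix_solution Q lam (psi lam) (dpsi lam)" "psi lam 0 = T1 - mat 1" "dpsi lam 0 = T1"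
  by (simp_all add: phi_def dphi_def psi_def dpsi_def sol)

definition VPhi where "VPhi lam = boundary_form_matrix T2 G2 (phi lam pi) (dphi lam pi)"
definition VPsi where "VPsi lam = boundary_form_matrix T2 G2 (psi lam pi) (dpsi lam pi)"
text \<open>Chosen so that \<open>psi + phi ** M\<close> satisfies the condition at \<pi>;
  meaningful only where \<open>VPhi lam\<close> is invertible.\<close>

definition M where "M lam = - (matrix_inv (VPhi lam) ** VPsi lam)"
definition Phi where "Phi lam x = psi lam x + phi lam x ** M lam"
definition DPhi where "DPhi lam x = dpsi lam x + dphi lam x ** M lam"

abbreviation regular where "regular lam \<equiv> det (VPhi lam) \<noteq> 0"

lemma T1_assoc: "T1 ** (T1 ** A) = T1 ** A" "G1 ** (T1 ** A) = G1 ** A" "T1 ** (G1 ** A) = G1 ** A"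
  by (simp_all add: matrix_mul_assoc T1 G1)

lemmas T1_simps = T1 G1 T1_assoc mm.add_left mm.add_right mm.diff_left mm.diff_right mm.minus_left mm.minus_right
  mm.zero_left mm.zero_right matrix_mul_assoc[symmetric]

lemma phi_V1: "boundary_form_matrix T1 G1 (phi lam 0) (dphi lam 0) = 0"
  by (simp add: boundary_form_matrix_def phi T1_simps)

text \<open>If \<open>VPhi lam\<close> kills \<open>v\<close>, then \<open>phi lam x *v v\<close>
  satisfies both boundary conditions; and \<open>v\<close> can be read off from the initial values
  \<open>T1 *v v\<close> and \<open>(mat 1 - T1 + G1) *v v\<close>.\<close>

lemma multiplicity_zero_imp_regular:
  assumes "eigenvalue_multiplicity Q T1 T2 G1 G2 lam = 0"
  shows "regular lam"
proof -
  have "v = 0" if v: "VPhi lam *v v = 0" for v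
  proof -
    have y: "vector_solution Q lam (\<lambda>x. phi lam x *v v) (\<lambda>x. dphi lam x *v v)"
      by (rule matrix_solution_mult_vec[OF phi(1)])
    have "boundary_form_vector T1 G1 (phi lam 0 *v v) (dphi lam 0 *v v) = 0"
      using phi_V1[of lam] by (simp add: boundary_form_matrix_mult_vec[symmetric] mv.zero_left)
    moreover have "boundary_form_vector T2 G2 (phi lam pi *v v) (dphi lam pi *v v) = 0"
      using v by (simp add: boundary_form_matrix_mult_vec[symmetric] VPhi_def)
    ultimately have "phi lam 0 *v v = 0" "dphi lam 0 *v v = 0"
      using eigenfunction_zero(1)[OF assms y, of 0] eigenfunction_zero(2)[OF assms y] by auto
    then have "T1 *v v = 0" "(mat 1 - T1 + G1) *v v = 0" by (simp_all add: phi)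
    moreover have "G1 *v v = G1 *v (T1 *v v)" by (simp add: matrix_vector_mul_assoc G1)
    ultimately show "v = 0" by (simp add: mv.add_left mv.diff_left mv.zero_right)
  qed
  then show ?thesis
    by (metis invertible_det_nz invertible_left_inverse matrix_left_invertible_ker)
qed

lemma regular_solution_zero:
  assumes reg: "regular lam" and y: "vector_solution Q lam y dy"
    and bc: "boundary_form_vector T1 G1 (y 0) (dy 0) = 0" "boundary_form_vector T2 G2 (y pi) (dy pi) = 0"
  shows "y 0 = 0" "dy 0 = 0"
proof -
  have bc1: "T1 *v y 0 = y 0" "T1 *v dy 0 = G1 *v y 0"
    using bc(1) boundary_form_vector_split T1(2) G1(2) by blast+
  \<comment> \<open>The complementary form of \<open>y\<close> at 0; by the boundary condition
    there, \<open>y\<close> is \<open>phi lam\<close> applied to this vector.\<close>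
  define v where "v = T1 *v y 0 + (dy 0 - T1 *v dy 0)"
  have g: "G1 *v (T1 *v w) = G1 *v w" "T1 *v (T1 *v w) = T1 *v w" "T1 *v (G1 *v w) = G1 *v w" for w by (simp_all add: matrix_vector_mul_assoc G1 T1)
  have v1: "T1 *v v = y 0" using bc1 by (simp add: v_def mv.add_right mv.diff_right g)
  have "G1 *v v = G1 *v (T1 *v v)" by (simp add: g)
  then have v2: "(mat 1 - T1 + G1) *v v = dy 0"
    using v1 bc1 by (simp add: mv.add_left mv.diff_left) (simp add: v_def)
  have z: "vector_solution Q lam (\<lambda>x. phi lam x *v v) (\<lambda>x. dphi lam x *v v)"
    by (rule matrix_solution_mult_vec[OF phi(1)])
  have "y pi = phi lam pi *v v" "dy pi = dphi lam pi *v v"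
    using vector_solution_unique[OF y, of pi] vector_solution_unique[OF z, of pi] v1 v2 by (simp_all add: phi)
  then have "VPhi lam *v v = 0" using bc(2) by (simp add: VPhi_def boundary_form_matrix_mult_vec)
  then have "v = 0"
    using reg by (metis invertible_det_nz invertible_left_inverse matrix_left_invertible_ker)
  then show "y 0 = 0" "dy 0 = 0" using v1 v2 by (simp_all add: mv.zero_right)
qed

lemma mult_matrix_inv: "invertible A \<Longrightarrow> A ** matrix_inv A = mat 1"
  unfolding invertible_def matrix_inv_def by (rule someI2_ex) auto

lemma VPhi_M: "regular lam \<Longrightarrow> VPsi lam + VPhi lam ** M lam = 0"
  using mult_matrix_inv[of "VPhi lam"] invertible_det_nz[of "VPhi lam"]
  by (simp add: M_def mm.minus_right matrix_mul_assoc)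

lemma Phi: "matrix_solution Q lam (Phi lam) (DPhi lam)"
  unfolding Phi_def[abs_def] DPhi_def[abs_def] 
  by (intro matrix_solution_add psi(1) matrix_solution_mult_right phi(1))

lemma Phi_0: "Phi lam 0 = T1 - mat 1 + T1 ** M lam" "DPhi lam 0 = T1 + (mat 1 - T1 + G1) ** M lam"
  by (simp_all add: Phi_def DPhi_def phi psi)

lemma Phi_V1: "boundary_form_matrix T1 G1 (Phi lam 0) (DPhi lam 0) = mat 1"
  by (simp add: boundary_form_matrix_def Phi_0 T1_simps)

lemma Phi_V1_perp: "(mat 1 - T1) ** DPhi lam 0 + T1 ** Phi lam 0 = M lam"
  by (simp add: Phi_0 T1_simps)

lemma boundary_form_matrix_linear:
  "boundary_form_matrix T G (A + B ** N) (A' + B' ** N) = boundary_form_matrix T G A A' + boundary_form_matrix T G B B' ** (N :: complex^'m^'m)"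
  by (simp add: boundary_form_matrix_def mm.add_left mm.add_right mm.diff_left mm.diff_right matrix_mul_assoc algebra_simps)

lemma Phi_V2: "regular lam \<Longrightarrow> boundary_form_matrix T2 G2 (Phi lam pi) (DPhi lam pi) = 0"
  unfolding Phi_def DPhi_def boundary_form_matrix_linear using VPhi_M[of lam] by (simp add: VPhi_def VPsi_def)

text \<open>The definite description is meaningful because the difference of two Weyl solutions
  satisfies both boundary conditions, hence has zero initial values where \<open>VPhi lam\<close> is
  invertible.\<close>

lemma weyl_matrix_eq:
  assumes "regular lam"
  shows "weyl_matrix Q T1 T2 G1 G2 lam = M lam"
  unfolding weyl_matrix_def
proof (rule the_equality)
  show "\<exists>F DF. weyl_solution Q T1 T2 G1 G2 lam F DF \<and> M lam = (mat 1 - T1) ** DF 0 + T1 ** F 0"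
    unfolding weyl_solution_def using Phi[of lam] Phi_V1[of lam] Phi_V2[OF assms] Phi_V1_perp[of lam]
    by (intro exI[of _ "Phi lam"] exI[of _ "DPhi lam"]) simp
  fix N assume "\<exists>F DF. weyl_solution Q T1 T2 G1 G2 lam F DF \<and> N = (mat 1 - T1) ** DF 0 + T1 ** F 0"
  then obtain F DF where F: "matrix_solution Q lam F DF" "boundary_form_matrix T1 G1 (F 0) (DF 0) = mat 1"
    "boundary_form_matrix T2 G2 (F pi) (DF pi) = 0" "N = (mat 1 - T1) ** DF 0 + T1 ** F 0"
    unfolding weyl_solution_def by blast
  have eq: "F 0 *v v = Phi lam 0 *v v" "DF 0 *v v = DPhi lam 0 *v v" for v
  proof -
    have y: "vector_solution Q lam (\<lambda>x. F x *v v - Phi lam x *v v) (\<lambda>x. DF x *v v - DPhi lam x *v v)"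
      by (intro vector_solution_diff matrix_solution_mult_vec F Phi)
    have "boundary_form_vector T1 G1 (F 0 *v v - Phi lam 0 *v v) (DF 0 *v v - DPhi lam 0 *v v) = 0"
      by (simp add: boundary_form_vector_diff boundary_form_matrix_mult_vec[symmetric] F Phi_V1)
    moreover have "boundary_form_vector T2 G2 (F pi *v v - Phi lam pi *v v) (DF pi *v v - DPhi lam pi *v v) = 0"
      by (simp add: boundary_form_vector_diff boundary_form_matrix_mult_vec[symmetric] F Phi_V2[OF assms] mv.zero_left)
    ultimately have "F 0 *v v - Phi lam 0 *v v = 0" "DF 0 *v v - DPhi lam 0 *v v = 0"
      using regular_solution_zero[OF assms y] by auto
    then show "F 0 *v v = Phi lam 0 *v v" "DF 0 *v v = DPhi lam 0 *v v" by simp_all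
  qed
  then have "F 0 = Phi lam 0" "DF 0 = DPhi lam 0" by (simp_all add: matrix_eq)
  then show "N = M lam" using F(4) Phi_V1_perp by simp
qed

end

section \<open>The Herglotz property\<close>

text \<open>The Hermitian inner product, antilinear in the first argument.\<close>

definition hip :: "complex^'m \<Rightarrow> complex^'m \<Rightarrow> complex"
  where "hip u w = (\<Sum>i\<in>UNIV. cnj (u $ i) * w $ i)"

lemma bounded_bilinear_hip: "bounded_bilinear (hip :: complex^'m \<Rightarrow> complex^'m \<Rightarrow> complex)"
  unfolding bilinear_conv_bounded_bilinear[symmetric] bilinear_def hip_def
  by (auto intro!: linearI simp: distrib_left distrib_right sum.distrib scaleR_sum_right)

interpretation hip: bounded_bilinear "hip :: complex^'m \<Rightarrow> complex^'m \<Rightarrow> complex"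
  by (rule bounded_bilinear_hip)

lemma hip_cnj: "cnj (hip u w) = hip w u"
  by (simp add: hip_def cnj_sum mult.commute)

lemma hip_adjoint: "hip (A *v u) w = hip u (A\<^sup>\<dagger> *v w)"
proof -
  have "hip (A *v u) w = (\<Sum>i\<in>UNIV. \<Sum>j\<in>UNIV. cnj (A $ i $ j) * cnj (u $ j) * w $ i)"
    by (simp add: hip_def matrix_vector_mult_def cnj_sum sum_distrib_right)
  also have "\<dots> = (\<Sum>j\<in>UNIV. \<Sum>i\<in>UNIV. cnj (A $ i $ j) * cnj (u $ j) * w $ i)" by (rule sum.swap)
  also have "\<dots> = hip u (A\<^sup>\<dagger> *v w)"
    by (simp add: hip_def matrix_vector_mult_def conj_transpose_def sum_distrib_left mult_ac)
  finally show ?thesis .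
qed

lemma hip_selfadjoint_real: "A\<^sup>\<dagger> = A \<Longrightarrow> Im (hip u (A *v u)) = 0"
  by (metis hip_adjoint hip_cnj cnj.simps(2) neg_equal_zero)

lemma hip_self: "Im (hip u u) = 0" "Re (hip u u) \<ge> 0"
  by (simp_all add: hip_def Im_sum Re_sum sum_nonneg mult.commute)

lemma hip_smult_right: "hip u (c *s w) = c * hip u w"
  by (simp add: hip_def sum_distrib_left mult_ac)

lemma hip_axis: "hip (axis i 1) w = w $ i"
  by (simp add: hip_def axis_def if_distrib[of cnj] if_distrib[of "\<lambda>x. x * _"] cong: if_cong)

lemma mult_vec_axis: "(A *v axis j 1) $ i = (A :: complex^'m^'n) $ i $ j"
  by (simp add: matrix_vector_mult_def axis_def if_distrib[of "\<lambda>x. _ * x"] cong: if_cong)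

text \<open>Schwarz--Pick for the upper half plane, obtained from the Schwarz lemma by Cayley transforms;
  \<open>f + i\<close> has values in the open upper half plane.\<close>

lemma herglotz_growth:
  assumes hol: "f holomorphic_on {z. Im z > 0}" and pos: "\<And>z. Im z > 0 \<Longrightarrow> Im (f z) \<ge> 0"
  obtains K where "K > 0" "\<And>z. Im z > 0 \<Longrightarrow> norm (f z) \<le> K * (1 + norm z)^2 / Im z"
proof -
  define g where "g z = f z + \<i>" for z
  have gpos: "Im (g z) \<ge> 1" if "Im z > 0" for z using pos[OF that] by (simp add: g_def)
  define w0 where "w0 = g \<i>"
  have w0: "Im w0 \<ge> 1" unfolding w0_def by (rule gpos) simp
  define F where "F z = (g z - w0) / (g z - cnj w0)" for z
  have den: "g z - cnj w0 \<noteq> 0" if "Im z > 0" for z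
    using gpos[OF that] w0 by (auto simp: complex_eq_iff)
  have F1: "norm (F z) < 1" if "Im z > 0" for z
  proof -
    have "(norm (g z - w0))\<^sup>2 < (norm (g z - cnj w0))\<^sup>2"
      unfolding cmod_power2 using mult_pos_pos[of "Im (g z)" "Im w0"] gpos[OF that] w0
      by (simp add: power2_eq_square algebra_simps)
    then have "norm (g z - w0) < norm (g z - cnj w0)" by (rule power2_less_imp_less) simp
    then show ?thesis using den[OF that] by (simp add: F_def norm_divide)
  qed
  \<comment> \<open>The inverse Cayley transform from the disc to the half plane; it sends 0 to
    \<i>, the point where \<open>F\<close> vanishes.\<close>
  define c where "c \<xi> = \<i> * (1 + \<xi>) / (1 - \<xi>)" for \<xi> :: complex
  have c1: "1 - \<xi> \<noteq> 0" if "norm \<xi> < 1" for \<xi> :: complex using that by auto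
  have cpos: "Im (c \<xi>) > 0" if "norm \<xi> < 1" for \<xi>
  proof -
    have "(norm \<xi>)\<^sup>2 < 1" using that by (simp add: power_less_one_iff abs_square_less_1)
    then have n: "(Re \<xi>)\<^sup>2 + (Im \<xi>)\<^sup>2 < 1" by (simp add: cmod_power2)
    have "(1 - Re \<xi>)\<^sup>2 + (Im \<xi>)\<^sup>2 > 0"
      using c1[OF that] by (simp add: complex_eq_iff sum_power2_gt_zero_iff)
    moreover have "Im (c \<xi>) = (1 - ((Re \<xi>)\<^sup>2 + (Im \<xi>)\<^sup>2)) / ((1 - Re \<xi>)\<^sup>2 + (Im \<xi>)\<^sup>2)"
      by (simp add: c_def Im_divide power2_eq_square algebra_simps)
    ultimately show ?thesis using n by simp
  qed
  have main: "norm (F z) \<le> norm ((z - \<i>) / (z + \<i>))" if z: "Im z > 0" for z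
  proof -
    let ?x = "(z - \<i>) / (z + \<i>)"
    have zi: "z + \<i> \<noteq> 0" using z by (auto simp: complex_eq_iff)
    have "(norm (z - \<i>))\<^sup>2 < (norm (z + \<i>))\<^sup>2"
      unfolding cmod_power2 using z by (simp add: power2_eq_square algebra_simps)
    then have "norm (z - \<i>) < norm (z + \<i>)" by (rule power2_less_imp_less) simp
    then have x1: "norm ?x < 1" using zi by (simp add: norm_divide)
    have eqs: "1 - ?x = 2 * \<i> / (z + \<i>)" "1 + ?x = 2 * z / (z + \<i>)" using zi by (simp_all add: field_simps)
    have cx: "c ?x = z" unfolding c_def eqs using zi by simp
    have "norm ((\<lambda>\<xi>. F (c \<xi>)) ?x) \<le> norm ?x"
    proof (rule Schwarz_Lemma(1)[of "\<lambda>\<xi>. F (c \<xi>)"])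
      have ch: "c holomorphic_on ball 0 1" unfolding c_def using c1 by (intro holomorphic_intros) auto
      have "F holomorphic_on {z. Im z > 0}"
        unfolding F_def g_def using den by (intro holomorphic_intros hol) (auto simp: g_def)
      then show "(\<lambda>\<xi>. F (c \<xi>)) holomorphic_on ball 0 1"
        using holomorphic_on_compose_gen[OF ch, of F "{z. Im z > 0}"] cpos by (simp add: o_def image_subset_iff)
      show "F (c 0) = 0" by (simp add: F_def c_def w0_def)
      show "norm (F (c \<xi>)) < 1" if "norm \<xi> < 1" for \<xi> using F1[OF cpos[OF that]] .
      show "norm ?x < 1" by (rule x1)
    qed
    then show ?thesis unfolding cx .
  qed
  show ?thesis
  proof (rule that[of "norm w0 + 1"])
    show "norm w0 + 1 > 0" by (simp add: add_nonneg_pos)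
    fix z assume z: "Im z > 0"
    have zi: "z + \<i> \<noteq> 0" using z by (auto simp: complex_eq_iff)
    let ?t = "norm (F z)"
    have t1: "?t < 1" by (rule F1[OF z])
    have "?t\<^sup>2 \<le> (norm ((z - \<i>) / (z + \<i>)))\<^sup>2" using main[OF z] by (intro power_mono) auto
    also have "\<dots> = 1 - 4 * Im z / (norm (z + \<i>))\<^sup>2"
    proof -
      have "(norm (z - \<i>))\<^sup>2 = (norm (z + \<i>))\<^sup>2 - 4 * Im z"
        unfolding cmod_power2 by (simp add: power2_eq_square algebra_simps)
      then have "(norm ((z - \<i>) / (z + \<i>)))\<^sup>2 = ((norm (z + \<i>))\<^sup>2 - 4 * Im z) / (norm (z + \<i>))\<^sup>2"
        by (simp only: norm_divide power_divide)
      also have "\<dots> = 1 - 4 * Im z / (norm (z + \<i>))\<^sup>2" using zi by (simp add: diff_divide_distrib)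
      finally show ?thesis .
    qed
    finally have "4 * Im z / (norm (z + \<i>))\<^sup>2 \<le> 1 - ?t\<^sup>2" by simp
    also have "\<dots> = (1 + ?t) * (1 - ?t)" by (simp add: power2_eq_square algebra_simps)
    also have "\<dots> \<le> 2 * (1 - ?t)" using t1 by (intro mult_right_mono) auto
    finally have "2 * Im z / (norm (z + \<i>))\<^sup>2 \<le> 1 - ?t" by simp
    then have low: "2 * Im z \<le> (1 - ?t) * (norm (z + \<i>))\<^sup>2" using zi by (simp add: field_simps)
    \<comment> \<open>Solving the Cayley transform for \<open>g\<close> bounds
      \<open>norm (g z)\<close> by \<open>2 * norm w0 / (1 - norm (F z))\<close>; the Schwarz lemma
      has just bounded the denominator from below.\<close>
    have "F z * (g z - cnj w0) = g z - w0" using den[OF z] by (simp add: F_def)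
    then have "g z = w0 - F z * cnj w0 + F z * g z" by (simp add: algebra_simps)
    then have "norm (g z) \<le> norm (w0 - F z * cnj w0) + ?t * norm (g z)"
      by (metis norm_mult norm_triangle_ineq)
    moreover have "norm (w0 - F z * cnj w0) \<le> norm w0 + ?t * norm w0"
      by (metis complex_mod_cnj norm_mult norm_triangle_ineq4)
    moreover have "?t * norm w0 \<le> norm w0" using t1 mult_left_le_one_le[of "norm w0" ?t] by simp
    ultimately have "(1 - ?t) * norm (g z) \<le> 2 * norm w0" by (simp add: algebra_simps)
    then have "(1 - ?t) * norm (g z) * (norm (z + \<i>))\<^sup>2 \<le> 2 * norm w0 * (norm (z + \<i>))\<^sup>2" by (intro mult_right_mono) auto
    moreover have "2 * Im z * norm (g z) \<le> (1 - ?t) * (norm (z + \<i>))\<^sup>2 * norm (g z)" using low by (intro mult_right_mono) auto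
    ultimately have "2 * Im z * norm (g z) \<le> 2 * norm w0 * (norm (z + \<i>))\<^sup>2" by (simp add: mult_ac)
    then have gb: "norm (g z) * Im z \<le> norm w0 * (norm (z + \<i>))\<^sup>2" by (simp add: mult_ac)
    have zb: "(norm (z + \<i>))\<^sup>2 \<le> (1 + norm z)\<^sup>2"
      using norm_triangle_ineq[of z \<i>] by (intro power_mono) auto
    have "Im z \<le> (1 + norm z)\<^sup>2"
    proof -
      have "Im z \<le> norm z" by (meson abs_Im_le_cmod abs_le_D1)
      also have "\<dots> \<le> (1 + norm z)\<^sup>2" by (simp add: power2_eq_square algebra_simps)
      finally show ?thesis .
    qed
    have "norm (f z) \<le> norm (g z) + 1" using norm_triangle_ineq4[of "g z" \<i>] by (simp add: g_def)
    then have "norm (f z) * Im z \<le> norm (g z) * Im z + Im z" using z mult_right_mono[of "norm (f z)" "norm (g z) + 1" "Im z"] by (simp add: algebra_simps)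
    also have "\<dots> \<le> norm w0 * (1 + norm z)\<^sup>2 + (1 + norm z)\<^sup>2"
      using gb mult_left_mono[OF zb, of "norm w0"] \<open>Im z \<le> (1 + norm z)\<^sup>2\<close> by simp
    finally show "norm (f z) \<le> (norm w0 + 1) * (1 + norm z)^2 / Im z"
      using z by (simp add: field_simps)
  qed
qed

context boundary_value
begin

lemma Phi_pi:
  assumes "regular z"
  shows "T2 ** Phi z pi = Phi z pi" "T2 ** DPhi z pi = G2 ** Phi z pi"
proof -
  have "boundary_form_vector T2 G2 (Phi z pi *v v) (DPhi z pi *v v) = 0" for v
    using Phi_V2[OF assms] by (simp add: boundary_form_matrix_mult_vec[symmetric] mv.zero_left)
  then show "T2 ** Phi z pi = Phi z pi" "T2 ** DPhi z pi = G2 ** Phi z pi"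
    unfolding boundary_form_vector_split[OF T2(2) G2(2)] by (simp_all add: matrix_eq matrix_vector_mul_assoc[symmetric])
qed

text \<open>Exhibits the whole range of \<open>T2\<close>, so that \<open>T2\<close> can be read off
  from \<open>Phi z pi\<close>. The auxiliary \<open>A\<close> contains the boundary values left
  free at \<pi>; if it kills \<open>v\<close>, the Wronskian with \<open>phi\<close> vanishes at
  \<pi>, while at 0 it equals \<open>v\<close>.\<close>

lemma Phi_pi_range:
  assumes reg: "regular z"
  obtains B where "Phi z pi ** B = T2"
proof -
  define A where "A = T2 ** Phi z pi + (mat 1 - T2) ** DPhi z pi"
  have T2A: "T2 ** A = Phi z pi"
    by (simp add: A_def mm.add_right mm.diff_left mm.diff_right matrix_mul_assoc T2 G2 Phi_pi[OF reg])
  have "v = 0" if v: "A *v v = 0" for v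
  proof -
    have y: "Phi z pi *v v = 0"
      unfolding T2A[symmetric] matrix_vector_mul_assoc[symmetric] v by (rule mv.zero_right)
    have "T2 *v (DPhi z pi *v v) = G2 *v (Phi z pi *v v)"
      by (simp add: matrix_vector_mul_assoc Phi_pi[OF reg])
    then have "T2 *v (DPhi z pi *v v) = 0" using y by (simp add: mv.zero_right)
    moreover have "A *v v = T2 *v (Phi z pi *v v) + (DPhi z pi *v v - T2 *v (DPhi z pi *v v))"
      by (simp add: A_def mv.add_left mv.diff_left mm.diff_left matrix_vector_mul_assoc)
    ultimately have dy: "DPhi z pi *v v = 0" using v y by (simp add: mv.zero_right)
    have "(phi (cnj z) pi)\<^sup>\<dagger> *v (DPhi z pi *v v) - (dphi (cnj z) pi)\<^sup>\<dagger> *v (Phi z pi *v v)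
       = (phi (cnj z) 0)\<^sup>\<dagger> *v (DPhi z 0 *v v) - (dphi (cnj z) 0)\<^sup>\<dagger> *v (Phi z 0 *v v)"
      by (rule wronskian_vector[OF phi(1) matrix_solution_mult_vec[OF Phi]]) simp
    then have "0 = (T1\<^sup>\<dagger> ** DPhi z 0 - (mat 1 - T1 + G1)\<^sup>\<dagger> ** Phi z 0) *v v"
      unfolding y dy by (simp add: phi mv.zero_right mv.diff_left matrix_vector_mul_assoc)
    also have "T1\<^sup>\<dagger> ** DPhi z 0 - (mat 1 - T1 + G1)\<^sup>\<dagger> ** Phi z 0 = mat 1"
      by (simp add: Phi_0 conj_transpose_add conj_transpose_diff T1_simps algebra_simps)
    finally show "v = 0" by simp
  qed
  then obtain C where "C ** A = mat 1" by (metis matrix_left_invertible_ker)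
  then have "A ** C = mat 1" by (simp add: matrix_left_right_inverse)
  then have "Phi z pi ** C = T2" unfolding T2A[symmetric] by (simp add: matrix_mul_assoc[symmetric])
  then show ?thesis by (rule that)
qed

text \<open>The Wronskian of \<open>Phi (cnj z)\<close> and \<open>Phi z\<close> vanishes at \<pi>,
  where both satisfy the same self-adjoint condition; at 0 it is the difference of the two
  sides.\<close>

lemma M_adjoint:
  assumes "regular z" "regular (cnj z)"
  shows "(M (cnj z))\<^sup>\<dagger> = M z"
proof -
  note s1 = Phi_pi[OF assms(1)] and s2 = Phi_pi[OF assms(2)]
  let ?P = "Phi z pi" and ?P' = "DPhi z pi" and ?R = "Phi (cnj z) pi" and ?R' = "DPhi (cnj z) pi"
  have "?R\<^sup>\<dagger> ** ?P' = ?R\<^sup>\<dagger> ** (T2 ** ?P')"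
    using arg_cong[OF s2(1), of conj_transpose] by (metis conj_transpose_mult T2(1) matrix_mul_assoc)
  also have "\<dots> = ?R\<^sup>\<dagger> ** (G2 ** ?P)" using s1 by simp
  also have "\<dots> = (G2 ** ?R)\<^sup>\<dagger> ** ?P" by (simp add: conj_transpose_mult G2 matrix_mul_assoc)
  also have "\<dots> = (T2 ** ?R')\<^sup>\<dagger> ** ?P" using s2 by simp
  also have "\<dots> = ?R'\<^sup>\<dagger> ** (T2 ** ?P)" by (simp add: conj_transpose_mult T2 matrix_mul_assoc)
  also have "\<dots> = ?R'\<^sup>\<dagger> ** ?P" using s1 by simp
  finally have "?R\<^sup>\<dagger> ** ?P' - ?R'\<^sup>\<dagger> ** ?P = 0" by simp
  then have 0: "(Phi (cnj z) 0)\<^sup>\<dagger> ** DPhi z 0 - (DPhi (cnj z) 0)\<^sup>\<dagger> ** Phi z 0 = 0"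
    using wronskian_matrix[OF Phi Phi, of pi z] by simp
  have "(Phi (cnj z) 0)\<^sup>\<dagger> ** DPhi z 0 - (DPhi (cnj z) 0)\<^sup>\<dagger> ** Phi z 0 = (M (cnj z))\<^sup>\<dagger> - M z"
    by (simp add: Phi_0 conj_transpose_add conj_transpose_diff conj_transpose_mult T1_simps algebra_simps)
  with 0 show ?thesis by simp
qed

text \<open>The imaginary part of \<open>hip (y x) (dy x)\<close> has derivative
  \<open>- Im z * Re (hip (y x) (y x))\<close>, vanishes at \<pi> because \<open>G2\<close> is
  Hermitian, and equals minus the quantity in question at 0.\<close>

lemma M_herglotz:
  assumes reg: "regular z" and z: "Im z > 0"
  shows "Im (hip v (M z *v v)) \<le> 0"
proof -
  define y dy where "y x = Phi z x *v v" and "dy x = DPhi z x *v v" for x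
  have sol: "vector_solution Q z y dy" unfolding y_def[abs_def] dy_def[abs_def] by (rule matrix_solution_mult_vec[OF Phi])
  note s = vector_solutionD[OF sol]
  obtain N where N: "negligible N" "\<And>x. x \<in> {0<..<pi} - N \<Longrightarrow> Q x = (Q x)\<^sup>\<dagger>" using hermitianE by blast
  have "ac_deriv 0 pi (\<lambda>x. Im (hip (y x) (dy x))) (\<lambda>x. Im (hip (y x) (Q x *v y x - z *s y x) + hip (dy x) (dy x)))"
    by (rule ac_deriv_linear[OF bounded_linear_Im ac_deriv_bilinear[OF bounded_bilinear_hip s(2) s(3)]])
  then have ac: "ac_deriv 0 pi (\<lambda>x. Im (hip (y x) (dy x))) (\<lambda>x. - Im z * Re (hip (y x) (y x)))"
  proof (rule ac_deriv_spike[OF _ N(1)])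
    fix x assume "x \<in> {0<..<pi} - N"
    then have "Im (hip (y x) (Q x *v y x)) = 0" using N(2)[of x] by (intro hip_selfadjoint_real) simp
    then show "Im (hip (y x) (Q x *v y x - z *s y x) + hip (dy x) (dy x)) = - Im z * Re (hip (y x) (y x))"
      using hip_self(1)[of "y x"] hip_self(1)[of "dy x"] by (simp add: hip.diff_right hip_smult_right)
  qed
  have mono: "Im (hip (y pi) (dy pi)) \<le> Im (hip (y 0) (dy 0))"
    by (rule ac_deriv_nonpos[OF ac]) (use z hip_self(2) in \<open>auto intro: mult_nonneg_nonneg less_imp_le\<close>)
  have "boundary_form_vector T2 G2 (y pi) (dy pi) = 0"
    using Phi_V2[OF reg] by (simp add: y_def dy_def boundary_form_matrix_mult_vec[symmetric] mv.zero_left)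
  then have bc: "T2 *v y pi = y pi" "T2 *v dy pi = G2 *v y pi" using boundary_form_vector_split T2(2) G2(2) by blast+
  have "hip (y pi) (dy pi) = hip (T2 *v y pi) (dy pi)" using bc by simp
  also have "\<dots> = hip (y pi) (T2 *v dy pi)" by (simp only: hip_adjoint T2)
  also have "\<dots> = hip (y pi) (G2 *v y pi)" by (simp only: bc)
  finally have "Im (hip (y pi) (dy pi)) = 0" using hip_selfadjoint_real[OF G2(1)] by simp
  then have pos: "0 \<le> Im (hip (y 0) (dy 0))" using mono by simp
  have "(T1 - mat 1 + T1 ** M z)\<^sup>\<dagger> ** (T1 + (mat 1 - T1 + G1) ** M z)
      = - ((mat 1 - T1) ** M z) + (M z)\<^sup>\<dagger> ** T1 + (M z)\<^sup>\<dagger> ** (G1 ** M z)"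
    by (simp add: conj_transpose_add conj_transpose_diff conj_transpose_mult T1_simps algebra_simps)
  then have "hip (y 0) (dy 0) = hip v ((- ((mat 1 - T1) ** M z) + (M z)\<^sup>\<dagger> ** T1 + (M z)\<^sup>\<dagger> ** (G1 ** M z)) *v v)"
    by (simp add: y_def dy_def Phi_0 hip_adjoint matrix_vector_mul_assoc)
  also have "\<dots> = - hip v (M z *v v) + hip v (T1 *v (M z *v v)) + hip (M z *v v) (T1 *v v) + hip (M z *v v) (G1 *v (M z *v v))"
    by (simp add: mv.add_left mv.minus_left mv.diff_left mm.diff_left hip.add_right hip.minus_right hip.diff_right 
        hip_adjoint[of "M z"] matrix_vector_mul_assoc)
  \<comment> \<open>The two terms with \<open>T1\<close> are complex conjugate, so their imaginary
    parts cancel.\<close>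
  also have "hip (M z *v v) (T1 *v v) = cnj (hip v (T1 *v (M z *v v)))"
    by (metis hip_adjoint hip_cnj T1(1))
  finally have "Im (hip (y 0) (dy 0)) = - Im (hip v (M z *v v))"
    using hip_selfadjoint_real[OF G1(1)] by simp
  then show ?thesis using pos by simp
qed

section \<open>The entries of the Weyl matrix: meromorphy and growth\<close>

definition hol_mat :: "(complex \<Rightarrow> complex^'m^'m) \<Rightarrow> complex set \<Rightarrow> bool"
  where "hol_mat F A \<longleftrightarrow> (\<forall>i j. (\<lambda>z. F z $ i $ j) holomorphic_on A)"

lemma hol_mat_intros:
  "hol_mat (\<lambda>z. B) A"
  "hol_mat F A \<Longrightarrow> hol_mat H A \<Longrightarrow> hol_mat (\<lambda>z. F z + H z) A"
  "hol_mat F A \<Longrightarrow> hol_mat H A \<Longrightarrow> hol_mat (\<lambda>z. F z - H z) A"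
  "hol_mat F A \<Longrightarrow> hol_mat H A \<Longrightarrow> hol_mat (\<lambda>z. F z ** H z) A"
  unfolding hol_mat_def matrix_matrix_mult_def by (auto intro!: holomorphic_intros)

lemma hol_mat_sol:
  "x \<in> {0..pi} \<Longrightarrow> hol_mat (\<lambda>lam. sol c1 c2 lam x) A" "x \<in> {0..pi} \<Longrightarrow> hol_mat (\<lambda>lam. dsol c1 c2 lam x) A"
  unfolding hol_mat_def using sol_holomorphic by blast+

lemma hol_VPhi: "hol_mat VPhi A" "hol_mat VPsi A"
  unfolding VPhi_def[abs_def] VPsi_def[abs_def] boundary_form_matrix_def phi_def dphi_def psi_def dpsi_def
  by (intro hol_mat_intros hol_mat_sol; simp)+

lemma det_holomorphic: "hol_mat F A \<Longrightarrow> (\<lambda>z. det (F z)) holomorphic_on A"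
  unfolding hol_mat_def det_def by (intro holomorphic_intros) auto

text \<open>Cramer's rule. As quotients of entire functions the entries have at most poles, which
  prepares the removal of singularities on the real axis.\<close>

lemma M_quotient:
  obtains num where "num holomorphic_on UNIV" "\<And>z. regular z \<Longrightarrow> M z $ k $ j = num z / det (VPhi z)"
proof -
  define B where "B z = (\<chi> i l. if l = k then - VPsi z $ i $ j else VPhi z $ i $ l)" for z
  have "hol_mat B UNIV"
    unfolding hol_mat_def
  proof (intro allI)
    fix i l show "(\<lambda>z. B z $ i $ l) holomorphic_on UNIV"
      using hol_VPhi[of UNIV] unfolding hol_mat_def B_def by (cases "l = k") (auto intro!: holomorphic_intros)
  qed
  then have 1: "(\<lambda>z. det (B z)) holomorphic_on UNIV" by (rule det_holomorphic)
  have "M z $ k $ j = det (B z) / det (VPhi z)" if reg: "regular z" for z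
  proof -
    have "VPhi z *v column j (M z) = - column j (VPsi z)"
    proof -
      have "VPhi z ** M z = - VPsi z" using VPhi_M[OF reg] by (metis add_eq_0_iff)
      then have "column j (VPhi z ** M z) = column j (- VPsi z)" by simp
      then show ?thesis by (simp add: column_def vec_eq_iff matrix_vector_mult_def matrix_matrix_mult_def)
    qed
    then have "column j (M z) = (\<chi> k. det (\<chi> i l. if l = k then (- column j (VPsi z)) $ i else VPhi z $ i $ l) / det (VPhi z))"
      using cramer[OF reg] by blast
    then have "column j (M z) $ k = det (\<chi> i l. if l = k then (- column j (VPsi z)) $ i else VPhi z $ i $ l) / det (VPhi z)"
      by simp
    moreover have "(\<chi> i l. if l = k then (- column j (VPsi z)) $ i else VPhi z $ i $ l) = B z"
      by (simp add: vec_eq_iff B_def column_def)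
    ultimately show ?thesis by (simp add: column_def)
  qed
  then show ?thesis using that 1 by blast
qed

lemma M_holomorphic: 
  assumes "\<And>z. z \<in> A \<Longrightarrow> regular z"
  shows "hol_mat M A"
  unfolding hol_mat_def
proof (intro allI)
  fix k j
  obtain num where num: "num holomorphic_on UNIV" "\<And>z. regular z \<Longrightarrow> M z $ k $ j = num z / det (VPhi z)"
    using M_quotient[of k j] by blast
  have "(\<lambda>z. num z / det (VPhi z)) holomorphic_on A"
    using assms by (intro holomorphic_intros holomorphic_on_subset[OF num(1)] det_holomorphic hol_VPhi) auto
  then show "(\<lambda>z. M z $ k $ j) holomorphic_on A"
    by (rule holomorphic_transform) (use num(2) assms in auto)
qed

text \<open>The Herglotz bound covers the upper half plane; \<open>M_adjoint\<close> reflects it to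
  the lower one.\<close>

lemma M_growth_vec:
  assumes reg: "\<And>z. Im z \<noteq> 0 \<Longrightarrow> regular z"
  obtains K where "K > 0" "\<And>z. Im z \<noteq> 0 \<Longrightarrow> norm (hip v (M z *v v)) \<le> K * (1 + norm z)^2 / \<bar>Im z\<bar>"
proof -
  let ?f = "\<lambda>z. - hip v (M z *v v)"
  have "?f holomorphic_on {z. Im z > 0}"
  proof -
    have "hol_mat M {z. Im z > 0}" by (rule M_holomorphic) (use reg in auto)
    then show ?thesis unfolding hip_def matrix_vector_mult_def hol_mat_def by (auto intro!: holomorphic_intros)
  qed
  then obtain K where K: "K > 0" "\<And>z. Im z > 0 \<Longrightarrow> norm (?f z) \<le> K * (1 + norm z)^2 / Im z"
    by (rule herglotz_growth) (use M_herglotz reg in auto)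
  show ?thesis
  proof (rule that[OF K(1)])
    fix z assume z: "Im z \<noteq> 0"
    show "norm (hip v (M z *v v)) \<le> K * (1 + norm z)^2 / \<bar>Im z\<bar>"
    proof (cases "Im z > 0")
      case True
      then show ?thesis using K(2)[OF True] by simp
    next
      case False
      then have z': "Im (cnj z) > 0" using z by simp
      have "hip v (M z *v v) = hip v ((M (cnj z))\<^sup>\<dagger> *v v)" using M_adjoint[of z] reg z by simp
      also have "\<dots> = cnj (hip v (M (cnj z) *v v))" by (simp add: hip_cnj hip_adjoint)
      finally have "norm (hip v (M z *v v)) = norm (?f (cnj z))" by simp
      then show ?thesis using K(2)[OF z'] False by simp
    qed
  qed
qed

text \<open>Polarization: the quadratic forms at \<open>e i\<close>, \<open>e j\<close>,
  \<open>e i + e j\<close> and \<open>e i + \<i> *s e j\<close> determine an entry.\<close>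

lemma M_growth:
  assumes reg: "\<And>z. Im z \<noteq> 0 \<Longrightarrow> regular z"
  obtains K where "K > 0" "\<And>z. Im z \<noteq> 0 \<Longrightarrow> norm (M z $ i $ j) \<le> K * (1 + norm z)^2 / \<bar>Im z\<bar>"
proof -
  let ?h = "\<lambda>v z. hip v (M z *v v)"
  define e where "e = (\<lambda>i. axis i 1 :: complex^'m)"
  obtain K1 where K1: "K1 > 0" "\<And>z. Im z \<noteq> 0 \<Longrightarrow> norm (?h (e i) z) \<le> K1 * (1 + norm z)^2 / \<bar>Im z\<bar>" using M_growth_vec[OF reg] by blast
  obtain K2 where K2: "K2 > 0" "\<And>z. Im z \<noteq> 0 \<Longrightarrow> norm (?h (e j) z) \<le> K2 * (1 + norm z)^2 / \<bar>Im z\<bar>" using M_growth_vec[OF reg] by blast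
  obtain K3 where K3: "K3 > 0" "\<And>z. Im z \<noteq> 0 \<Longrightarrow> norm (?h (e i + e j) z) \<le> K3 * (1 + norm z)^2 / \<bar>Im z\<bar>" using M_growth_vec[OF reg] by blast
  obtain K4 where K4: "K4 > 0" "\<And>z. Im z \<noteq> 0 \<Longrightarrow> norm (?h (e i + \<i> *s e j) z) \<le> K4 * (1 + norm z)^2 / \<bar>Im z\<bar>" using M_growth_vec[OF reg] by blast
  have smult_left: "hip (\<i> *s u) w = - \<i> * hip u w" for u w :: "complex^'m"
    by (simp add: hip_def sum_distrib_left mult_ac sum_negf)
  have polar: "2 * M z $ i $ j = (?h (e i + e j) z - ?h (e i) z - ?h (e j) z) - \<i> * (?h (e i + \<i> *s e j) z - ?h (e i) z - ?h (e j) z)" for z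
    by (simp add: mv.add_right hip.add_right hip.add_left smult_left hip_smult_right vector_scalar_commute e_def hip_axis mult_vec_axis algebra_simps)
  show ?thesis
  proof (rule that[of "K1 + K1 + K2 + K2 + K3 + K4"])
    fix z assume z: "Im z \<noteq> 0"
    define r where "r = (1 + norm z)^2 / \<bar>Im z\<bar>"
    have r0: "r \<ge> 0" by (simp add: r_def)
    have b: "norm (?h (e i) z) \<le> K1 * r" "norm (?h (e j) z) \<le> K2 * r" "norm (?h (e i + e j) z) \<le> K3 * r" "norm (?h (e i + \<i> *s e j) z) \<le> K4 * r"
      using K1(2)[OF z] K2(2)[OF z] K3(2)[OF z] K4(2)[OF z] by (simp_all add: r_def)
    have t3: "norm (a - b' - c) \<le> norm a + norm b' + norm c" for a b' c :: complex
      using norm_triangle_ineq4[of "a - b'" c] norm_triangle_ineq4[of a b'] by linarith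
    have "norm (2 * M z $ i $ j) \<le> norm (?h (e i + e j) z - ?h (e i) z - ?h (e j) z) + norm (?h (e i + \<i> *s e j) z - ?h (e i) z - ?h (e j) z)"
      unfolding polar by (rule order_trans[OF norm_triangle_ineq4]) (simp add: norm_mult)
    also have "\<dots> \<le> (K3 * r + K1 * r + K2 * r) + (K4 * r + K1 * r + K2 * r)"
      using t3[of "?h (e i + e j) z" "?h (e i) z" "?h (e j) z"] t3[of "?h (e i + \<i> *s e j) z" "?h (e i) z" "?h (e j) z"] b by linarith
    also have "\<dots> = (K1 + K1 + K2 + K2 + K3 + K4) * r" by (simp add: algebra_simps)
    finally have "2 * norm (M z $ i $ j) \<le> (K1 + K1 + K2 + K2 + K3 + K4) * r" by (simp add: norm_mult)
    then have "norm (M z $ i $ j) \<le> (K1 + K1 + K2 + K2 + K3 + K4) * r"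
      using norm_ge_zero[of "M z $ i $ j"] by linarith
    then show "norm (M z $ i $ j) \<le> (K1 + K1 + K2 + K2 + K3 + K4) * (1 + norm z)^2 / \<bar>Im z\<bar>" by (simp add: r_def)
  qed (use K1 K2 K3 K4 in auto)
qed

end

section \<open>Entire functions\<close>

text \<open>The circle of radius \<open>2 * r\<close> serves a point of modulus \<open>r\<close>:
  there the auxiliary factor is at least \<open>3 * r^2\<close>, which leaves linear growth, and
  Liouville's theorem for polynomial growth applies.\<close>

lemma entire_linear_growth:
  assumes hol: "E holomorphic_on UNIV" and K: "K > 0"
    and bd: "\<And>z. Im z \<noteq> 0 \<Longrightarrow> norm (E z) \<le> K * (1 + norm z)^2 / \<bar>Im z\<bar>"
  obtains a b where "\<And>z. E z = a + b * z"
proof -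
  have main: "norm (E \<xi>) \<le> 12 * K * norm \<xi> ^ 1" if \<xi>: "1 \<le> norm \<xi>" for \<xi>
  proof -
    define r where "r = norm \<xi>"
    have r: "r \<ge> 1" using \<xi> by (simp add: r_def)
    define g where "g z = E z * (z^2 - of_real (2 * r)^2)" for z
    have "norm (g \<xi>) \<le> 4 * r * K * (1 + 2 * r)^2"
    proof (rule maximum_modulus_frontier[of g "cball (0::complex) (2 * r)"])
      show "g holomorphic_on interior (cball (0::complex) (2 * r))"
        unfolding g_def by (intro holomorphic_intros holomorphic_on_subset[OF hol]) auto
      show "continuous_on (closure (cball (0::complex) (2 * r))) g"
        unfolding g_def by (intro continuous_intros holomorphic_on_imp_continuous_on holomorphic_on_subset[OF hol]) auto
      fix z assume "z \<in> frontier (cball (0::complex) (2 * r))"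
      then have z: "norm z = 2 * r" using r by (simp add: frontier_cball)
      have "of_real (2 * r)^2 = z * cnj z" using complex_norm_square[where z = z] unfolding z by simp
      then have eqz: "z^2 - of_real (2 * r)^2 = z * (z - cnj z)" by (simp add: power2_eq_square algebra_simps)
      then have f: "norm (z^2 - of_real (2 * r)^2) = 2 * r * (2 * \<bar>Im z\<bar>)"
        by (simp add: norm_mult z complex_diff_cnj)
      show "norm (g z) \<le> 4 * r * K * (1 + 2 * r)^2"
      \<comment> \<open>At the two real points of the circle the hypothesis is void, but there the
        auxiliary factor vanishes.\<close>
      proof (cases "Im z = 0")
        case True
        then have "norm (g z) = 0" unfolding g_def norm_mult f by simp
        then show ?thesis using r K by simp
      next
        case False
        have "norm (g z) \<le> (K * (1 + norm z)^2 / \<bar>Im z\<bar>) * (2 * r * (2 * \<bar>Im z\<bar>))"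
          unfolding g_def norm_mult f using bd[OF False] r by (intro mult_right_mono) auto
        also have "\<dots> = 4 * r * K * (1 + 2 * r)^2" using False by (simp add: z)
        finally show ?thesis .
      qed
    qed (use r in \<open>auto simp: r_def\<close>)
    moreover have "norm (g \<xi>) \<ge> norm (E \<xi>) * (3 * r^2)"
    proof -
      have "norm (of_real (2 * r)^2 :: complex) - norm (\<xi>^2) \<le> norm (\<xi>^2 - of_real (2 * r)^2)"
        by (metis norm_minus_commute norm_triangle_ineq2)
      then have "3 * r^2 \<le> norm (\<xi>^2 - of_real (2 * r)^2)"
        using r by (simp add: norm_power r_def[symmetric] norm_mult power_mult_distrib)
      then show ?thesis unfolding g_def norm_mult by (intro mult_left_mono) auto
    qed
    ultimately have "norm (E \<xi>) * (3 * r^2) \<le> 4 * r * K * (1 + 2 * r)^2" by linarith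
    also have "\<dots> \<le> 4 * r * K * (3 * r)^2"
      using r K by (intro mult_left_mono power_mono) auto
    also have "\<dots> = (12 * K * r) * (3 * r^2)" by (simp add: power2_eq_square)
    finally have "norm (E \<xi>) \<le> 12 * K * r" using r by (simp only: mult_le_cancel_right) auto
    then show ?thesis by (simp add: r_def)
  qed
  have "E z = E 0 + deriv E 0 * z" for z
    using Liouville_polynomial[OF hol main, where \<xi> = z] by simp
  then show ?thesis using that by blast
qed

text \<open>Multiplied by \<open>w - z0\<close>, \<open>f\<close> stays bounded along a vertical
  approach to \<open>z0\<close>, because there the distance to \<open>z0\<close> is at most the
  distance to the real axis. So the product, a quotient of entire functions near \<open>z0\<close>,
  has no pole but a limit, which is the residue.\<close>

lemma simple_pole_residue:
  assumes n: "n holomorphic_on UNIV" and d: "d holomorphic_on UNIV" and nz: "\<And>z. Im z \<noteq> 0 \<Longrightarrow> d z \<noteq> 0"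
    and f: "\<And>z. d z \<noteq> 0 \<Longrightarrow> f z = n z / d z"
    and K: "K > 0" "\<And>z. Im z \<noteq> 0 \<Longrightarrow> norm (f z) \<le> K * (1 + norm z)^2 / \<bar>Im z\<bar>"
  obtains r where "r > 0" "f holomorphic_on (ball z0 r - {z0})" "((\<lambda>w. f w * (w - z0)) \<longlongrightarrow> residue f z0) (at z0)"
proof -
  have "d \<i> \<noteq> 0" by (rule nz) simp
  then have "\<forall>\<^sub>F w in at z0. d w \<noteq> 0 \<and> w \<in> UNIV"
    using non_zero_neighbour_alt[OF d open_UNIV connected_UNIV, of z0 \<i>] by simp
  then obtain r where r: "r > 0" "\<And>w. w \<noteq> z0 \<Longrightarrow> dist w z0 < r \<Longrightarrow> d w \<noteq> 0"
    unfolding eventually_at by auto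
  have dn: "d w \<noteq> 0" if "w \<in> ball z0 r - {z0}" for w using r(2)[of w] that by (auto simp: dist_commute)
  have hol: "f holomorphic_on (ball z0 r - {z0})"
  proof (rule holomorphic_transform)
    show "(\<lambda>z. n z / d z) holomorphic_on (ball z0 r - {z0})"
      using dn by (intro holomorphic_intros holomorphic_on_subset[OF n] holomorphic_on_subset[OF d]) auto
  qed (use f dn in auto)
  let ?g = "\<lambda>w. f w * (w - z0)"
  have ev: "\<forall>\<^sub>F w in at z0. (n w * (w - z0)) / d w = ?g w"
    unfolding eventually_at by (rule exI[of _ r]) (use r f in auto)
  have "not_essential (\<lambda>w. (n w * (w - z0)) / d w) z0"
  proof (rule not_essential_divide)
    have a: "(\<lambda>w. n w * (w - z0)) analytic_on {z0}" "d analytic_on {z0}"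
      using n d by (auto intro!: analytic_intros simp: holomorphic_on_imp_analytic_at)
    show "not_essential (\<lambda>w. n w * (w - z0)) z0" "not_essential d z0"
      using a by (auto intro: not_essential_analytic)
    show "isolated_singularity_at (\<lambda>w. n w * (w - z0)) z0" "isolated_singularity_at d z0"
      using a by (auto intro: isolated_singularity_at_analytic)
  qed
  then have "not_essential ?g z0" using ev by (rule not_essential_transform)
  moreover have "\<not> is_pole ?g z0"
  proof
    assume "is_pole ?g z0"
    \<comment> \<open>A point below the real axis is approached from below and any other from above,
      so that the distance to the axis is at least \<open>1 / real (Suc k)\<close>.\<close>
    define s :: real where "s = (if Im z0 < 0 then -1 else 1)"
    define w where "w k = z0 + \<i> * of_real (s / real (Suc k))" for k
    have wim: "\<bar>Im (w k)\<bar> \<ge> 1 / real (Suc k)" for k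
      by (auto simp: w_def s_def abs_if)
    have wn: "norm (w k - z0) = 1 / real (Suc k)" for k
    proof -
      have "w k - z0 = \<i> * of_real (s / real (Suc k))" by (simp add: w_def)
      then have "norm (w k - z0) = \<bar>s / real (Suc k)\<bar>" by (simp only: norm_mult norm_of_real norm_ii mult_1)
      then show ?thesis by (simp add: s_def abs_divide)
    qed
    have lim0: "(\<lambda>k. w k) \<longlonglongrightarrow> z0"
    proof -
      have "(\<lambda>k. s * (1 / real (Suc k))) \<longlonglongrightarrow> s * 0" by (intro tendsto_mult tendsto_const LIMSEQ_Suc lim_1_over_n)
      then have "(\<lambda>k. z0 + \<i> * of_real (s / real (Suc k))) \<longlonglongrightarrow> z0 + \<i> * of_real 0"
        by (intro tendsto_intros) simp
      then show ?thesis unfolding w_def[abs_def] by simp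
    qed
    have "filterlim w (at z0) sequentially"
    proof -
      have "w k \<noteq> z0" for k using wn[of k] by auto
      then show ?thesis unfolding filterlim_at using lim0 by simp
    qed
    then have "filterlim (\<lambda>k. ?g (w k)) at_infinity sequentially"
      using \<open>is_pole ?g z0\<close> filterlim_compose unfolding is_pole_def by blast
    moreover have pos: "K * (2 + norm z0)^2 + 1 > 0" using K(1) by (simp add: add_nonneg_pos)
    ultimately have "\<forall>\<^sub>F k in sequentially. norm (?g (w k)) \<ge> K * (2 + norm z0)^2 + 1"
      by (simp only: filterlim_at_infinity[OF order_refl])
    then obtain k where k: "norm (?g (w k)) \<ge> K * (2 + norm z0)^2 + 1"
      unfolding eventually_sequentially by blast
    have im0: "Im (w k) \<noteq> 0" using wim[of k] by (auto simp: field_simps)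
    have "norm (w k) \<le> norm z0 + 1"
    proof -
      have "1 / real (Suc k) \<le> 1" by simp
      then have "norm (w k - z0) \<le> 1" using wn[of k] by linarith
      then show ?thesis using norm_triangle_ineq[of z0 "w k - z0"] by simp
    qed
    then have sq: "(1 + norm (w k))^2 \<le> (2 + norm z0)^2" by (intro power_mono) auto
    have "norm (?g (w k)) = norm (f (w k)) * (1 / real (Suc k))" by (simp only: norm_mult wn)
    also have "\<dots> \<le> norm (f (w k)) * \<bar>Im (w k)\<bar>" using wim[of k] by (intro mult_left_mono) auto
    also have "\<dots> \<le> K * (1 + norm (w k))^2 / \<bar>Im (w k)\<bar> * \<bar>Im (w k)\<bar>" using K(2)[OF im0] by (intro mult_right_mono) auto
    also have "\<dots> = K * (1 + norm (w k))^2" using im0 by simp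
    also have "\<dots> \<le> K * (2 + norm z0)^2" using sq K(1) by (intro mult_left_mono) auto
    finally show False using k by linarith
  qed
  ultimately obtain c where c: "(?g \<longlongrightarrow> c) (at z0)" unfolding not_essential_def by blast
  then have "residue f z0 = c" using residue_simple'[of "ball z0 r" z0 f c] hol r(1) by simp
  then show ?thesis using that[OF r(1) hol] c by simp
qed

text \<open>Multiplied by \<open>w - z0\<close>, both functions have the same limit at every point,
  so Riemann's theorem removes each singularity of the difference.\<close>

lemma equal_residues_difference:
  assumes f: "\<And>z0. \<exists>r>0. f holomorphic_on (ball z0 r - {z0}) \<and> ((\<lambda>w. f w * (w - z0)) \<longlongrightarrow> residue f z0) (at z0)"
    and g: "\<And>z0. \<exists>r>0. g holomorphic_on (ball z0 r - {z0}) \<and> ((\<lambda>w. g w * (w - z0)) \<longlongrightarrow> residue g z0) (at z0)"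
    and res: "\<And>z0. residue f z0 = residue g z0"
  shows "remove_sings (\<lambda>z. f z - g z) holomorphic_on UNIV"
proof -
  define E where "E z = f z - g z" for z
  have "remove_sings E analytic_on {z0}" for z0
  proof -
    obtain r1 where r1: "r1 > 0" "f holomorphic_on (ball z0 r1 - {z0})" "((\<lambda>w. f w * (w - z0)) \<longlongrightarrow> residue f z0) (at z0)" using f by blast
    obtain r2 where r2: "r2 > 0" "g holomorphic_on (ball z0 r2 - {z0})" "((\<lambda>w. g w * (w - z0)) \<longlongrightarrow> residue g z0) (at z0)" using g by blast
    define r where "r = min r1 r2"
    have r: "r > 0" "ball z0 r - {z0} \<subseteq> ball z0 r1 - {z0}" "ball z0 r - {z0} \<subseteq> ball z0 r2 - {z0}" using r1 r2 by (auto simp: r_def)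
    have hol: "E holomorphic_on (ball z0 r - {z0})" unfolding E_def
      by (intro holomorphic_intros holomorphic_on_subset[OF r1(2)] holomorphic_on_subset[OF r2(2)] r)
    have "((\<lambda>w. f w * (w - z0) - g w * (w - z0)) \<longlongrightarrow> residue f z0 - residue g z0) (at z0)"
      by (intro tendsto_intros r1 r2)
    then have "((\<lambda>w. (w - z0) * E w) \<longlongrightarrow> 0) (at z0)" by (simp add: res E_def algebra_simps)
    then obtain h where h: "h holomorphic_on ball z0 r" "\<And>z. z \<in> ball z0 r - {z0} \<Longrightarrow> h z = E z"
      using holomorphic_on_extend_lim[OF hol, of] r(1) by (auto simp: interior_open)
    have "isolated_singularity_at E z0"
      unfolding isolated_singularity_at_def using r(1) hol by (auto simp: analytic_on_open open_Diff)
    moreover have "(E \<longlongrightarrow> h z0) (at z0)"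
    proof -
      have "(h \<longlongrightarrow> h z0) (at z0)"
        using holomorphic_on_imp_continuous_on[OF h(1)] r(1) by (simp add: continuous_on_eq_continuous_at isContD)
      moreover have "\<forall>\<^sub>F w in at z0. h w = E w"
        using eventually_at_in_open[of "ball z0 r" z0] r(1) h(2) by (auto elim!: eventually_mono)
      ultimately show ?thesis by (rule Lim_transform_eventually)
    qed
    ultimately show ?thesis by (rule remove_sings_analytic_at)
  qed
  then have "remove_sings E analytic_on UNIV" by (subst analytic_on_analytic_at) blast
  then show ?thesis unfolding E_def[abs_def] by (rule analytic_imp_holomorphic)
qed

lemma equal_residues_linear:
  assumes f: "\<And>z0. \<exists>r>0. f holomorphic_on (ball z0 r - {z0}) \<and> ((\<lambda>w. f w * (w - z0)) \<longlongrightarrow> residue f z0) (at z0)"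
    and g: "\<And>z0. \<exists>r>0. g holomorphic_on (ball z0 r - {z0}) \<and> ((\<lambda>w. g w * (w - z0)) \<longlongrightarrow> residue g z0) (at z0)"
    and res: "\<And>z0. residue f z0 = residue g z0"
    and hol: "f holomorphic_on {z. Im z \<noteq> 0}" "g holomorphic_on {z. Im z \<noteq> 0}"
    and K: "K > 0" "\<And>z. Im z \<noteq> 0 \<Longrightarrow> norm (f z) \<le> K * (1 + norm z)^2 / \<bar>Im z\<bar>"
    and L: "L > 0" "\<And>z. Im z \<noteq> 0 \<Longrightarrow> norm (g z) \<le> L * (1 + norm z)^2 / \<bar>Im z\<bar>"
  obtains a b where "\<And>z. Im z \<noteq> 0 \<Longrightarrow> f z - g z = a + b * z"
proof -
  define E where "E = remove_sings (\<lambda>z. f z - g z)"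
  have op: "open {z. Im z \<noteq> 0}" by (intro open_Collect_neq continuous_intros)
  have EE: "E z = f z - g z" if "Im z \<noteq> 0" for z
  proof -
    have "(\<lambda>z. f z - g z) holomorphic_on {z. Im z \<noteq> 0}" by (intro holomorphic_intros hol)
    then have "(\<lambda>z. f z - g z) analytic_on {z}"
      using op that by (meson CollectI analytic_at)
    then show ?thesis unfolding E_def by simp
  qed
  have "E holomorphic_on UNIV" unfolding E_def by (rule equal_residues_difference[OF f g res])
  moreover have "norm (E z) \<le> (K + L) * (1 + norm z)^2 / \<bar>Im z\<bar>" if "Im z \<noteq> 0" for z
  proof -
    have "norm (E z) \<le> norm (f z) + norm (g z)" unfolding EE[OF that] by (rule norm_triangle_ineq4)
    also have "\<dots> \<le> K * (1 + norm z)^2 / \<bar>Im z\<bar> + L * (1 + norm z)^2 / \<bar>Im z\<bar>" using K(2)[OF that] L(2)[OF that] by simp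
    finally show ?thesis by (simp add: add_divide_distrib distrib_right)
  qed
  ultimately obtain a b where "\<And>z. E z = a + b * z"
    using entire_linear_growth[of E "K + L"] add_pos_pos[OF K(1) L(1)] by blast
  then show ?thesis using that EE by metis
qed

text \<open>The cone \<open>Re z > norm z / 2\<close> has opening 2\<pi>/3, less than \<pi>, so
  \<open>exp (- e * z)\<close> decays there exponentially in \<open>norm z\<close> and beats the
  growth of order 1/2. Then \<open>e\<close> tends to 0.\<close>

lemma phragmen_lindelof_cone:
  assumes hol: "f holomorphic_on UNIV" and A: "A > 0"
    and growth: "\<And>z. norm z \<ge> R \<Longrightarrow> norm (f z) \<le> A * exp (C * sqrt (norm z))"
    and bound': "\<And>z. norm z \<ge> R \<Longrightarrow> Re z \<le> norm z / 2 \<Longrightarrow> Im z \<noteq> 0 \<Longrightarrow> norm (f z) \<le> B"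
  obtains c where "\<And>z. f z = c"
proof -
  have bound: "norm (f z) \<le> B" if z: "norm z \<ge> R" "Re z \<le> norm z / 2" for z
  proof (cases "Im z = 0")
    case True
    \<comment> \<open>A real point with \<open>Re z \<le> norm z / 2\<close> is not positive; it is
      approached vertically within the region where the bound is assumed.\<close>
    define w where "w k = z + \<i> * of_real (1 / real (Suc k))" for k
    have "norm z = \<bar>Re z\<bar>" using True by (simp add: cmod_eq_Re)
    then have Re0: "Re z \<le> 0" using z(2) by (cases "Re z \<ge> 0") auto
    have fw: "norm (f (w k)) \<le> B" for k
    proof (rule bound')
      have "norm z \<le> norm (w k)" using True by (simp add: w_def norm_complex_def)
      then show "norm (w k) \<ge> R" using z(1) by linarith
      have "Re (w k) = Re z" by (simp add: w_def)
      then show "Re (w k) \<le> norm (w k) / 2" using Re0 norm_ge_zero[of "w k"] by linarith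
      show "Im (w k) \<noteq> 0" using True by (simp add: w_def)
    qed
    have "(\<lambda>k. 1 / real (Suc k)) \<longlonglongrightarrow> 0" by (intro LIMSEQ_Suc lim_1_over_n)
    then have "(\<lambda>k. z + \<i> * of_real (1 / real (Suc k))) \<longlonglongrightarrow> z + \<i> * of_real 0"
      by (intro tendsto_intros)
    then have "w \<longlonglongrightarrow> z" unfolding w_def[abs_def] by simp
    moreover have "isCont f z" using holomorphic_on_imp_continuous_on[OF hol] by (simp add: continuous_on_eq_continuous_at)
    ultimately have "(\<lambda>k. f (w k)) \<longlonglongrightarrow> f z" by (rule isCont_tendsto_compose[rotated])
    then have "(\<lambda>k. norm (f (w k))) \<longlonglongrightarrow> norm (f z)" by (rule tendsto_norm)
    then show ?thesis by (rule LIMSEQ_le_const2) (use fw in auto)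
  qed (use bound'[OF z] in auto)
  have "compact (f ` cball 0 R)"
    by (intro compact_continuous_image holomorphic_on_imp_continuous_on holomorphic_on_subset[OF hol]) auto
  then obtain B0 where "\<forall>w\<in>f ` cball 0 R. norm w \<le> B0"
    using compact_imp_bounded[of "f ` cball 0 R"] unfolding bounded_iff by blast
  then have B0: "\<And>z. norm z \<le> R \<Longrightarrow> norm (f z) \<le> B0" by simp
  define B1 where "B1 = max 1 (max B B0)"
  have out: "norm (f z) \<le> B1" if "Re z \<le> norm z / 2" for z
  proof (cases "norm z \<ge> R")
    case True then show ?thesis using bound[OF True that] by (simp add: B1_def)
  next
    case False then show ?thesis using B0[of z] by (simp add: B1_def)
  qed
  have inside: "norm (f z0) \<le> B1" if z0: "Re z0 > norm z0 / 2" for z0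
  proof -
    have eps: "norm (f z0) * exp (- e * Re z0) \<le> B1" if e: "e > 0" for e
    proof -
      \<comment> \<open>The radius is going to be \<open>s^2\<close>. The last summand makes
        \<open>ln A + C * s\<close> at most \<open>e * s^2 / 2\<close>; the others put
        \<open>z0\<close> inside and the circle beyond \<open>R\<close>.\<close>
      define s where "s = 1 + \<bar>R\<bar> + norm z0 + 2 * (\<bar>ln A\<bar> + \<bar>C\<bar>) / e"
      have "2 * (\<bar>ln A\<bar> + \<bar>C\<bar>) / e \<ge> 0" using e by simp
      then have s: "s \<ge> 1" "s \<ge> R" "s \<ge> norm z0 + 1" "s \<ge> 2 * (\<bar>ln A\<bar> + \<bar>C\<bar>) / e" unfolding s_def using norm_ge_zero[of z0] abs_ge_self[of R] abs_ge_zero[of R] by linarith+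
      have ss: "s \<le> s^2" using s(1) by (simp add: power2_eq_square)
      define g where "g z = f z * exp (- of_real e * z)" for z
      have ng: "norm (g z) = norm (f z) * exp (- e * Re z)" for z by (simp add: g_def norm_mult)
      define D where "D = {z. Re z > norm z / 2} \<inter> ball 0 (s^2)"
      have oD: "open D" unfolding D_def by (intro open_Int open_Collect_less continuous_intros open_ball) auto
      have "closed ({z. norm z / 2 \<le> Re z} \<inter> cball 0 (s^2))" by (intro closed_Int closed_Collect_le continuous_intros closed_cball) auto
      then have cD: "closure D \<subseteq> {z. norm z / 2 \<le> Re z} \<inter> cball 0 (s^2)"
        by (intro closure_minimal) (auto simp: D_def)
      have "norm (g z0) \<le> B1"
      proof (rule maximum_modulus_frontier[of g D])
        show "g holomorphic_on interior D" unfolding g_def by (intro holomorphic_intros holomorphic_on_subset[OF hol]) auto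
        show "continuous_on (closure D) g"
          unfolding g_def by (intro continuous_intros holomorphic_on_imp_continuous_on holomorphic_on_subset[OF hol]) auto
        show "bounded D" unfolding D_def by (rule bounded_Int) auto
        show "z0 \<in> D" using z0 s ss by (auto simp: D_def)
        fix z assume "z \<in> frontier D"
        then have "z \<in> closure D" "z \<notin> D" using oD by (auto simp: frontier_def interior_open)
        then have z: "norm z / 2 \<le> Re z" "norm z \<le> s^2" "\<not> (Re z > norm z / 2 \<and> norm z < s^2)"
          using cD by (auto simp: D_def)
        have Re0: "Re z \<ge> 0" using z(1) norm_ge_zero[of z] by linarith
        show "norm (g z) \<le> B1"
        proof (cases "norm z = s^2")
          case True
          have "norm (g z) \<le> A * exp (C * sqrt (norm z)) * exp (- e * Re z)"
            unfolding ng using growth[of z] True s ss by (intro mult_right_mono) auto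
          also have "\<dots> = exp (ln A + C * s - e * Re z)"
            using A s(1) True by (simp add: exp_add exp_diff exp_minus field_simps)
          also have "\<dots> \<le> 1"
          proof -
            have "2 * (\<bar>ln A\<bar> + \<bar>C\<bar>) \<le> s * e" using s(4) e by (simp add: field_simps)
            then have "(\<bar>ln A\<bar> + \<bar>C\<bar>) * s \<le> s * e / 2 * s" using s(1) by (intro mult_right_mono) auto
            moreover have "ln A \<le> \<bar>ln A\<bar> * s" using s(1) by (metis abs_ge_self abs_ge_zero mult.right_neutral mult_left_mono order_trans)
            moreover have "C * s \<le> \<bar>C\<bar> * s" using s(1) by (intro mult_right_mono) auto
            moreover have "s * e / 2 * s \<le> e * Re z"
              using mult_left_mono[OF z(1), of e] e by (simp add: True power2_eq_square field_simps)
            ultimately show ?thesis by (simp add: distrib_right)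
          qed
          also have "1 \<le> B1" by (simp add: B1_def)
          finally show ?thesis .
        next
          case False
          then have "Re z \<le> norm z / 2" using z by auto
          then have "norm (f z) \<le> B1" by (rule out)
          moreover have "exp (- e * Re z) \<le> 1" using e Re0 by simp
          ultimately have "norm (g z) \<le> B1 * 1" unfolding ng by (intro mult_mono) (auto simp: B1_def)
          then show ?thesis by simp
        qed
      qed
      then show ?thesis unfolding ng .
    qed
    have lim: "((\<lambda>e. norm (f z0) * exp (- e * Re z0)) \<longlongrightarrow> norm (f z0) * exp (- 0 * Re z0)) (at_right 0)"
      by (intro tendsto_intros)
    have "\<forall>\<^sub>F e in at_right 0. norm (f z0) * exp (- e * Re z0) \<le> B1"
      using eventually_at_right_less[of 0] by eventually_elim (rule eps)
    from tendsto_upperbound[OF lim this] show ?thesis by simp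
  qed
  have "norm (f z) \<le> B1" for z using out[of z] inside[of z] by linarith
  then have "bounded (range f)" unfolding bounded_iff by auto
  then have "f constant_on UNIV" by (rule Liouville_theorem[OF hol])
  then show ?thesis using that unfolding constant_on_def by blast
qed

section \<open>Uniqueness\<close>

text \<open>Second differences isolate \<open>p2\<close>, then first differences isolate
  \<open>p1\<close>.\<close>

lemma quadratic_tendsto_0:
  fixes p0 p1 p2 :: "'a::real_normed_vector"
  assumes "(\<lambda>n. p0 + real n *\<^sub>R p1 + (real n)\<^sup>2 *\<^sub>R p2) \<longlonglongrightarrow> 0"
  shows "p0 = 0" "p1 = 0" "p2 = 0"
proof -
  define f where "f n = p0 + real n *\<^sub>R p1 + (real n)\<^sup>2 *\<^sub>R p2" for n
  have f: "f \<longlonglongrightarrow> 0" using assms by (simp add: f_def[abs_def])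
  have f1: "(\<lambda>n. f (Suc n)) \<longlonglongrightarrow> 0" using f by (rule LIMSEQ_Suc)
  have f2: "(\<lambda>n. f (Suc (Suc n))) \<longlonglongrightarrow> 0" using f1 by (rule LIMSEQ_Suc)
  have g: "f (Suc n) - f n = p1 + (2 * real n + 1) *\<^sub>R p2" for n
  proof -
    have "f (Suc n) - f n = (real (Suc n) - real n) *\<^sub>R p1 + ((real (Suc n))\<^sup>2 - (real n)\<^sup>2) *\<^sub>R p2"
      by (simp only: f_def scaleR_left_diff_distrib) simp
    moreover have "(real (Suc n))\<^sup>2 - (real n)\<^sup>2 = 2 * real n + 1" "real (Suc n) - real n = 1"
      by (simp_all add: power2_eq_square algebra_simps)
    ultimately show ?thesis by simp
  qed
  have "(\<lambda>n. (f (Suc (Suc n)) - f (Suc n)) - (f (Suc n) - f n)) \<longlonglongrightarrow> (0 - 0) - (0 - 0)"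
    by (intro tendsto_intros f f1 f2)
  moreover have "(f (Suc (Suc n)) - f (Suc n)) - (f (Suc n) - f n) = 2 *\<^sub>R p2" for n
  proof -
    have "(f (Suc (Suc n)) - f (Suc n)) - (f (Suc n) - f n) = ((2 * real (Suc n) + 1) - (2 * real n + 1)) *\<^sub>R p2"
      unfolding g by (simp only: scaleR_left_diff_distrib) simp
    also have "(2 * real (Suc n) + 1) - (2 * real n + 1) = 2" by simp
    finally show ?thesis .
  qed
  ultimately have "(\<lambda>n::nat. 2 *\<^sub>R p2) \<longlonglongrightarrow> 0" by simp
  then show p2: "p2 = 0" using LIMSEQ_unique[OF tendsto_const] by fastforce
  have "(\<lambda>n. f (Suc n) - f n) \<longlonglongrightarrow> 0 - 0" by (intro tendsto_intros f f1)
  moreover have "f (Suc n) - f n = p1" for n unfolding g p2 by simp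
  ultimately have "(\<lambda>n::nat. p1) \<longlonglongrightarrow> 0" by simp
  then show p1: "p1 = 0" using LIMSEQ_unique[OF tendsto_const] by fastforce
  have "f = (\<lambda>n. p0)" by (simp add: f_def p1 p2 fun_eq_iff)
  then have "(\<lambda>n::nat. p0) \<longlonglongrightarrow> 0" using f by simp
  then show "p0 = 0" using LIMSEQ_unique[OF tendsto_const] by fastforce
qed

text \<open>The direction \<open>1 + 2 * \<i>\<close> satisfies
  \<open>Im rho \<ge> norm rho / 2\<close>, and its square \<open>- 3 + 4 * \<i>\<close> is not
  real.\<close>

definition ray :: "nat \<Rightarrow> complex" where "ray n = of_nat n * (1 + 2 * \<i>)"

lemma ray: "Im (ray n) = 2 * real n" "norm (ray n) = sqrt 5 * real n" "Im (ray n) \<ge> norm (ray n) / 2"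
  "n \<ge> 1 \<Longrightarrow> Im ((ray n)\<^sup>2) \<noteq> 0" "norm (ray n) \<ge> real n"
proof -
  show 1: "Im (ray n) = 2 * real n" by (simp add: ray_def)
  have "norm (1 + 2 * \<i>) = sqrt 5" by (simp add: norm_complex_def)
  then show 2: "norm (ray n) = sqrt 5 * real n" by (simp add: ray_def norm_mult)
  have "sqrt 5 \<le> sqrt (4^2)" by (intro real_sqrt_le_mono) simp
  then have "sqrt 5 * real n \<le> 4 * real n" by (intro mult_right_mono) auto
  then show "Im (ray n) \<ge> norm (ray n) / 2" unfolding 1 2 by simp
  show "n \<ge> 1 \<Longrightarrow> Im ((ray n)\<^sup>2) \<noteq> 0" by (simp add: ray_def power2_eq_square)
  have "1 * real n \<le> sqrt 5 * real n" by (intro mult_right_mono) auto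
  then show "norm (ray n) \<ge> real n" unfolding 2 by simp
qed

locale spectral_problem = boundary_value Q T1 T2 G1 G2
  for Q :: "real \<Rightarrow> complex^'m^'m" and T1 T2 G1 G2 +
  fixes lam :: "nat \<Rightarrow> nat \<Rightarrow> real" and alpha :: "nat \<Rightarrow> nat \<Rightarrow> complex^'m^'m"
  assumes sd: "spectral_data Q T1 T2 G1 G2 lam alpha"
begin

lemma multiplicity:
  "eigenvalue_multiplicity Q T1 T2 G1 G2 mu = card {(n, k) \<in> index_set T1 T2. complex_of_real (lam n k) = mu}"
  "finite {(n, k) \<in> index_set T1 T2. complex_of_real (lam n k) = mu}"
  using sd unfolding spectral_data_def eigenvalue_numbering_def by auto

lemma alpha: "(n, k) \<in> index_set T1 T2 \<Longrightarrow> alpha n k = weight_matrix Q T1 T2 G1 G2 (complex_of_real (lam n k))"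
  using sd unfolding spectral_data_def by blast

text \<open>The numbering lists all eigenvalues by real numbers, so a nonreal number has
  multiplicity 0.\<close>

lemma nonreal_regular:
  assumes "Im z \<noteq> 0"
  shows "regular z"
proof (rule multiplicity_zero_imp_regular)
  have e: "{(n, k) \<in> index_set T1 T2. complex_of_real (lam n k) = z} = {}" using assms by auto
  show "eigenvalue_multiplicity Q T1 T2 G1 G2 z = 0" unfolding multiplicity(1) e by simp
qed

lemma weyl_matrix_pole:
  "\<exists>r>0. (\<lambda>z. weyl_matrix Q T1 T2 G1 G2 z $ i $ j) holomorphic_on (ball z0 r - {z0}) \<and>
     ((\<lambda>w. weyl_matrix Q T1 T2 G1 G2 w $ i $ j * (w - z0)) \<longlongrightarrow> residue (\<lambda>z. weyl_matrix Q T1 T2 G1 G2 z $ i $ j) z0) (at z0)"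
proof -
  obtain num where num: "num holomorphic_on UNIV" "\<And>z. regular z \<Longrightarrow> M z $ i $ j = num z / det (VPhi z)"
    by (rule M_quotient[of i j]) blast
  obtain K where K: "K > 0" "\<And>z. Im z \<noteq> 0 \<Longrightarrow> norm (M z $ i $ j) \<le> K * (1 + norm z)^2 / \<bar>Im z\<bar>"
    using M_growth[OF nonreal_regular] by blast
  show ?thesis
  proof (rule simple_pole_residue[of num "\<lambda>z. det (VPhi z)" "\<lambda>z. weyl_matrix Q T1 T2 G1 G2 z $ i $ j" K z0])
    show "(\<lambda>z. det (VPhi z)) holomorphic_on UNIV" by (intro det_holomorphic hol_VPhi)
  qed (use num K nonreal_regular weyl_matrix_eq in auto)
qed

text \<open>The regular points form an open set, on which the Weyl matrix is the holomorphic
  \<open>M\<close>.\<close>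

lemma weyl_matrix_regular_residue:
  assumes "regular z0"
  shows "residue (\<lambda>z. weyl_matrix Q T1 T2 G1 G2 z $ i $ j) z0 = 0"
proof (rule residue_holo)
  let ?S = "{z. det (VPhi z) \<noteq> 0}"
  have "continuous_on UNIV (\<lambda>z. det (VPhi z))"
    by (intro holomorphic_on_imp_continuous_on det_holomorphic hol_VPhi)
  then show "open ?S" by (intro open_Collect_neq) auto
  show "z0 \<in> ?S" using assms by simp
  have "(\<lambda>z. M z $ i $ j) holomorphic_on ?S" using M_holomorphic[of ?S] unfolding hol_mat_def by simp
  then show "(\<lambda>z. weyl_matrix Q T1 T2 G1 G2 z $ i $ j) holomorphic_on ?S"
    by (rule holomorphic_transform) (simp add: weyl_matrix_eq)
qed

text \<open>The vector \<open>d = DPhi (rho^2) 0 *v v - (\<i> * rho) *s y0\<close>, controlled by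
  \<open>weyl_bounds\<close>, is split by \<open>T1\<close>: its part in the range of
  \<open>mat 1 - T1\<close> gives the second estimate, its part in the range of \<open>T1\<close>
  the other two. The third is kept relative to \<open>Phi (rho^2) 0 *v v\<close>, which is itself of
  order \<open>1 / norm rho\<close> for \<open>v\<close> in the range of \<open>T1\<close>;
  \<open>G1_eq\<close> relies on that.\<close>

lemma M_asymptotics:
  obtains K R where "K > 0" "R > 0"
    "\<And>rho v. norm rho \<ge> R \<Longrightarrow> Im rho \<ge> norm rho / 2 \<Longrightarrow> Im (rho^2) \<noteq> 0 \<Longrightarrow>
      norm (T1 *v (M (rho^2) *v v)) \<le> K / norm rho * norm v \<and>
      norm (M (rho^2) *v v - T1 *v (M (rho^2) *v v) + (\<i> * rho) *s (v - T1 *v v)) \<le> K * remainder rho * norm v \<and>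
      norm ((\<i> * rho) *s (T1 *v (M (rho^2) *v v)) - G1 *v (M (rho^2) *v v) - T1 *v v) \<le> K * remainder rho * norm (Phi (rho^2) 0 *v v)"
proof -
  obtain K R where KR: "K > 0" "R > 0"
    "\<And>rho y dy. norm rho \<ge> R \<Longrightarrow> Im rho \<ge> norm rho / 2 \<Longrightarrow> vector_solution Q (rho^2) y dy \<Longrightarrow>
       boundary_form_vector T2 G2 (y pi) (dy pi) = 0 \<Longrightarrow>
       (\<forall>x\<in>{0..pi}. norm (y x) \<le> K * exp (- Im rho * x) * norm (y 0) \<and> norm (dy x) \<le> K * norm rho * exp (- Im rho * x) * norm (y 0)) \<and>
       norm (dy 0 - (\<i> * rho) *s y 0) \<le> K * remainder rho * norm (y 0)"
    by (rule weyl_bounds) blast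
  \<comment> \<open>A common bound for the operators \<open>T1\<close>, \<open>mat 1 - T1\<close>
    and \<open>G1\<close>, at least 1.\<close>
  define c where "c = (norm T1 + norm (mat 1 - T1) + norm G1 + 1) * kq + 1"
  have c: "c \<ge> 1" "norm (T1 *v w) \<le> c * norm w" "norm (w - T1 *v w) \<le> c * norm w" "norm (G1 *v w) \<le> c * norm w" for w
  proof -
    have le: "norm (A *v w) \<le> c * norm w" if "norm A \<le> norm T1 + norm (mat 1 - T1) + norm G1 + 1" for A :: "complex^'m^'m"
    proof -
      have "norm (A *v w) \<le> norm A * norm w * kq" by (rule kq)
      also have "\<dots> = (norm A * kq) * norm w" by simp
      also have "\<dots> \<le> c * norm w"
      proof (intro mult_right_mono)
        show "norm A * kq \<le> c" unfolding c_def using mult_right_mono[OF that, of kq] kq(1) by linarith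
      qed simp
      finally show ?thesis .
    qed
    show "c \<ge> 1" unfolding c_def using kq(1) by (auto intro!: mult_nonneg_nonneg add_nonneg_nonneg)
    show "norm (T1 *v w) \<le> c * norm w" "norm (G1 *v w) \<le> c * norm w" by (rule le; simp)+
    have "w - T1 *v w = (mat 1 - T1) *v w" by (simp add: mv.diff_left)
    then show "norm (w - T1 *v w) \<le> c * norm w" using le[of "mat 1 - T1"] by simp
  qed
  define L where "L = c * K * (1 + q0)"
  have L: "L \<ge> 0" unfolding L_def using c KR(1) q0_nonneg by simp
  \<comment> \<open>Lets half of \<open>norm rho * norm u\<close> absorb the term
    \<open>(c + L) * norm u\<close> below.\<close>
  define R' where "R' = max R (max 1 (2 * (c + L)))"
  define c2 where "c2 = c + L * c"
  have c2: "c2 \<ge> 0" unfolding c2_def using c L by simp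
  define K' where "K' = 2 * c2 + c * K * (2 * c2 + c) + c * K"
  have K'ge: "K' \<ge> 2 * c2" "K' \<ge> c * K * (2 * c2 + c)" "K' \<ge> c * K" "K' > 0"
    unfolding K'_def using c(1) KR(1) c2 by (auto intro!: add_nonneg_nonneg add_nonneg_pos mult_pos_pos)
  show ?thesis
  proof (rule that[of K' R'])
    fix rho :: complex and v :: "complex^'m"
    assume rho: "norm rho \<ge> R'" "Im rho \<ge> norm rho / 2" "Im (rho^2) \<noteq> 0"
    let ?z = "rho^2"
    have reg: "regular ?z" by (rule nonreal_regular[OF rho(3)])
    have r: "norm rho \<ge> R" "norm rho \<ge> 1" "norm rho \<ge> 2 * (c + L)" using rho(1) by (auto simp: R'_def)
    define u where "u = T1 *v (M ?z *v v)"
    define y0 where "y0 = Phi ?z 0 *v v"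
    define d where "d = DPhi ?z 0 *v v - (\<i> * rho) *s y0"
    have bc: "boundary_form_vector T2 G2 (Phi ?z pi *v v) (DPhi ?z pi *v v) = 0"
      using Phi_V2[OF reg] by (simp add: boundary_form_matrix_mult_vec[symmetric] mv.zero_left)
    have d: "norm d \<le> K * remainder rho * norm y0"
      unfolding d_def y0_def using KR(3)[OF r(1) rho(2) matrix_solution_mult_vec[OF Phi] bc] by blast
    have tt: "T1 *v (T1 *v w) = T1 *v w" "T1 *v (G1 *v w) = G1 *v w" "G1 *v (T1 *v w) = G1 *v w" for w
      by (simp_all add: matrix_vector_mul_assoc T1 G1)
    have y0: "y0 = u - (v - T1 *v v)"
      by (simp add: y0_def u_def Phi_0 mv.add_left mv.diff_left matrix_vector_mul_assoc[symmetric])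
    have dy0: "DPhi ?z 0 *v v = T1 *v v + (M ?z *v v - u) + G1 *v (M ?z *v v)"
      by (simp add: u_def Phi_0 mv.add_left mv.diff_left matrix_vector_mul_assoc[symmetric])
    have Gu: "G1 *v (M ?z *v v) = G1 *v u" by (simp add: u_def tt)
    have T1y0: "T1 *v y0 = u" by (simp add: y0 mv.diff_right u_def tt)
    have T1d: "T1 *v d = T1 *v v + G1 *v u - (\<i> * rho) *s u"
      by (simp add: d_def dy0 mv.diff_right mv.add_right tt vector_scalar_commute T1y0 Gu) (simp add: u_def tt)
    have T1pd: "d - T1 *v d = M ?z *v v - u + (\<i> * rho) *s (v - T1 *v v)"
      unfolding T1d by (simp add: d_def dy0 Gu y0 sv.diff_right sv.add_right algebra_simps)
    have ny0: "norm y0 \<le> norm u + c * norm v"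
      unfolding y0 using norm_triangle_ineq4[of u "v - T1 *v v"] c(3)[of v] by linarith
    have rem: "0 \<le> remainder rho" "remainder rho \<le> 1 + q0" using remainder_bound[OF rho(2)] by auto
    have cd: "c * norm d \<le> L * norm y0"
    proof -
      have "norm d \<le> K * (1 + q0) * norm y0"
        using d rem KR(1) by (meson less_imp_le mult_left_mono mult_right_mono norm_ge_zero order_trans)
      then have "c * norm d \<le> c * (K * (1 + q0) * norm y0)" using c(1) by (intro mult_left_mono) auto
      then show ?thesis by (simp add: L_def mult_ac)
    qed
    have "(\<i> * rho) *s u = T1 *v v + G1 *v u - T1 *v d" unfolding T1d by simp
    then have "norm rho * norm u = norm (T1 *v v + G1 *v u - T1 *v d)"
      by (metis norm_vector_smult norm_mult norm_ii mult_1)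
    also have "\<dots> \<le> norm (T1 *v v) + norm (G1 *v u) + norm (T1 *v d)"
      using norm_triangle_ineq4[of "T1 *v v + G1 *v u" "T1 *v d"] norm_triangle_ineq[of "T1 *v v" "G1 *v u"] by linarith
    also have "\<dots> \<le> c * norm v + c * norm u + c * norm d" using c(2)[of v] c(4)[of u] c(2)[of d] by linarith
    also have "\<dots> \<le> c * norm v + c * norm u + L * (norm u + c * norm v)"
      using cd mult_left_mono[OF ny0 L] by linarith
    also have "\<dots> = c2 * norm v + (c + L) * norm u" by (simp add: c2_def algebra_simps)
    also have "(c + L) * norm u \<le> norm rho / 2 * norm u" using r(3) by (intro mult_right_mono) auto
    finally have "norm rho * norm u \<le> 2 * c2 * norm v" by simp
    moreover have rpos: "norm rho > 0" using r(2) by linarith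
    ultimately have u: "norm u \<le> 2 * c2 / norm rho * norm v" by (simp add: pos_le_divide_eq mult.commute)
    also have "\<dots> \<le> 2 * c2 * norm v" using r(2) rpos c2 by (intro mult_right_mono) (auto simp: pos_divide_le_eq mult_le_cancel_left1)
    finally have ny0v: "norm y0 \<le> (2 * c2 + c) * norm v" using ny0 by (simp add: algebra_simps)
    show "norm (T1 *v (M ?z *v v)) \<le> K' / norm rho * norm v \<and>
      norm (M ?z *v v - T1 *v (M ?z *v v) + (\<i> * rho) *s (v - T1 *v v)) \<le> K' * remainder rho * norm v \<and>
      norm ((\<i> * rho) *s (T1 *v (M ?z *v v)) - G1 *v (M ?z *v v) - T1 *v v) \<le> K' * remainder rho * norm (Phi ?z 0 *v v)"
    proof (intro conjI)
      have "2 * c2 / norm rho * norm v \<le> K' / norm rho * norm v"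
        using K'ge(1) by (intro mult_right_mono divide_right_mono) auto
      then show "norm (T1 *v (M ?z *v v)) \<le> K' / norm rho * norm v" using u by (simp add: u_def)
      have "norm (d - T1 *v d) \<le> c * (K * remainder rho * norm y0)"
        using c(3)[of d] mult_left_mono[OF d, of c] c(1) by linarith
      also have "\<dots> \<le> c * (K * remainder rho * ((2 * c2 + c) * norm v))"
        using ny0v c(1) KR(1) rem by (intro mult_left_mono) auto
      also have "\<dots> = (c * K * (2 * c2 + c)) * (remainder rho * norm v)" by (simp add: mult_ac)
      also have "\<dots> \<le> K' * (remainder rho * norm v)" using K'ge(2) rem by (intro mult_right_mono) auto
      finally show "norm (M ?z *v v - T1 *v (M ?z *v v) + (\<i> * rho) *s (v - T1 *v v)) \<le> K' * remainder rho * norm v"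
        unfolding T1pd u_def by (simp add: mult_ac)
      have "(\<i> * rho) *s u - G1 *v (M ?z *v v) - T1 *v v = - (T1 *v d)" unfolding T1d Gu by simp
      then have "norm ((\<i> * rho) *s u - G1 *v (M ?z *v v) - T1 *v v) \<le> c * (K * remainder rho * norm y0)"
        using c(2)[of d] mult_left_mono[OF d, of c] c(1) by (simp only: norm_minus_cancel) linarith
      also have "\<dots> = (c * K) * (remainder rho * norm y0)" by (simp add: mult_ac)
      also have "\<dots> \<le> K' * (remainder rho * norm y0)" using K'ge(3) rem by (intro mult_right_mono) auto
      finally show "norm ((\<i> * rho) *s (T1 *v (M ?z *v v)) - G1 *v (M ?z *v v) - T1 *v v) \<le> K' * remainder rho * norm (Phi ?z 0 *v v)"
        unfolding u_def y0_def by (simp add: mult_ac)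
    qed
  qed (use KR K'ge in \<open>auto simp: R'_def\<close>)
qed

text \<open>Comparison with the point \<open>\<i> * of_nat (2 * n)\<close> of the imaginary axis:
  the imaginary parts agree, and the moduli differ by a constant factor.\<close>

lemma remainder_ray: "(\<lambda>n. remainder (ray n)) \<longlonglongrightarrow> 0"
proof (rule Lim_null_comparison)
  have "strict_mono (\<lambda>n::nat. 2 * n)" by (simp add: strict_mono_def)
  from LIMSEQ_subseq_LIMSEQ[OF remainder_tendsto_0 this]
  have "(\<lambda>n. remainder (\<i> * of_nat (2 * n))) \<longlonglongrightarrow> 0" by (simp add: o_def)
  from tendsto_mult_right_zero[OF this, of 2]
  show "(\<lambda>n. 2 * remainder (\<i> * of_nat (2 * n))) \<longlonglongrightarrow> 0" .
  show "\<forall>\<^sub>F n in sequentially. norm (remainder (ray n)) \<le> 2 * remainder (\<i> * of_nat (2 * n))"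
  proof (intro always_eventually allI)
    fix n
    let ?I = "integral {0..pi} (\<lambda>t. q t * exp (- 2 * (2 * real n) * t))"
    have I0: "?I \<ge> 0" by (intro integral_nonneg q_times_integrable continuous_intros) (auto intro: q_nonneg mult_nonneg_nonneg)
    have n2: "norm (\<i> * complex_of_nat (2 * n)) = 2 * real n" by (simp add: norm_mult)
    have s5: "sqrt 5 \<le> 4"
      using real_sqrt_le_mono[of 5 "4^2"] by simp
    have "remainder (ray n) = sqrt 5 * (real n * exp (- 2 * (2 * real n) * pi)) + ?I"
      by (simp add: remainder_def ray)
    also have "\<dots> \<le> 4 * (real n * exp (- 2 * (2 * real n) * pi)) + 2 * ?I"
      using s5 I0 by (intro add_mono mult_right_mono) auto
    also have "\<dots> = 2 * remainder (\<i> * of_nat (2 * n))"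
      unfolding remainder_def n2 by simp
    finally show "norm (remainder (ray n)) \<le> 2 * remainder (\<i> * of_nat (2 * n))"
      using remainder_bound(2)[OF ray(3)] by simp
  qed
qed

end

section \<open>Growth in the plane of z and bounds in the sector of rho\<close>

text \<open>The root \<open>\<i> * csqrt (- z)\<close> lies in the closed upper half plane. The
  sector condition comes from \<open>norm z - Re z = 2 * (Im rho)^2\<close>.\<close>

lemma square_root_upper:
  obtains rho where "rho^2 = z" "Im rho \<ge> 0" "norm rho = sqrt (norm z)" "Re z \<le> norm z / 2 \<Longrightarrow> Im rho \<ge> norm rho / 2"
proof -
  define s where "s = csqrt (- z)"
  define rho where "rho = \<i> * s"
  have s2: "s^2 = - z" by (simp add: s_def)
  have 1: "rho^2 = z" by (simp add: rho_def power_mult_distrib s2)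
  have 2: "Im rho \<ge> 0" using csqrt_principal[of "- z"] by (auto simp: rho_def s_def)
  have n2: "(norm rho)^2 = norm z" unfolding 1[symmetric] by (simp add: norm_power)
  from arg_cong[OF this, of sqrt] have 3: "norm rho = sqrt (norm z)" by (simp only: real_sqrt_abs abs_norm_cancel)
  have "Im rho \<ge> norm rho / 2" if "Re z \<le> norm z / 2"
  proof -
    have "Re z = (Re rho)^2 - (Im rho)^2" using arg_cong[OF 1, of Re] by (simp add: power2_eq_square)
    moreover have "norm z = (Re rho)^2 + (Im rho)^2" unfolding n2[symmetric] by (rule cmod_power2)
    ultimately have "(norm rho)^2 \<le> (2 * Im rho)^2" using that by (simp add: cmod_power2)
    then have "norm rho \<le> 2 * Im rho" by (rule power2_le_imp_le) (use 2 in simp)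
    then show ?thesis by simp
  qed
  then show ?thesis using that 1 2 3 by blast
qed

lemma norm_matrix_le:
  fixes A :: "complex^'m^'m"
  assumes "\<And>v. norm (A *v v) \<le> c * norm v"
  shows "norm A \<le> real CARD('m) * real CARD('m) * c"
proof -
  have e: "norm (A $ i $ j) \<le> c" for i j
  proof -
    have "norm (A $ i $ j) \<le> norm (A *v axis j 1)" unfolding mult_vec_axis[symmetric] by (rule Finite_Cartesian_Product.norm_nth_le)
    also have "\<dots> \<le> c * norm (axis j 1 :: complex^'m)" by (rule assms)
    also have "norm (axis j 1 :: complex^'m) = 1"
      by (simp add: norm_vec_def L2_set_def axis_def if_distrib[of norm] if_distrib[of "\<lambda>x. x^2"] cong: if_cong)
    finally show ?thesis by simp
  qed
  have "norm A \<le> (\<Sum>i\<in>UNIV. norm (A $ i))" by (simp add: norm_vec_def L2_set_le_sum)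
  also have "\<dots> \<le> (\<Sum>i\<in>UNIV. \<Sum>j\<in>UNIV. norm (A $ i $ j))"
    by (intro sum_mono) (simp add: norm_vec_def L2_set_le_sum)
  also have "\<dots> \<le> (\<Sum>i\<in>(UNIV::'m set). \<Sum>j\<in>(UNIV::'m set). c)" by (intro sum_mono e)
  also have "\<dots> = real CARD('m) * real CARD('m) * c" by simp
  finally show ?thesis .
qed

lemma norm_entry_le: "norm (A $ i $ j) \<le> norm (A :: complex^'m^'n)"
  by (rule order_trans[OF Finite_Cartesian_Product.norm_nth_le Finite_Cartesian_Product.norm_nth_le])

lemma norm_conj_transpose: "norm (A\<^sup>\<dagger>) = norm (A :: complex^'m^'n)"
proof -
  have "norm (A\<^sup>\<dagger>) = sqrt (\<Sum>i\<in>UNIV. \<Sum>j\<in>UNIV. (norm (A $ j $ i))^2)"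
    by (simp add: norm_vec_def L2_set_def conj_transpose_def sum_nonneg)
  also have "\<dots> = sqrt (\<Sum>j\<in>UNIV. \<Sum>i\<in>UNIV. (norm (A $ j $ i))^2)" by (subst sum.swap) simp
  also have "\<dots> = norm A" by (simp add: norm_vec_def L2_set_def sum_nonneg)
  finally show ?thesis .
qed

context hermitian_potential
begin

text \<open>The exponent is at most \<open>pi * norm rho\<close>, and \<open>norm rho\<close> is the
  square root of \<open>norm z\<close>: this is the source of the order 1/2.\<close>

lemma sol_growth:
  obtains K where "K > 0" "\<And>z x. norm z \<ge> 1 \<Longrightarrow> x \<in> {0..pi} \<Longrightarrow> norm (sol c1 c2 z x) \<le> K * exp (pi * sqrt (norm z))"
proof -
  define c where "c = norm c1 * kq + norm c2 * kq + 1"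
  have c: "c > 0" unfolding c_def using kq(1) by (auto intro!: add_nonneg_pos add_nonneg_nonneg mult_nonneg_nonneg)
  define N where "N = real CARD('m) * real CARD('m)"
  show ?thesis
  proof (rule that[of "N * (2 * exp q0 * c)"])
    show "N * (2 * exp q0 * c) > 0" using c by (simp add: N_def)
    fix z :: complex and x assume z: "norm z \<ge> 1" and x: "x \<in> {0..pi}"
    obtain rho where rho: "rho^2 = z" "Im rho \<ge> 0" "norm rho = sqrt (norm z)" by (rule square_root_upper[of z]) blast
    have r1: "norm rho \<ge> 1" using z rho(3) by simp
    then have r0: "rho \<noteq> 0" by auto
    have "norm (sol c1 c2 z x *v v) \<le> (2 * exp q0 * c * exp (pi * sqrt (norm z))) * norm v" for v
    proof -
      have s: "vector_solution Q (rho^2) (\<lambda>x. sol c1 c2 z x *v v) (\<lambda>x. dsol c1 c2 z x *v v)"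
        unfolding rho(1) by (rule matrix_solution_mult_vec[OF sol])
      have "norm (c2 *v v) / norm rho \<le> norm (c2 *v v) / 1" using r1 by (intro divide_left_mono) auto
      then have "norm (c1 *v v) + norm (c2 *v v) / norm rho \<le> norm c1 * norm v * kq + norm c2 * norm v * kq"
        using kq(2)[of c1 v] kq(2)[of c2 v] by simp
      also have "\<dots> \<le> c * norm v" unfolding c_def by (simp add: algebra_simps)
      finally have a: "norm (c1 *v v) + norm (c2 *v v) / norm rho \<le> c * norm v" .
      have "q0 / norm rho \<le> q0 / 1" using r1 q0_nonneg by (intro divide_left_mono) auto
      then have b: "exp (q0 / norm rho) \<le> exp q0" by simp
      have "Im rho * x \<le> norm rho * pi" using abs_Im_le_cmod[of rho] rho(2) x by (intro mult_mono) auto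
      then have d: "exp (Im rho * x) \<le> exp (pi * sqrt (norm z))" using rho(3) by (simp add: mult.commute)
      have "norm (sol c1 c2 z x *v v) \<le> 2 * exp (q0 / norm rho) * exp (Im rho * x) * (norm (c1 *v v) + norm (c2 *v v) / norm rho)"
        using solution_growth'(1)[OF s r0 rho(2) x] by simp
      also have "\<dots> \<le> 2 * exp q0 * exp (pi * sqrt (norm z)) * (c * norm v)"
        using a b d by (intro mult_mono) (auto intro!: add_nonneg_nonneg)
      finally show ?thesis by (simp add: mult_ac)
    qed
    from norm_matrix_le[OF this]
    show "norm (sol c1 c2 z x) \<le> N * (2 * exp q0 * c) * exp (pi * sqrt (norm z))" by (simp add: N_def mult_ac)
  qed
qed

end

context spectral_problem
begin

text \<open>The growth of \<open>phi\<close> and the decay of \<open>Phi\<close> differ by a factor \<open>\<rho>\<close> on the ranges of \<open>T1\<close> and of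
  \<open>1 - T1\<close>; they have to be paired blockwise.\<close>

lemma sector_bounds:
  obtains K R where "K > 0" "R > 0"
    "\<And>rho x. norm rho \<ge> R \<Longrightarrow> Im rho \<ge> norm rho / 2 \<Longrightarrow> Im (rho^2) \<noteq> 0 \<Longrightarrow> x \<in> {0..pi} \<Longrightarrow>
      norm (phi (rho^2) x ** T1) \<le> K * exp (Im rho * x) \<and>
      norm (phi (rho^2) x ** (mat 1 - T1)) \<le> K * exp (Im rho * x) / norm rho \<and>
      norm (Phi (rho^2) x ** T1) \<le> K * exp (- Im rho * x) / norm rho \<and>
      norm (Phi (rho^2) x ** (mat 1 - T1)) \<le> K * exp (- Im rho * x)"
proof -
  obtain K1 R1 where 1: "K1 > 0" "R1 > 0"
    "\<And>rho y dy. norm rho \<ge> R1 \<Longrightarrow> Im rho \<ge> norm rho / 2 \<Longrightarrow> vector_solution Q (rho^2) y dy \<Longrightarrow>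
       boundary_form_vector T2 G2 (y pi) (dy pi) = 0 \<Longrightarrow>
       (\<forall>x\<in>{0..pi}. norm (y x) \<le> K1 * exp (- Im rho * x) * norm (y 0) \<and> norm (dy x) \<le> K1 * norm rho * exp (- Im rho * x) * norm (y 0)) \<and>
       norm (dy 0 - (\<i> * rho) *s y 0) \<le> K1 * remainder rho * norm (y 0)"
    by (rule weyl_bounds) blast
  obtain K2 R2 where 2: "K2 > 0" "R2 > 0"
    "\<And>rho v. norm rho \<ge> R2 \<Longrightarrow> Im rho \<ge> norm rho / 2 \<Longrightarrow> Im (rho^2) \<noteq> 0 \<Longrightarrow>
      norm (T1 *v (M (rho^2) *v v)) \<le> K2 / norm rho * norm v \<and>
      norm (M (rho^2) *v v - T1 *v (M (rho^2) *v v) + (\<i> * rho) *s (v - T1 *v v)) \<le> K2 * remainder rho * norm v \<and>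
      norm ((\<i> * rho) *s (T1 *v (M (rho^2) *v v)) - G1 *v (M (rho^2) *v v) - T1 *v v) \<le> K2 * remainder rho * norm (Phi (rho^2) 0 *v v)"
    by (rule M_asymptotics) blast
  define c where "c = (norm T1 + norm (mat 1 - T1) + norm G1) * kq"
  have cle: "norm (A *v w) \<le> c * norm w" if "norm A \<le> norm T1 + norm (mat 1 - T1) + norm G1" for w and A :: "complex^'m^'m"
  proof -
    have "norm (A *v w) \<le> norm A * norm w * kq" by (rule kq)
    also have "\<dots> = (norm A * kq) * norm w" by simp
    also have "\<dots> \<le> c * norm w" unfolding c_def using that kq(1) by (intro mult_right_mono) auto
    finally show ?thesis .
  qed
  have c: "norm (T1 *v w) \<le> c * norm w" "norm ((mat 1 - T1) *v w) \<le> c * norm w" "norm (G1 *v w) \<le> c * norm w" for w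
    by (rule cle; simp)+
  have c0: "c \<ge> 0" unfolding c_def using kq(1) by (auto intro!: mult_nonneg_nonneg)
  define N where "N = real CARD('m) * real CARD('m)"
  have N: "N > 0" by (simp add: N_def)
  define L where "L = 4 * exp q0 * c + K1 * (c + K2 * c) + 1"
  have L: "L > 0" "4 * exp q0 * c \<le> L" "K1 * (c + K2 * c) \<le> L" 
    unfolding L_def using c0 1(1) 2(1) by (auto intro!: add_nonneg_pos add_nonneg_nonneg mult_nonneg_nonneg)
  show ?thesis
  proof (rule that[of "N * L" "max 1 (max R1 R2)"])
    fix rho x assume rho: "norm rho \<ge> max 1 (max R1 R2)" "Im rho \<ge> norm rho / 2" "Im (rho^2) \<noteq> 0" and x: "x \<in> {0..pi}"
    let ?z = "rho^2"
    have r: "norm rho \<ge> 1" "norm rho \<ge> R1" "norm rho \<ge> R2" "rho \<noteq> 0" "Im rho \<ge> 0"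
      using rho norm_ge_zero[of rho] by auto
    have reg: "regular ?z" by (rule nonreal_regular[OF rho(3)])
    have "q0 / norm rho \<le> q0 / 1" using r q0_nonneg by (intro divide_left_mono) auto
    then have e: "exp (q0 / norm rho) \<le> exp q0" by simp
    have sphi: "vector_solution Q ?z (\<lambda>x. phi ?z x *v v) (\<lambda>x. dphi ?z x *v v)" for v by (rule matrix_solution_mult_vec[OF phi(1)])
    have grow: "norm (phi ?z x *v v) \<le> 2 * exp q0 * exp (Im rho * x) * (norm (T1 *v v) + norm ((mat 1 - T1 + G1) *v v) / norm rho)" for v
    proof -
      have "norm (phi ?z x *v v) \<le> 2 * exp (q0 / norm rho) * exp (Im rho * x) * (norm (T1 *v v) + norm ((mat 1 - T1 + G1) *v v) / norm rho)"
        using solution_growth'(1)[OF sphi r(4,5) x, of v] by (simp add: phi)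
      also have "\<dots> \<le> 2 * exp q0 * exp (Im rho * x) * (norm (T1 *v v) + norm ((mat 1 - T1 + G1) *v v) / norm rho)"
        using e by (intro mult_right_mono mult_left_mono) auto
      finally show ?thesis .
    qed
    have decay: "norm (Phi ?z x *v v) \<le> K1 * exp (- Im rho * x) * norm (Phi ?z 0 *v v)" for v
    proof -
      have "boundary_form_vector T2 G2 (Phi ?z pi *v v) (DPhi ?z pi *v v) = 0"
        using Phi_V2[OF reg] by (simp add: boundary_form_matrix_mult_vec[symmetric] mv.zero_left)
      from 1(3)[OF r(2) rho(2) matrix_solution_mult_vec[OF Phi] this] show ?thesis using x by blast
    qed
    have TM: "norm (T1 *v (M ?z *v v)) \<le> K2 / norm rho * norm v" for v using 2(3)[OF r(3) rho(2,3)] by blast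
    have div1: "a / norm rho \<le> a" if "a \<ge> 0" for a using r(1) that by (simp add: divide_le_eq mult_le_cancel_left1)
    have b1: "norm ((phi ?z x ** T1) *v v) \<le> L * exp (Im rho * x) * norm v" for v
    proof -
      have "(mat 1 - T1 + G1) *v (T1 *v v) = G1 *v v"
        by (simp add: matrix_vector_mul_assoc T1_simps)
      then have "norm ((phi ?z x ** T1) *v v) \<le> 2 * exp q0 * exp (Im rho * x) * (norm (T1 *v v) + norm (G1 *v v) / norm rho)"
        using grow[of "T1 *v v"] by (simp add: matrix_vector_mul_assoc T1)
      also have "\<dots> \<le> 2 * exp q0 * exp (Im rho * x) * (2 * c * norm v)"
        using c(1)[of v] c(3)[of v] div1[of "norm (G1 *v v)"] by (intro mult_left_mono) auto
      also have "\<dots> = 4 * exp q0 * c * (exp (Im rho * x) * norm v)" by simp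
      also have "\<dots> \<le> L * (exp (Im rho * x) * norm v)" by (intro mult_right_mono L) auto
      finally show ?thesis by (simp add: mult_ac)
    qed
    have b2: "norm ((phi ?z x ** (mat 1 - T1)) *v v) \<le> L * exp (Im rho * x) / norm rho * norm v" for v
    proof -
      \<comment> \<open>Here the initial value of \<open>phi\<close> vanishes and only its
        derivative is left, which enters with the factor \<open>1 / norm rho\<close>.\<close>
      have "(mat 1 - T1 + G1) *v ((mat 1 - T1) *v v) = (mat 1 - T1) *v v" "T1 *v ((mat 1 - T1) *v v) = 0"
        unfolding matrix_vector_mul_assoc by (simp_all only: T1_simps matrix_mul_lid matrix_mul_rid) (simp_all add: mv.zero_left)
      then have "norm ((phi ?z x ** (mat 1 - T1)) *v v) \<le> 2 * exp q0 * exp (Im rho * x) * (norm ((mat 1 - T1) *v v) / norm rho)"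
        using grow[of "(mat 1 - T1) *v v"] by (simp add: matrix_vector_mul_assoc)
      also have "\<dots> \<le> 2 * exp q0 * exp (Im rho * x) * (2 * c * norm v / norm rho)"
      proof -
        have "norm ((mat 1 - T1) *v v) \<le> 2 * c * norm v" using c(2)[of v] mult_nonneg_nonneg[OF c0 norm_ge_zero[of v]] by linarith
        then show ?thesis by (intro mult_left_mono divide_right_mono) auto
      qed
      also have "\<dots> = 4 * exp q0 * c * (exp (Im rho * x) / norm rho * norm v)" by simp
      also have "\<dots> \<le> L * (exp (Im rho * x) / norm rho * norm v)" by (intro mult_right_mono L) auto
      finally show ?thesis by (simp add: mult_ac)
    qed
    have b3: "norm ((Phi ?z x ** T1) *v v) \<le> L * exp (- Im rho * x) / norm rho * norm v" for v
    proof -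
      \<comment> \<open>Here the initial value of \<open>Phi\<close> involves \<open>M\<close> only
        through \<open>T1 ** M\<close>, which is of order \<open>1 / norm rho\<close>.\<close>
      have "Phi ?z 0 *v (T1 *v v) = T1 *v (M ?z *v (T1 *v v))"
        by (simp add: Phi_0 matrix_vector_mul_assoc T1_simps)
      then have "norm ((Phi ?z x ** T1) *v v) \<le> K1 * exp (- Im rho * x) * norm (T1 *v (M ?z *v (T1 *v v)))"
        using decay[of "T1 *v v"] by (simp add: matrix_vector_mul_assoc)
      also have "norm (T1 *v (M ?z *v (T1 *v v))) \<le> K2 / norm rho * (c * norm v)"
        using TM[of "T1 *v v"] mult_left_mono[OF c(1)[of v], of "K2 / norm rho"] 2(1) by simp
      also have "K1 * exp (- Im rho * x) * (K2 / norm rho * (c * norm v)) = K1 * (K2 * c) * (exp (- Im rho * x) / norm rho * norm v)" by simp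
      also have "\<dots> \<le> L * (exp (- Im rho * x) / norm rho * norm v)"
      proof (intro mult_right_mono)
        have "K1 * (K2 * c) \<le> K1 * (c + K2 * c)" using 1(1) c0 by (intro mult_left_mono) auto
        then show "K1 * (K2 * c) \<le> L" using L(3) by linarith
      qed auto
      finally show ?thesis using 1(1) by (simp add: mult_ac)
    qed
    have b4: "norm ((Phi ?z x ** (mat 1 - T1)) *v v) \<le> L * exp (- Im rho * x) * norm v" for v
    proof -
      define w where "w = (mat 1 - T1) *v v"
      have T1w: "T1 *v w = 0" unfolding w_def matrix_vector_mul_assoc
        by (simp only: T1_simps matrix_mul_rid) (simp add: mv.zero_left)
      have cw: "norm w \<le> c * norm v" unfolding w_def by (rule c(2))
      have "Phi ?z 0 *v w = T1 *v w - w + T1 *v (M ?z *v w)"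
        by (simp add: Phi_0 mv.add_left mv.diff_left matrix_vector_mul_assoc[symmetric])
      then have "Phi ?z 0 *v w = T1 *v (M ?z *v w) - w" using T1w by simp
      then have "norm (Phi ?z 0 *v w) \<le> norm (T1 *v (M ?z *v w)) + norm w" by (simp add: norm_triangle_ineq4)
      also have "\<dots> \<le> K2 / norm rho * norm w + norm w" using TM by simp
      also have "\<dots> \<le> K2 * norm w + norm w" using mult_right_mono[OF div1[of K2], of "norm w"] 2(1) by simp
      also have "\<dots> \<le> (c + K2 * c) * norm v" using add_mono[OF cw mult_left_mono[OF cw less_imp_le[OF 2(1)]]] by (simp add: algebra_simps)
      finally have "K1 * exp (- Im rho * x) * norm (Phi ?z 0 *v w) \<le> K1 * exp (- Im rho * x) * ((c + K2 * c) * norm v)"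
        using 1(1) by (intro mult_left_mono) auto
      also have "\<dots> = K1 * (c + K2 * c) * (exp (- Im rho * x) * norm v)" by simp
      also have "\<dots> \<le> L * (exp (- Im rho * x) * norm v)" by (intro mult_right_mono L) auto
      finally have "norm (Phi ?z x *v w) \<le> L * (exp (- Im rho * x) * norm v)"
        by (rule order_trans[OF decay])
      then show ?thesis unfolding w_def matrix_vector_mul_assoc by (simp add: mult_ac)
    qed
    show "norm (phi ?z x ** T1) \<le> N * L * exp (Im rho * x) \<and>
      norm (phi ?z x ** (mat 1 - T1)) \<le> N * L * exp (Im rho * x) / norm rho \<and>
      norm (Phi ?z x ** T1) \<le> N * L * exp (- Im rho * x) / norm rho \<and>
      norm (Phi ?z x ** (mat 1 - T1)) \<le> N * L * exp (- Im rho * x)"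
      using norm_matrix_le[OF b1] norm_matrix_le[OF b2] norm_matrix_le[OF b3] norm_matrix_le[OF b4]
      by (simp add: N_def mult_ac)
  qed (use L N in auto)
qed

end

lemma conj_transpose_has_derivative:
  "(f has_vector_derivative f') F \<Longrightarrow> ((\<lambda>x. (f x :: complex^'m^'m)\<^sup>\<dagger>) has_vector_derivative f'\<^sup>\<dagger>) F"
  by (rule bounded_linear.has_vector_derivative[OF bounded_linear_conj_transpose])

lemma matrix_mult_has_derivative:
  "(f has_vector_derivative f') (at x within s) \<Longrightarrow> (g has_vector_derivative g') (at x within s) \<Longrightarrow>
    ((\<lambda>x. (f x :: complex^'m^'m) ** (g x :: complex^'m^'m)) has_vector_derivative f x ** g' + f' ** g x) (at x within s)"
  by (rule bounded_bilinear.has_vector_derivative[OF bounded_bilinear_matrix_mult])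

lemma hol_cnj_cnj:
  assumes "f holomorphic_on UNIV"
  shows "(\<lambda>z. cnj (f (cnj z))) holomorphic_on UNIV"
proof -
  have "surj cnj" by (metis complex_cnj_cnj surjI)
  then have "cnj \<circ> f \<circ> cnj holomorphic_on UNIV"
    using assms by (intro holomorphic_on_compose_cnj_cnj) auto
  then show ?thesis by (simp add: o_def)
qed

lemma scaleR_vec_conv: "r *\<^sub>R (v :: complex^'m) = of_real r *s v"
proof -
  have "(r *\<^sub>R v) $ i = (of_real r *s v) $ i" for i
    unfolding vector_scaleR_component vector_smult_component by (rule scaleR_conv_of_real)
  then show ?thesis by (simp only: vec_eq_iff simp_thms)
qed

lemma has_derivative_unique_Icc:
  assumes "(f has_vector_derivative a) (at t within {0..pi})" "(f has_vector_derivative b) (at t within {0..pi})" "t \<in> {0..pi}"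
  shows "a = b"
  using vector_derivative_unique_within_closed_interval[of 0 pi t f a b] assms by (simp add: cbox_interval)

section \<open>Equality of the Weyl matrices and of the left boundary condition\<close>

locale isospectral =
  X: spectral_problem Q T1 T2 G1 G2 lam alpha + Y: spectral_problem Q' T1' T2' G1' G2' lam' alpha'
  for Q Q' :: "real \<Rightarrow> complex^'m^'m" and T1 T2 G1 G2 T1' T2' G1' G2' lam lam' alpha alpha' +
  assumes index: "index_set T1 T2 = index_set T1' T2'"
    and data: "\<forall>(n, k) \<in> index_set T1 T2. lam n k = lam' n k \<and> alpha n k = alpha' n k"
begin

text \<open>At a listed eigenvalue this is the equality of weight matrices. Everywhere else both
  problems are regular, and both residues are 0.\<close>

lemma residue_eq:
  "residue (\<lambda>z. weyl_matrix Q T1 T2 G1 G2 z $ i $ j) z0 = residue (\<lambda>z. weyl_matrix Q' T1' T2' G1' G2' z $ i $ j) z0"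
proof (cases "\<exists>n k. (n, k) \<in> index_set T1 T2 \<and> complex_of_real (lam n k) = z0")
  case True
  then obtain n k where nk: "(n, k) \<in> index_set T1 T2" "complex_of_real (lam n k) = z0" by blast
  then have eq: "lam n k = lam' n k" "alpha n k = alpha' n k" using data by auto
  have "weight_matrix Q T1 T2 G1 G2 z0 = weight_matrix Q' T1' T2' G1' G2' z0"
    using X.alpha[OF nk(1)] Y.alpha[of n k] nk index eq by simp
  then have "weight_matrix Q T1 T2 G1 G2 z0 $ i $ j = weight_matrix Q' T1' T2' G1' G2' z0 $ i $ j" by simp
  then show ?thesis by (simp add: weight_matrix_def)
next
  case False
  then have e: "{(n, k) \<in> index_set T1 T2. complex_of_real (lam n k) = z0} = {}" by auto
  have e': "{(n, k) \<in> index_set T1' T2'. complex_of_real (lam' n k) = z0} = {}"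
    using False data index by fastforce
  have "X.regular z0"
    by (rule X.multiplicity_zero_imp_regular) (simp only: X.multiplicity(1) e card.empty)
  moreover have "Y.regular z0"
    by (rule Y.multiplicity_zero_imp_regular) (simp only: Y.multiplicity(1) e' card.empty)
  ultimately show ?thesis by (simp add: X.weyl_matrix_regular_residue Y.weyl_matrix_regular_residue)
qed

lemma M_difference_entry:
  obtains a b where "\<And>z. Im z \<noteq> 0 \<Longrightarrow> X.M z $ i $ j - Y.M z $ i $ j = a + b * z"
proof -
  obtain K where K: "K > 0" "\<And>z. Im z \<noteq> 0 \<Longrightarrow> norm (X.M z $ i $ j) \<le> K * (1 + norm z)^2 / \<bar>Im z\<bar>"
    using X.M_growth[OF X.nonreal_regular] by blast
  obtain L where L: "L > 0" "\<And>z. Im z \<noteq> 0 \<Longrightarrow> norm (Y.M z $ i $ j) \<le> L * (1 + norm z)^2 / \<bar>Im z\<bar>"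
    using Y.M_growth[OF Y.nonreal_regular] by blast
  let ?f = "\<lambda>z. weyl_matrix Q T1 T2 G1 G2 z $ i $ j" and ?g = "\<lambda>z. weyl_matrix Q' T1' T2' G1' G2' z $ i $ j"
  have eqs: "?f z = X.M z $ i $ j" "?g z = Y.M z $ i $ j" if "Im z \<noteq> 0" for z
    using X.weyl_matrix_eq[OF X.nonreal_regular[OF that]] Y.weyl_matrix_eq[OF Y.nonreal_regular[OF that]] by simp_all
  have "(\<lambda>z. X.M z $ i $ j) holomorphic_on {z. Im z \<noteq> 0}"
    using X.M_holomorphic[of "{z. Im z \<noteq> 0}"] X.nonreal_regular unfolding X.hol_mat_def by auto
  then have hf: "?f holomorphic_on {z. Im z \<noteq> 0}" by (rule holomorphic_transform) (simp add: eqs)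
  have "(\<lambda>z. Y.M z $ i $ j) holomorphic_on {z. Im z \<noteq> 0}"
    using Y.M_holomorphic[of "{z. Im z \<noteq> 0}"] Y.nonreal_regular unfolding Y.hol_mat_def by auto
  then have hg: "?g holomorphic_on {z. Im z \<noteq> 0}" by (rule holomorphic_transform) (simp add: eqs)
  obtain a b where "\<And>z. Im z \<noteq> 0 \<Longrightarrow> ?f z - ?g z = a + b * z"
    by (rule equal_residues_linear[OF X.weyl_matrix_pole Y.weyl_matrix_pole residue_eq hf hg K(1) _ L(1)])
       (use K(2) L(2) eqs in auto)
  then show ?thesis using that eqs by metis
qed

lemma M_difference:
  obtains A B where "\<And>z v. Im z \<noteq> 0 \<Longrightarrow> X.M z *v v - Y.M z *v v = A *v v + z *s (B *v v)"
proof -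
  have "\<forall>i j. \<exists>a b. \<forall>z. Im z \<noteq> 0 \<longrightarrow> X.M z $ i $ j - Y.M z $ i $ j = a + b * z"
    using M_difference_entry by metis
  then obtain a b where ab: "\<And>i j z. Im z \<noteq> 0 \<Longrightarrow> X.M z $ i $ j - Y.M z $ i $ j = a i j + b i j * z"
    by metis
  have "X.M z - Y.M z = (\<chi> i j. a i j) + mat z ** (\<chi> i j. b i j)" if "Im z \<noteq> 0" for z
    using ab[OF that] by (simp add: vec_eq_iff mat_mult_entry mult.commute)
  then have "X.M z *v v - Y.M z *v v = (\<chi> i j. a i j) *v v + z *s ((\<chi> i j. b i j) *v v)" if "Im z \<noteq> 0" for z v
    using that by (simp add: mv.diff_left[symmetric] mv.add_left matrix_vector_mul_assoc[symmetric] mat_mult_vec_scale)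
  then show ?thesis using that by blast
qed

text \<open>Inserting the asymptotics of both Weyl matrices into their affine difference leaves,
  along the ray, a null sequence that is a quadratic polynomial in \<open>n\<close>. Its
  coefficients are \<open>A\<close>, a multiple of \<open>T1' - T1\<close> and a multiple of
  \<open>B\<close>, applied to \<open>v\<close>.\<close>

lemma T1_M_eq:
  shows "T1' = T1" "Im z \<noteq> 0 \<Longrightarrow> Y.M z = X.M z"
proof -
  obtain A B where AB: "\<And>z v. Im z \<noteq> 0 \<Longrightarrow> X.M z *v v - Y.M z *v v = A *v v + z *s (B *v v)"
    by (rule M_difference) blast
  obtain K R where KR: "K > 0" "R > 0"
    "\<And>rho v. norm rho \<ge> R \<Longrightarrow> Im rho \<ge> norm rho / 2 \<Longrightarrow> Im (rho^2) \<noteq> 0 \<Longrightarrow>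
      norm (T1 *v (X.M (rho^2) *v v)) \<le> K / norm rho * norm v \<and>
      norm (X.M (rho^2) *v v - T1 *v (X.M (rho^2) *v v) + (\<i> * rho) *s (v - T1 *v v)) \<le> K * X.remainder rho * norm v \<and>
      norm ((\<i> * rho) *s (T1 *v (X.M (rho^2) *v v)) - G1 *v (X.M (rho^2) *v v) - T1 *v v) \<le> K * X.remainder rho * norm (X.Phi (rho^2) 0 *v v)"
    by (rule X.M_asymptotics) blast
  obtain L S where LS: "L > 0" "S > 0"
    "\<And>rho v. norm rho \<ge> S \<Longrightarrow> Im rho \<ge> norm rho / 2 \<Longrightarrow> Im (rho^2) \<noteq> 0 \<Longrightarrow>
      norm (T1' *v (Y.M (rho^2) *v v)) \<le> L / norm rho * norm v \<and>
      norm (Y.M (rho^2) *v v - T1' *v (Y.M (rho^2) *v v) + (\<i> * rho) *s (v - T1' *v v)) \<le> L * Y.remainder rho * norm v \<and>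
      norm ((\<i> * rho) *s (T1' *v (Y.M (rho^2) *v v)) - G1' *v (Y.M (rho^2) *v v) - T1' *v v) \<le> L * Y.remainder rho * norm (Y.Phi (rho^2) 0 *v v)"
    by (rule Y.M_asymptotics) blast
  have inv: "(\<lambda>n. 1 / norm (ray n)) \<longlonglongrightarrow> 0"
  proof -
    have "(\<lambda>n. (1 / sqrt 5) * (1 / real n)) \<longlonglongrightarrow> (1 / sqrt 5) * 0" by (intro tendsto_intros lim_1_over_n)
    then show ?thesis by (simp add: ray(2))
  qed
  have vec: "A *v v = 0 \<and> T1 *v v = T1' *v v \<and> B *v v = 0" for v
  proof -
    \<comment> \<open>Made up of the small terms of both asymptotics. Everything cancels except the
      difference of the two Weyl matrices and
      \<open>(\<i> * ray n) *s (T1' *v v - T1 *v v)\<close>.\<close>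
    define e where "e n = (X.M ((ray n)^2) *v v - T1 *v (X.M ((ray n)^2) *v v) + (\<i> * ray n) *s (v - T1 *v v))
        - (Y.M ((ray n)^2) *v v - T1' *v (Y.M ((ray n)^2) *v v) + (\<i> * ray n) *s (v - T1' *v v))
        + T1 *v (X.M ((ray n)^2) *v v) - T1' *v (Y.M ((ray n)^2) *v v)" for n
    define b where "b n = K * X.remainder (ray n) * norm v + L * Y.remainder (ray n) * norm v + K * (1 / norm (ray n)) * norm v + L * (1 / norm (ray n)) * norm v" for n
    have "e \<longlonglongrightarrow> 0"
    proof (rule Lim_null_comparison)
      have "b \<longlonglongrightarrow> K * 0 * norm v + L * 0 * norm v + K * 0 * norm v + L * 0 * norm v"
        unfolding b_def by (intro tendsto_intros X.remainder_ray Y.remainder_ray inv)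
      then show "b \<longlonglongrightarrow> 0" by simp
      obtain n0 :: nat where n0: "real n0 \<ge> max 1 (max R S)" using real_arch_simple by blast
      show "\<forall>\<^sub>F n in sequentially. norm (e n) \<le> b n"
      proof (rule eventually_sequentiallyI[of n0])
        fix n assume n: "n \<ge> n0"
        then have "real n \<ge> max 1 (max R S)" using n0 by linarith
        then have n1: "n \<ge> 1" and r: "norm (ray n) \<ge> R" "norm (ray n) \<ge> S" using ray(5)[of n] by auto
        note 1 = KR(3)[OF r(1) ray(3) ray(4)[OF n1], of v] and 2 = LS(3)[OF r(2) ray(3) ray(4)[OF n1], of v]
        have t4: "norm (p - q + s - t) \<le> norm p + norm q + norm s + norm t" for p q s t :: "complex^'m"
          using norm_triangle_ineq4[of "p - q + s" t] norm_triangle_ineq[of "p - q" s] norm_triangle_ineq4[of p q] by linarith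
        show "norm (e n) \<le> b n"
          unfolding e_def b_def by (rule order_trans[OF t4]) (use 1 2 in \<open>auto intro!: add_mono\<close>)
      qed
    qed
    moreover have "\<forall>\<^sub>F n in sequentially. e n = A *v v + real n *\<^sub>R ((\<i> * (1 + 2 * \<i>)) *s (T1' *v v - T1 *v v)) + (real n)\<^sup>2 *\<^sub>R ((1 + 2 * \<i>)^2 *s (B *v v))"
    proof (rule eventually_sequentiallyI[of 1])
      fix n :: nat assume n: "n \<ge> 1"
      have "e n = (X.M ((ray n)^2) *v v - Y.M ((ray n)^2) *v v) + (\<i> * ray n) *s (T1' *v v - T1 *v v)"
        by (simp add: e_def vec_eq_iff algebra_simps)
      also have "\<dots> = A *v v + (ray n)^2 *s (B *v v) + (\<i> * ray n) *s (T1' *v v - T1 *v v)" using AB[OF ray(4)[OF n]] by simp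
      also have "\<dots> = A *v v + real n *\<^sub>R ((\<i> * (1 + 2 * \<i>)) *s (T1' *v v - T1 *v v)) + (real n)\<^sup>2 *\<^sub>R ((1 + 2 * \<i>)^2 *s (B *v v))"
      proof -
        have "(ray n)^2 = of_real ((real n)^2) * (1 + 2 * \<i>)^2" "\<i> * ray n = of_real (real n) * (\<i> * (1 + 2 * \<i>))"
          by (simp_all add: ray_def power_mult_distrib)
        then show ?thesis by (simp only: scaleR_vec_conv vector_smult_assoc add_ac)
      qed
      finally show "e n = A *v v + real n *\<^sub>R ((\<i> * (1 + 2 * \<i>)) *s (T1' *v v - T1 *v v)) + (real n)\<^sup>2 *\<^sub>R ((1 + 2 * \<i>)^2 *s (B *v v))" .
    qed
    ultimately have "(\<lambda>n. A *v v + real n *\<^sub>R ((\<i> * (1 + 2 * \<i>)) *s (T1' *v v - T1 *v v)) + (real n)\<^sup>2 *\<^sub>R ((1 + 2 * \<i>)^2 *s (B *v v))) \<longlonglongrightarrow> 0"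
      by (rule Lim_transform_eventually)
    note q = quadratic_tendsto_0[OF this]
    have "1 + 2 * \<i> \<noteq> 0" by (simp add: complex_eq_iff)
    then have nz: "\<i> * (1 + 2 * \<i>) \<noteq> 0" "(1 + 2 * \<i>)^2 \<noteq> 0" by simp_all
    have "T1' *v v - T1 *v v = 0" using q(2) nz(1) by (metis vector_mul_eq_0)
    moreover have "B *v v = 0" using q(3) nz(2) by (metis vector_mul_eq_0)
    ultimately show ?thesis using q(1) by simp
  qed
  then show "T1' = T1" by (simp add: matrix_eq)
  show "Y.M z = X.M z" if "Im z \<noteq> 0"
    using AB[OF that] vec by (simp add: matrix_eq)
qed

text \<open>For \<open>v\<close> in the range of \<open>T1\<close> both problems satisfy the third
  asymptotic estimate with the same small vector \<open>u n\<close>, so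
  \<open>(G1' - G1) *v u n\<close> is o(1) times \<open>norm (u n)\<close>. Since
  \<open>(\<i> * ray n) *s u n\<close> tends to \<open>v\<close>, multiplication by
  \<open>\<i> * ray n\<close> shows that \<open>G1' - G1\<close> kills \<open>v\<close>.\<close>

lemma G1_eq: "G1' = G1"
proof -
  obtain K R where KR: "K > 0" "R > 0"
    "\<And>rho v. norm rho \<ge> R \<Longrightarrow> Im rho \<ge> norm rho / 2 \<Longrightarrow> Im (rho^2) \<noteq> 0 \<Longrightarrow>
      norm (T1 *v (X.M (rho^2) *v v)) \<le> K / norm rho * norm v \<and>
      norm (X.M (rho^2) *v v - T1 *v (X.M (rho^2) *v v) + (\<i> * rho) *s (v - T1 *v v)) \<le> K * X.remainder rho * norm v \<and>
      norm ((\<i> * rho) *s (T1 *v (X.M (rho^2) *v v)) - G1 *v (X.M (rho^2) *v v) - T1 *v v) \<le> K * X.remainder rho * norm (X.Phi (rho^2) 0 *v v)"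
    by (rule X.M_asymptotics) blast
  obtain L S where LS: "L > 0" "S > 0"
    "\<And>rho v. norm rho \<ge> S \<Longrightarrow> Im rho \<ge> norm rho / 2 \<Longrightarrow> Im (rho^2) \<noteq> 0 \<Longrightarrow>
      norm (T1' *v (Y.M (rho^2) *v v)) \<le> L / norm rho * norm v \<and>
      norm (Y.M (rho^2) *v v - T1' *v (Y.M (rho^2) *v v) + (\<i> * rho) *s (v - T1' *v v)) \<le> L * Y.remainder rho * norm v \<and>
      norm ((\<i> * rho) *s (T1' *v (Y.M (rho^2) *v v)) - G1' *v (Y.M (rho^2) *v v) - T1' *v v) \<le> L * Y.remainder rho * norm (Y.Phi (rho^2) 0 *v v)"
    by (rule Y.M_asymptotics) blast
  have T: "T1' = T1" by (rule T1_M_eq)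
  have main: "(G1' - G1) *v (T1 *v w) = 0" for w
  proof -
    define v where "v = T1 *v w"
    have Tv: "T1 *v v = v" unfolding v_def by (simp add: matrix_vector_mul_assoc X.T1)
    define u where "u n = T1 *v (X.M ((ray n)^2) *v v)" for n
    define rm where "rm n = (K * X.remainder (ray n) + L * Y.remainder (ray n)) * (K * norm v)" for n
    have rm0: "rm \<longlonglongrightarrow> 0"
    proof -
      have "rm \<longlonglongrightarrow> (K * 0 + L * 0) * (K * norm v)" unfolding rm_def by (intro tendsto_intros X.remainder_ray Y.remainder_ray)
      then show ?thesis by simp
    qed
    obtain n0 :: nat where n0: "real n0 \<ge> max 1 (max R S)" using real_arch_simple by blast
    have ev: "norm (u n) \<le> K / norm (ray n) * norm v \<and>
        norm ((\<i> * ray n) *s u n - G1 *v u n - v) \<le> K * X.remainder (ray n) * norm (u n) \<and>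
        norm ((\<i> * ray n) *s u n - G1' *v u n - v) \<le> L * Y.remainder (ray n) * norm (u n)" if n: "n \<ge> n0" for n
    proof -
      have "real n \<ge> max 1 (max R S)" using n0 n by linarith
      then have n1: "n \<ge> 1" and r: "norm (ray n) \<ge> R" "norm (ray n) \<ge> S" using ray(5)[of n] by auto
      note i = ray(4)[OF n1]
      have m: "Y.M ((ray n)^2) = X.M ((ray n)^2)" by (rule T1_M_eq(2)[OF i])
      have GT: "G1 *v (X.M ((ray n)^2) *v v) = G1 *v u n" "G1' *v (X.M ((ray n)^2) *v v) = G1' *v u n"
      proof -
        have "G1 *v (T1 *v w) = G1 *v w" "G1' *v (T1 *v w) = G1' *v w" for w
          using X.G1 Y.G1 T by (simp_all add: matrix_vector_mul_assoc)
        then show "G1 *v (X.M ((ray n)^2) *v v) = G1 *v u n" "G1' *v (X.M ((ray n)^2) *v v) = G1' *v u n"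
          unfolding u_def by simp_all
      qed
      \<comment> \<open>For such \<open>v\<close> the error of the third estimate is relative to
        \<open>u n\<close> itself.\<close>
      have ph: "X.Phi ((ray n)^2) 0 *v v = u n" "Y.Phi ((ray n)^2) 0 *v v = u n"
        unfolding X.Phi_0 Y.Phi_0 unfolding m unfolding T u_def
        by (simp_all add: mv.add_left mv.diff_left matrix_vector_mul_assoc[symmetric] Tv)
      show ?thesis
        using KR(3)[OF r(1) ray(3) i, of v] LS(3)[OF r(2) ray(3) i, of v] unfolding ph unfolding m unfolding T GT Tv u_def[symmetric] by blast
    qed
    have scale: "norm (ray n) * norm (u n) \<le> K * norm v" if n: "n \<ge> n0" for n
    proof -
      have "real n \<ge> 1" using n0 n by linarith
      then have "norm (ray n) > 0" using ray(5)[of n] by linarith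
      then show ?thesis using ev[OF n] by (simp add: field_simps)
    qed
    define p where "p n = (\<i> * ray n) *s u n" for n
    have "(\<lambda>n. (G1' - G1) *v p n) \<longlonglongrightarrow> 0"
    proof (rule Lim_null_comparison[OF _ rm0], rule eventually_sequentiallyI[of n0])
      fix n assume n: "n \<ge> n0"
      have "(G1' - G1) *v p n = (\<i> * ray n) *s (((\<i> * ray n) *s u n - G1 *v u n - v) - ((\<i> * ray n) *s u n - G1' *v u n - v))"
        by (simp add: p_def mv.diff_left vector_scalar_commute algebra_simps sv.diff_right)
      then have "norm ((G1' - G1) *v p n) \<le> norm (ray n) * (norm ((\<i> * ray n) *s u n - G1 *v u n - v) + norm ((\<i> * ray n) *s u n - G1' *v u n - v))"
        by (simp only: norm_vector_smult norm_mult norm_ii mult_1) (intro mult_left_mono norm_triangle_ineq4, simp)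
      also have "\<dots> \<le> norm (ray n) * (K * X.remainder (ray n) * norm (u n) + L * Y.remainder (ray n) * norm (u n))"
        using ev[OF n] by (intro mult_left_mono add_mono) auto
      also have "\<dots> = (K * X.remainder (ray n) + L * Y.remainder (ray n)) * (norm (ray n) * norm (u n))" by (simp add: algebra_simps)
      also have "\<dots> \<le> rm n" unfolding rm_def
        using scale[OF n] KR(1) LS(1) X.remainder_bound(2)[OF ray(3)] Y.remainder_bound(2)[OF ray(3)]
        by (intro mult_left_mono) (auto intro!: add_nonneg_nonneg mult_nonneg_nonneg)
      finally show "norm ((G1' - G1) *v p n) \<le> rm n" .
    qed
    moreover have "p \<longlonglongrightarrow> v"
    proof -
      obtain c where c: "\<And>w. norm (G1 *v w) \<le> norm w * c" "c > 0"
        using bounded_linear.pos_bounded[OF mv.bounded_linear_right[of G1]] by blast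
      have inv: "(\<lambda>n. 1 / norm (ray n)) \<longlonglongrightarrow> 0"
      proof -
        have "(\<lambda>n. (1 / sqrt 5) * (1 / real n)) \<longlonglongrightarrow> (1 / sqrt 5) * 0" by (intro tendsto_intros lim_1_over_n)
        then show ?thesis by (simp add: ray(2))
      qed
      have "(\<lambda>n. p n - v) \<longlonglongrightarrow> 0"
      proof (rule Lim_null_comparison)
        have "(\<lambda>n. (K * X.remainder (ray n) + c) * (K * norm v * (1 / norm (ray n)))) \<longlonglongrightarrow> (K * 0 + c) * (K * norm v * 0)"
          by (intro tendsto_intros X.remainder_ray inv)
        then show "(\<lambda>n. (K * X.remainder (ray n) + c) * (K * norm v * (1 / norm (ray n)))) \<longlonglongrightarrow> 0" by simp
        show "\<forall>\<^sub>F n in sequentially. norm (p n - v) \<le> (K * X.remainder (ray n) + c) * (K * norm v * (1 / norm (ray n)))"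
        proof (rule eventually_sequentiallyI[of n0])
          fix n assume n: "n \<ge> n0"
          have "norm (p n - v) \<le> norm ((\<i> * ray n) *s u n - G1 *v u n - v) + norm (G1 *v u n)"
            using norm_triangle_ineq[of "(\<i> * ray n) *s u n - G1 *v u n - v" "G1 *v u n"] by (simp add: p_def)
          also have "\<dots> \<le> K * X.remainder (ray n) * norm (u n) + norm (u n) * c" using ev[OF n] c(1)[of "u n"] by (intro add_mono) auto
          also have "\<dots> = (K * X.remainder (ray n) + c) * norm (u n)" by (simp add: algebra_simps)
          also have "\<dots> \<le> (K * X.remainder (ray n) + c) * (K * norm v * (1 / norm (ray n)))"
            using ev[OF n] KR(1) c(2) X.remainder_bound(2)[OF ray(3)]
            by (intro mult_left_mono) (auto intro!: add_nonneg_nonneg mult_nonneg_nonneg)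
          finally show "norm (p n - v) \<le> (K * X.remainder (ray n) + c) * (K * norm v * (1 / norm (ray n)))" .
        qed
      qed
      then show ?thesis by (simp add: LIM_zero_iff)
    qed
    then have "(\<lambda>n. (G1' - G1) *v p n) \<longlonglongrightarrow> (G1' - G1) *v v"
      by (rule bounded_linear.tendsto[OF mv.bounded_linear_right])
    ultimately show ?thesis unfolding v_def using LIMSEQ_unique by blast
  qed
  have "(G1' - G1) ** T1 = 0" using main by (simp add: matrix_eq matrix_vector_mul_assoc[symmetric] mv.zero_left)
  then show ?thesis using X.G1 Y.G1 T by (simp add: mm.diff_left)
qed

lemma T1_eq: "T1' = T1" by (rule T1_M_eq)

section \<open>The mixed function P and its vanishing\<close>

text \<open>Up to sign the upper right block of one fundamental matrix times the inverse of the
  other, the inverse being written with solutions at \<open>cnj z\<close>. It is 0 if the two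
  problems coincide.\<close>

definition P :: "real \<Rightarrow> complex \<Rightarrow> complex^'m^'m"
  where "P x z = X.phi z x ** (Y.psi (cnj z) x)\<^sup>\<dagger> - X.psi z x ** (Y.phi (cnj z) x)\<^sup>\<dagger>"

text \<open>The conjugate transpose undoes the antiholomorphic dependence through
  \<open>cnj z\<close>.\<close>

lemma P_holomorphic:
  assumes "x \<in> {0..pi}"
  shows "(\<lambda>z. P x z $ i $ j) holomorphic_on UNIV"
proof -
  have star: "(\<lambda>z. (Y.sol c1 c2 (cnj z) x)\<^sup>\<dagger> $ i $ j) holomorphic_on UNIV" for c1 c2 i j
    using hol_cnj_cnj[OF Y.sol_holomorphic(1)[OF assms]] by (simp add: conj_transpose_def)
  show ?thesis
    unfolding P_def X.phi_def X.psi_def Y.phi_def Y.psi_def matrix_matrix_mult_def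
    by (auto intro!: holomorphic_intros star X.sol_holomorphic(1)[OF assms])
qed

text \<open>Replacing \<open>psi\<close> by \<open>Phi\<close> adds the product of
  \<open>X.phi z x\<close>, the common Weyl matrix and the adjoint of \<open>Y.phi (cnj z) x\<close>
  to both terms, and these additions cancel.\<close>

lemma P_weyl:
  assumes "Im z \<noteq> 0"
  shows "P x z = X.phi z x ** (Y.Phi (cnj z) x)\<^sup>\<dagger> - X.Phi z x ** (Y.phi (cnj z) x)\<^sup>\<dagger>"
proof -
  have "(Y.M (cnj z))\<^sup>\<dagger> = X.M z"
    using Y.M_adjoint[OF Y.nonreal_regular[OF assms] Y.nonreal_regular] T1_M_eq(2)[OF assms] assms by simp
  then show ?thesis
    by (simp add: P_def Y.Phi_def X.Phi_def conj_transpose_add conj_transpose_mult mm.add_right mm.add_left matrix_mul_assoc)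
qed

text \<open>In each block the exponential growth of \<open>phi\<close> meets the inverse decay of
  \<open>Phi\<close>, and exactly one of the two factors brings \<open>1 / norm rho\<close>.\<close>

lemma P_sector:
  obtains C R where "C > 0" "R > 0"
    "\<And>rho x. norm rho \<ge> R \<Longrightarrow> Im rho \<ge> norm rho / 2 \<Longrightarrow> Im (rho^2) \<noteq> 0 \<Longrightarrow> x \<in> {0..pi} \<Longrightarrow> norm (P x (rho^2)) \<le> C / norm rho"
proof -
  obtain K R where K: "K > 0" "R > 0"
    "\<And>rho x. norm rho \<ge> R \<Longrightarrow> Im rho \<ge> norm rho / 2 \<Longrightarrow> Im (rho^2) \<noteq> 0 \<Longrightarrow> x \<in> {0..pi} \<Longrightarrow>
      norm (X.phi (rho^2) x ** T1) \<le> K * exp (Im rho * x) \<and>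
      norm (X.phi (rho^2) x ** (mat 1 - T1)) \<le> K * exp (Im rho * x) / norm rho \<and>
      norm (X.Phi (rho^2) x ** T1) \<le> K * exp (- Im rho * x) / norm rho \<and>
      norm (X.Phi (rho^2) x ** (mat 1 - T1)) \<le> K * exp (- Im rho * x)"
    by (rule X.sector_bounds) blast
  obtain L S where L: "L > 0" "S > 0"
    "\<And>rho x. norm rho \<ge> S \<Longrightarrow> Im rho \<ge> norm rho / 2 \<Longrightarrow> Im (rho^2) \<noteq> 0 \<Longrightarrow> x \<in> {0..pi} \<Longrightarrow>
      norm (Y.phi (rho^2) x ** T1') \<le> L * exp (Im rho * x) \<and>
      norm (Y.phi (rho^2) x ** (mat 1 - T1')) \<le> L * exp (Im rho * x) / norm rho \<and>
      norm (Y.Phi (rho^2) x ** T1') \<le> L * exp (- Im rho * x) / norm rho \<and>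
      norm (Y.Phi (rho^2) x ** (mat 1 - T1')) \<le> L * exp (- Im rho * x)"
    by (rule Y.sector_bounds) blast
  obtain k where k: "k > 0" "\<And>(A :: complex^'m^'m) (B :: complex^'m^'m). norm (A ** B) \<le> norm A * norm B * k" using mm.pos_bounded by blast
  \<comment> \<open>\<open>T1\<close> is a Hermitian projection common to both problems, so no mixed
    blocks occur.\<close>
  have block: "A ** B\<^sup>\<dagger> = (A ** T1) ** (B ** T1')\<^sup>\<dagger> + (A ** (mat 1 - T1)) ** (B ** (mat 1 - T1'))\<^sup>\<dagger>" for A B :: "complex^'m^'m"
    unfolding T1_eq by (simp add: conj_transpose_mult conj_transpose_diff X.T1_simps)
  have prod: "norm (A ** B\<^sup>\<dagger>) \<le> a * b * k" if "norm A \<le> a" "norm B \<le> b" for A B :: "complex^'m^'m" and a b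
  proof -
    have "a \<ge> 0" using that(1) norm_ge_zero order_trans by blast
    have "norm (A ** B\<^sup>\<dagger>) \<le> norm A * norm B * k" using k(2)[of A "B\<^sup>\<dagger>"] by (simp add: norm_conj_transpose)
    also have "\<dots> \<le> a * b * k" using that k(1) \<open>a \<ge> 0\<close> by (intro mult_right_mono mult_mono) auto
    finally show ?thesis .
  qed
  show ?thesis
  proof (rule that[of "4 * K * L * k" "max R S"])
    fix rho x assume rho: "norm rho \<ge> max R S" "Im rho \<ge> norm rho / 2" "Im (rho^2) \<noteq> 0" and x: "x \<in> {0..pi}"
    \<comment> \<open>The square root of \<open>cnj (rho^2)\<close> that lies in the same sector as
      \<open>rho\<close>.\<close>
    define sig where "sig = - cnj rho"
    have sig: "norm sig = norm rho" "Im sig = Im rho" "sig^2 = cnj (rho^2)" by (simp_all add: sig_def)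
    have "Im (sig^2) = - Im (rho^2)" unfolding sig(3) by (rule cnj.simps(2))
    then have im: "Im (sig^2) \<noteq> 0" using rho(3) by linarith
    have r: "norm rho \<ge> R" "norm rho \<ge> S" "norm rho > 0" using rho K(2) by auto
    note b = K(3)[OF r(1) rho(2,3) x]
    have c: "norm (Y.phi (cnj (rho^2)) x ** T1') \<le> L * exp (Im rho * x) \<and>
      norm (Y.phi (cnj (rho^2)) x ** (mat 1 - T1')) \<le> L * exp (Im rho * x) / norm rho \<and>
      norm (Y.Phi (cnj (rho^2)) x ** T1') \<le> L * exp (- Im rho * x) / norm rho \<and>
      norm (Y.Phi (cnj (rho^2)) x ** (mat 1 - T1')) \<le> L * exp (- Im rho * x)"
      using L(3)[of sig x] r(2) rho(2) im x unfolding sig(1,2) unfolding sig(3) by blast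
    have ee: "exp (Im rho * x) * exp (- Im rho * x) = 1" by (simp add: exp_minus)
    have e1: "(K * exp (Im rho * x)) * (L * exp (- Im rho * x) / norm rho) * k = K * L * k / norm rho"
      "(K * exp (Im rho * x) / norm rho) * (L * exp (- Im rho * x)) * k = K * L * k / norm rho"
      "(K * exp (- Im rho * x) / norm rho) * (L * exp (Im rho * x)) * k = K * L * k / norm rho"
      "(K * exp (- Im rho * x)) * (L * exp (Im rho * x) / norm rho) * k = K * L * k / norm rho"
      by (simp_all add: exp_minus)
    let ?A = "X.phi (rho^2) x" and ?B = "Y.Phi (cnj (rho^2)) x" and ?C = "X.Phi (rho^2) x" and ?D = "Y.phi (cnj (rho^2)) x"
    have "norm (?A ** ?B\<^sup>\<dagger>) \<le> K * L * k / norm rho + K * L * k / norm rho"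
      unfolding block[of ?A ?B]
      by (rule norm_triangle_le[OF add_mono[OF order_trans[OF prod eq_refl[OF e1(1)]] order_trans[OF prod eq_refl[OF e1(2)]]]]) (use b c in blast)+
    moreover have "norm (?C ** ?D\<^sup>\<dagger>) \<le> K * L * k / norm rho + K * L * k / norm rho"
      unfolding block[of ?C ?D]
      by (rule norm_triangle_le[OF add_mono[OF order_trans[OF prod eq_refl[OF e1(3)]] order_trans[OF prod eq_refl[OF e1(4)]]]]) (use b c in blast)+
    ultimately have "norm (P x (rho^2)) \<le> 4 * (K * L * k / norm rho)"
      unfolding P_weyl[OF rho(3)] using norm_triangle_ineq4[of "?A ** ?B\<^sup>\<dagger>" "?C ** ?D\<^sup>\<dagger>"] by linarith
    then show "norm (P x (rho^2)) \<le> 4 * K * L * k / norm rho" by simp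
  qed (use K L k in auto)
qed

lemma P_growth:
  assumes x: "x \<in> {0..pi}"
  obtains A where "A > 0" "\<And>z. norm z \<ge> 1 \<Longrightarrow> norm (P x z) \<le> A * exp (2 * pi * sqrt (norm z))"
proof -
  obtain K1 where K1: "K1 > 0" "\<And>z x. norm z \<ge> 1 \<Longrightarrow> x \<in> {0..pi} \<Longrightarrow> norm (X.phi z x) \<le> K1 * exp (pi * sqrt (norm z))"
    unfolding X.phi_def using X.sol_growth by metis
  obtain K2 where K2: "K2 > 0" "\<And>z x. norm z \<ge> 1 \<Longrightarrow> x \<in> {0..pi} \<Longrightarrow> norm (X.psi z x) \<le> K2 * exp (pi * sqrt (norm z))"
    unfolding X.psi_def using X.sol_growth by metis
  obtain K3 where K3: "K3 > 0" "\<And>z x. norm z \<ge> 1 \<Longrightarrow> x \<in> {0..pi} \<Longrightarrow> norm (Y.phi z x) \<le> K3 * exp (pi * sqrt (norm z))"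
    unfolding Y.phi_def using Y.sol_growth by metis
  obtain K4 where K4: "K4 > 0" "\<And>z x. norm z \<ge> 1 \<Longrightarrow> x \<in> {0..pi} \<Longrightarrow> norm (Y.psi z x) \<le> K4 * exp (pi * sqrt (norm z))"
    unfolding Y.psi_def using Y.sol_growth by metis
  obtain k where k: "k > 0" "\<And>(A :: complex^'m^'m) (B :: complex^'m^'m). norm (A ** B) \<le> norm A * norm B * k" using mm.pos_bounded by blast
  show ?thesis
  proof (rule that[of "(K1 * K4 + K2 * K3) * k"])
    show "(K1 * K4 + K2 * K3) * k > 0" using K1 K2 K3 K4 k by (simp add: add_pos_pos)
    fix z :: complex assume z: "norm z \<ge> 1"
    define e where "e = exp (pi * sqrt (norm z))"
    have ee: "e * e = exp (2 * pi * sqrt (norm z))" unfolding e_def exp_add[symmetric] by simp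
    have z': "norm (cnj z) \<ge> 1" using z by simp
    have b: "norm (X.phi z x) \<le> K1 * e" "norm (X.psi z x) \<le> K2 * e" "norm (Y.phi (cnj z) x) \<le> K3 * e" "norm (Y.psi (cnj z) x) \<le> K4 * e"
      using K1(2)[OF z x] K2(2)[OF z x] K3(2)[OF z' x] K4(2)[OF z' x] by (simp_all add: e_def)
    have e0: "e > 0" by (simp add: e_def)
    have "norm (X.phi z x ** (Y.psi (cnj z) x)\<^sup>\<dagger>) \<le> (K1 * e) * (K4 * e) * k"
      by (rule order_trans[OF k(2)], unfold norm_conj_transpose, intro mult_right_mono mult_mono) (use b K1 k e0 in auto)
    moreover have "norm (X.psi z x ** (Y.phi (cnj z) x)\<^sup>\<dagger>) \<le> (K2 * e) * (K3 * e) * k"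
      by (rule order_trans[OF k(2)], unfold norm_conj_transpose, intro mult_right_mono mult_mono) (use b K2 k e0 in auto)
    ultimately have "norm (P x z) \<le> (K1 * e) * (K4 * e) * k + (K2 * e) * (K3 * e) * k"
      unfolding P_def by (intro order_trans[OF norm_triangle_ineq4] add_mono)
    also have "\<dots> = (K1 * K4 + K2 * K3) * k * (e * e)" by (simp add: algebra_simps)
    finally show "norm (P x z) \<le> (K1 * K4 + K2 * K3) * k * exp (2 * pi * sqrt (norm z))" unfolding ee .
  qed
qed

text \<open>The cone argument only makes \<open>P x\<close> constant in \<open>z\<close>; the decay
  along the ray then makes the constant 0.\<close>

lemma P_zero:
  assumes x: "x \<in> {0..pi}"
  shows "P x z = 0"
proof -
  obtain C R where C: "C > 0" "R > 0"
    "\<And>rho x. norm rho \<ge> R \<Longrightarrow> Im rho \<ge> norm rho / 2 \<Longrightarrow> Im (rho^2) \<noteq> 0 \<Longrightarrow> x \<in> {0..pi} \<Longrightarrow> norm (P x (rho^2)) \<le> C / norm rho"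
    by (rule P_sector) blast
  obtain A where A: "A > 0" "\<And>z. norm z \<ge> 1 \<Longrightarrow> norm (P x z) \<le> A * exp (2 * pi * sqrt (norm z))"
    by (rule P_growth[OF x]) blast
  \<comment> \<open>The bound in the sector is stated for \<open>rho\<close>, whose modulus is the
    square root of that of \<open>z\<close>; hence the square.\<close>
  define R' where "R' = max 1 (R^2)"
  have "P x z $ i $ j = 0" for i j
  proof -
    obtain c where c: "\<And>z. P x z $ i $ j = c"
    proof (rule phragmen_lindelof_cone[of "\<lambda>z. P x z $ i $ j" A R' "2 * pi" "C / R"])
      show "(\<lambda>z. P x z $ i $ j) holomorphic_on UNIV" by (rule P_holomorphic[OF x])
      show "norm (P x z $ i $ j) \<le> A * exp (2 * pi * sqrt (norm z))" if "norm z \<ge> R'" for z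
        using order_trans[OF norm_entry_le A(2)[of z]] that by (simp add: R'_def)
      show "norm (P x z $ i $ j) \<le> C / R" if z: "norm z \<ge> R'" "Re z \<le> norm z / 2" "Im z \<noteq> 0" for z
      proof -
        obtain rho where rho: "rho^2 = z" "norm rho = sqrt (norm z)" "Re z \<le> norm z / 2 \<Longrightarrow> Im rho \<ge> norm rho / 2"
          by (rule square_root_upper[of z]) blast
        have "R^2 \<le> norm z" using z(1) by (simp add: R'_def)
        then have r: "norm rho \<ge> R" unfolding rho(2) using C(2) by (simp add: real_le_rsqrt)
        have "norm (P x z $ i $ j) \<le> C / norm rho"
          using order_trans[OF norm_entry_le C(3)[OF r rho(3)[OF z(2)] _ x]] z(3) unfolding rho(1) by blast
        also have "\<dots> \<le> C / R" using r C(1,2) by (intro divide_left_mono mult_pos_pos) linarith+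
        finally show ?thesis .
      qed
    qed (use A that in auto)
    have "norm c \<le> 0"
    proof (rule LIMSEQ_le_const[of "\<lambda>n. C * (1 / (sqrt 5 * real n))"])
      have "(\<lambda>n. C * (1 / sqrt 5) * (1 / real n)) \<longlonglongrightarrow> C * (1 / sqrt 5) * 0" by (intro tendsto_intros lim_1_over_n)
      then show "(\<lambda>n. C * (1 / (sqrt 5 * real n))) \<longlonglongrightarrow> 0" by (simp add: mult_ac)
      obtain n0 :: nat where n0: "real n0 \<ge> max 1 R" using real_arch_simple by blast
      show "\<exists>N. \<forall>n\<ge>N. norm c \<le> C * (1 / (sqrt 5 * real n))"
      proof (intro exI[of _ n0] allI impI)
        fix n assume "n \<ge> n0"
        then have "real n \<ge> max 1 R" using n0 by linarith
        then have n: "n \<ge> 1" and r: "norm (ray n) \<ge> R" using ray(5)[of n] by auto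
        have "norm c \<le> C / norm (ray n)"
          using order_trans[OF norm_entry_le C(3)[OF r ray(3) ray(4)[OF n] x]] c[of "(ray n)^2"] by metis
        then show "norm c \<le> C * (1 / (sqrt 5 * real n))" by (simp add: ray(2))
      qed
    qed
    then show ?thesis using c by simp
  qed
  then show ?thesis by (simp add: vec_eq_iff)
qed

text \<open>Differentiating \<open>P = 0\<close> gives \<open>A = A2\<close> for the two mixed terms, while \<open>A + A2\<close> has derivative
  \<open>P (Q' - z) - (Q - z) P = 0\<close>; so \<open>A\<close> keeps its initial value \<open>1\<close>.\<close>

lemma mixed_wronskian_one:
  assumes x: "x \<in> {0..pi}"
  shows "X.phi z x ** (Y.dpsi (cnj z) x)\<^sup>\<dagger> - X.psi z x ** (Y.dphi (cnj z) x)\<^sup>\<dagger> = mat 1"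
proof -
  define A where "A x = X.phi z x ** (Y.dpsi (cnj z) x)\<^sup>\<dagger> - X.psi z x ** (Y.dphi (cnj z) x)\<^sup>\<dagger>" for x
  define A2 where "A2 x = X.dpsi z x ** (Y.phi (cnj z) x)\<^sup>\<dagger> - X.dphi z x ** (Y.psi (cnj z) x)\<^sup>\<dagger>" for x
  note p = matrix_solutionD[OF X.phi(1)[of z]] and s = matrix_solutionD[OF X.psi(1)[of z]]
  note p' = matrix_solutionD[OF Y.phi(1)[of "cnj z"]] and s' = matrix_solutionD[OF Y.psi(1)[of "cnj z"]]
  note ct = conj_transpose_has_derivative and mmd = matrix_mult_has_derivative
  have eq: "A t = A2 t" if t: "t \<in> {0..pi}" for t
  proof -
    have "((\<lambda>x. P x z) has_vector_derivative (X.phi z t ** (Y.dpsi (cnj z) t)\<^sup>\<dagger> + X.dphi z t ** (Y.psi (cnj z) t)\<^sup>\<dagger>)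
       - (X.psi z t ** (Y.dphi (cnj z) t)\<^sup>\<dagger> + X.dpsi z t ** (Y.phi (cnj z) t)\<^sup>\<dagger>)) (at t within {0..pi})"
      unfolding P_def
      by (intro has_vector_derivative_diff mmd ct p(1)[OF t] s(1)[OF t] p'(1)[OF t] s'(1)[OF t])
    then have "((\<lambda>x. 0) has_vector_derivative (X.phi z t ** (Y.dpsi (cnj z) t)\<^sup>\<dagger> + X.dphi z t ** (Y.psi (cnj z) t)\<^sup>\<dagger>)
       - (X.psi z t ** (Y.dphi (cnj z) t)\<^sup>\<dagger> + X.dpsi z t ** (Y.phi (cnj z) t)\<^sup>\<dagger>)) (at t within {0..pi})"
      by (rule has_vector_derivative_transform[OF t, rotated]) (simp add: P_zero)
    moreover have "((\<lambda>x. 0 :: complex^'m^'m) has_vector_derivative 0) (at t within {0..pi})" by simp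
    ultimately have "(X.phi z t ** (Y.dpsi (cnj z) t)\<^sup>\<dagger> + X.dphi z t ** (Y.psi (cnj z) t)\<^sup>\<dagger>)
       - (X.psi z t ** (Y.dphi (cnj z) t)\<^sup>\<dagger> + X.dpsi z t ** (Y.phi (cnj z) t)\<^sup>\<dagger>) = 0"
      using t by (rule has_derivative_unique_Icc)
    then show ?thesis by (simp add: A_def A2_def algebra_simps)
  qed
  note lct = ac_deriv_linear[OF bounded_linear_conj_transpose] and b = ac_deriv_bilinear[OF bounded_bilinear_matrix_mult]
  have "ac_deriv 0 pi (\<lambda>x. A x + A2 x) (\<lambda>x. 
     (X.phi z x ** (Q' x ** Y.psi (cnj z) x - mat (cnj z) ** Y.psi (cnj z) x)\<^sup>\<dagger> + X.dphi z x ** (Y.dpsi (cnj z) x)\<^sup>\<dagger>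
       - (X.psi z x ** (Q' x ** Y.phi (cnj z) x - mat (cnj z) ** Y.phi (cnj z) x)\<^sup>\<dagger> + X.dpsi z x ** (Y.dphi (cnj z) x)\<^sup>\<dagger>))
     + (X.dpsi z x ** (Y.dphi (cnj z) x)\<^sup>\<dagger> + (Q x ** X.psi z x - mat z ** X.psi z x) ** (Y.phi (cnj z) x)\<^sup>\<dagger>
       - (X.dphi z x ** (Y.dpsi (cnj z) x)\<^sup>\<dagger> + (Q x ** X.phi z x - mat z ** X.phi z x) ** (Y.psi (cnj z) x)\<^sup>\<dagger>)))"
    unfolding A_def A2_def
    by (intro ac_deriv_add ac_deriv_diff b lct p s p' s')
  then have "ac_deriv 0 pi (\<lambda>x. A x + A2 x) (\<lambda>x. 0)"
  proof (rule ac_deriv_cong)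
    fix x :: real assume "x \<in> {0<..<pi}"
    then have P0: "X.phi z x ** (Y.psi (cnj z) x)\<^sup>\<dagger> = X.psi z x ** (Y.phi (cnj z) x)\<^sup>\<dagger>"
      using P_zero[of x z] by (simp add: P_def)
    then have P1: "X.phi z x ** ((Y.psi (cnj z) x)\<^sup>\<dagger> ** B) = X.psi z x ** ((Y.phi (cnj z) x)\<^sup>\<dagger> ** B)" for B
      by (simp add: matrix_mul_assoc)
    show "X.phi z x ** (Q' x ** Y.psi (cnj z) x - mat (cnj z) ** Y.psi (cnj z) x)\<^sup>\<dagger> + X.dphi z x ** (Y.dpsi (cnj z) x)\<^sup>\<dagger>
       - (X.psi z x ** (Q' x ** Y.phi (cnj z) x - mat (cnj z) ** Y.phi (cnj z) x)\<^sup>\<dagger> + X.dpsi z x ** (Y.dphi (cnj z) x)\<^sup>\<dagger>)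
     + (X.dpsi z x ** (Y.dphi (cnj z) x)\<^sup>\<dagger> + (Q x ** X.psi z x - mat z ** X.psi z x) ** (Y.phi (cnj z) x)\<^sup>\<dagger>
       - (X.dphi z x ** (Y.dpsi (cnj z) x)\<^sup>\<dagger> + (Q x ** X.phi z x - mat z ** X.phi z x) ** (Y.psi (cnj z) x)\<^sup>\<dagger>)) = 0"
      by (simp add: P0 P1 conj_transpose_diff conj_transpose_mult mm.diff_left mm.diff_right matrix_mul_assoc[symmetric])
  qed
  from ac_deriv_zero_imp_const[OF this x] have "A x + A x = A 0 + A 0" using eq[OF x] eq[of 0] by simp
  then have "A x = A 0" by (simp add: scaleR_2[symmetric])
  also have "A 0 = mat 1"
    unfolding A_def X.phi X.psi Y.phi Y.psi
    by (simp add: T1_eq G1_eq conj_transpose_add conj_transpose_diff X.T1_simps)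
  finally show ?thesis by (simp add: A_def)
qed

section \<open>Equality of the solutions, the potentials and the right boundary condition\<close>

text \<open>The mixed Wronskian and, up to sign, \<open>P\<close> form the first block row of the
  transition matrix between the two problems, by now known to be 1 and 0. \<open>key\<close> applies
  this row to a solution of the second problem, and the constant Wronskians \<open>w1\<close> to
  \<open>w4\<close> single out one solution of the first.\<close>

lemma solutions_eq:
  assumes x: "x \<in> {0..pi}"
  shows "X.phi z x = Y.phi z x" "X.psi z x = Y.psi z x"
proof -
  note W = Y.wronskian_matrix[OF _ _ x, where lam = z]
  note simps = Y.phi Y.psi conj_transpose_add conj_transpose_diff Y.T1_simps
  have w1: "(Y.psi (cnj z) x)\<^sup>\<dagger> ** Y.dphi z x - (Y.dpsi (cnj z) x)\<^sup>\<dagger> ** Y.phi z x = - mat 1"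
    using W[OF Y.psi(1) Y.phi(1)] by (simp add: simps)
  have w2: "(Y.phi (cnj z) x)\<^sup>\<dagger> ** Y.dphi z x - (Y.dphi (cnj z) x)\<^sup>\<dagger> ** Y.phi z x = 0"
    using W[OF Y.phi(1) Y.phi(1)] by (simp add: simps)
  have w3: "(Y.psi (cnj z) x)\<^sup>\<dagger> ** Y.dpsi z x - (Y.dpsi (cnj z) x)\<^sup>\<dagger> ** Y.psi z x = 0"
    using W[OF Y.psi(1) Y.psi(1)] by (simp add: simps)
  have w4: "(Y.phi (cnj z) x)\<^sup>\<dagger> ** Y.dpsi z x - (Y.dphi (cnj z) x)\<^sup>\<dagger> ** Y.psi z x = mat 1"
    using W[OF Y.phi(1) Y.psi(1)] by (simp add: simps)
  have key: "U = X.psi z x ** ((Y.phi (cnj z) x)\<^sup>\<dagger> ** DU - (Y.dphi (cnj z) x)\<^sup>\<dagger> ** U)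
     - X.phi z x ** ((Y.psi (cnj z) x)\<^sup>\<dagger> ** DU - (Y.dpsi (cnj z) x)\<^sup>\<dagger> ** U)" for U DU :: "complex^'m^'m"
  proof -
    have "X.psi z x ** ((Y.phi (cnj z) x)\<^sup>\<dagger> ** DU - (Y.dphi (cnj z) x)\<^sup>\<dagger> ** U)
     - X.phi z x ** ((Y.psi (cnj z) x)\<^sup>\<dagger> ** DU - (Y.dpsi (cnj z) x)\<^sup>\<dagger> ** U)
     = (X.phi z x ** (Y.dpsi (cnj z) x)\<^sup>\<dagger> - X.psi z x ** (Y.dphi (cnj z) x)\<^sup>\<dagger>) ** U - P x z ** DU"
      by (simp add: P_def mm.diff_left mm.diff_right matrix_mul_assoc algebra_simps)
    then show ?thesis unfolding mixed_wronskian_one[OF x] P_zero[OF x] by (simp add: mm.zero_left)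
  qed
  show "X.phi z x = Y.phi z x" using key[of "Y.phi z x" "Y.dphi z x"] unfolding w1 w2 by (simp add: mm.zero_right mm.minus_right)
  show "X.psi z x = Y.psi z x" using key[of "Y.psi z x" "Y.dpsi z x"] unfolding w3 w4 by (simp add: mm.zero_right)
qed

lemma derivative_eq:
  assumes F: "matrix_solution Q z F DF" and H: "matrix_solution Q' z H DH"
    and eq: "\<And>x. x \<in> {0..pi} \<Longrightarrow> F x = H x" and x: "x \<in> {0..pi}"
  shows "DF x = DH x"
proof -
  have "(F has_vector_derivative DH x) (at x within {0..pi})"
    by (rule has_vector_derivative_transform[OF x _ matrix_solutionD(1)[OF H x]]) (use eq in auto)
  with matrix_solutionD(1)[OF F x] show ?thesis using x by (rule has_derivative_unique_Icc)
qed

lemma potential_difference: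
  assumes F: "matrix_solution Q z F DF" and H: "matrix_solution Q' z H DH"
    and eq: "\<And>x. x \<in> {0..pi} \<Longrightarrow> F x = H x"
  obtains N where "negligible N" "\<And>x. x \<in> {0<..<pi} - N \<Longrightarrow> (Q x - Q' x) ** F x = 0"
proof -
  obtain N1 where N1: "negligible N1" "\<And>x. x \<in> {0<..<pi} - N1 \<Longrightarrow> (DF has_vector_derivative (Q x ** F x - mat z ** F x)) (at x)"
    using ac_derivD[OF matrix_solutionD(3)[OF F]] by blast
  obtain N2 where N2: "negligible N2" "\<And>x. x \<in> {0<..<pi} - N2 \<Longrightarrow> (DH has_vector_derivative (Q' x ** H x - mat z ** H x)) (at x)"
    using ac_derivD[OF matrix_solutionD(3)[OF H]] by blast
  show ?thesis
  proof (rule that[of "N1 \<union> N2"])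
    show "negligible (N1 \<union> N2)" using N1 N2 by auto
    fix x assume x: "x \<in> {0<..<pi} - (N1 \<union> N2)"
    have "(DH has_vector_derivative (Q x ** F x - mat z ** F x)) (at x)"
      by (rule has_vector_derivative_transform_within_open[of DF _ _ "{0<..<pi}"])
         (use x N1(2)[of x] derivative_eq[OF F H eq] in auto)
    moreover have "(DH has_vector_derivative (Q' x ** H x - mat z ** H x)) (at x)" using N2(2) x by auto
    ultimately have "Q x ** F x - mat z ** F x = Q' x ** H x - mat z ** H x" by (rule vector_derivative_unique_at)
    then show "(Q x - Q' x) ** F x = 0" using eq[of x] x by (simp add: mm.diff_left)
  qed
qed

text \<open>Each of \<open>phi\<close> and \<open>psi\<close> may be singular at some points, but
  the mixed Wronskian writes the unit matrix as a combination of both with factors on the right.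
  What kills both from the left is therefore 0.\<close>

lemma Q_eq: "AE x in lebesgue_on {0<..<pi}. Q x = Q' x"
proof -
  obtain N1 where N1: "negligible N1" "\<And>x. x \<in> {0<..<pi} - N1 \<Longrightarrow> (Q x - Q' x) ** X.phi \<i> x = 0"
    by (rule potential_difference[OF X.phi(1) Y.phi(1) solutions_eq(1)]) blast+
  obtain N2 where N2: "negligible N2" "\<And>x. x \<in> {0<..<pi} - N2 \<Longrightarrow> (Q x - Q' x) ** X.psi \<i> x = 0"
    by (rule potential_difference[OF X.psi(1) Y.psi(1) solutions_eq(2)]) blast+
  have "Q x = Q' x" if x: "x \<in> {0<..<pi} - (N1 \<union> N2)" for x
  proof -
    have "Q x - Q' x = (Q x - Q' x) ** (X.phi \<i> x ** (Y.dpsi (cnj \<i>) x)\<^sup>\<dagger> - X.psi \<i> x ** (Y.dphi (cnj \<i>) x)\<^sup>\<dagger>)"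
      using mixed_wronskian_one[of x \<i>] x by simp
    also have "\<dots> = ((Q x - Q' x) ** X.phi \<i> x) ** (Y.dpsi (cnj \<i>) x)\<^sup>\<dagger> - ((Q x - Q' x) ** X.psi \<i> x) ** (Y.dphi (cnj \<i>) x)\<^sup>\<dagger>"
      by (simp only: mm.diff_right matrix_mul_assoc)
    also have "\<dots> = 0" using N1(2)[of x] N2(2)[of x] x by (simp add: mm.zero_left)
    finally show ?thesis by simp
  qed
  then have "\<exists>N. negligible N \<and> (\<forall>x\<in>{0<..<pi} - N. Q x = Q' x)"
    using N1(1) N2(1) by (intro exI[of _ "N1 \<union> N2"]) auto
  then show ?thesis by (subst AE_lebesgue_on_iff_negligible) auto
qed

text \<open>At the regular point \<i> the two Weyl solutions have the same values and derivatives at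
  \<pi>. Each projection fixes these values and has exactly their span as its range, so each of the
  two absorbs the other from the left; Hermitian projections with this property coincide. Then
  \<open>G2\<close> is determined on the range of \<open>T2\<close>.\<close>

lemma T2_G2_eq: "T2 = T2'" "G2 = G2'"
proof -
  have reg: "X.regular \<i>" "Y.regular \<i>" by (simp_all add: X.nonreal_regular Y.nonreal_regular)
  have F: "X.Phi \<i> pi = Y.Phi \<i> pi"
    unfolding X.Phi_def Y.Phi_def using solutions_eq[of pi \<i>] T1_M_eq(2)[of \<i>] by simp
  have "X.dphi \<i> pi = Y.dphi \<i> pi" "X.dpsi \<i> pi = Y.dpsi \<i> pi"
    using derivative_eq[OF X.phi(1) Y.phi(1) solutions_eq(1)] derivative_eq[OF X.psi(1) Y.psi(1) solutions_eq(2)] by simp_all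
  then have DF: "X.DPhi \<i> pi = Y.DPhi \<i> pi"
    unfolding X.DPhi_def Y.DPhi_def using T1_M_eq(2)[of \<i>] by simp
  note x = X.Phi_pi[OF reg(1)] and y = Y.Phi_pi[OF reg(2), folded F DF]
  obtain B where B: "X.Phi \<i> pi ** B = T2" by (rule X.Phi_pi_range[OF reg(1)])
  obtain B' where B': "X.Phi \<i> pi ** B' = T2'" using Y.Phi_pi_range[OF reg(2)] unfolding F by blast
  have "T2' ** (X.Phi \<i> pi ** B) = X.Phi \<i> pi ** B" unfolding matrix_mul_assoc y by (rule refl)
  then have 1: "T2' ** T2 = T2" unfolding B .
  have "T2 ** (X.Phi \<i> pi ** B') = X.Phi \<i> pi ** B'" unfolding matrix_mul_assoc x by (rule refl)
  then have 2: "T2 ** T2' = T2'" unfolding B' .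
  have "T2 = (T2' ** T2)\<^sup>\<dagger>" unfolding 1 by (simp add: X.T2)
  also have "\<dots> = T2 ** T2'" by (simp add: conj_transpose_mult X.T2 Y.T2)
  finally show T: "T2 = T2'" using 2 by simp
  have "T2 ** X.DPhi \<i> pi = T2' ** X.DPhi \<i> pi" by (rule arg_cong[OF T])
  then have "G2 ** X.Phi \<i> pi = G2' ** X.Phi \<i> pi" unfolding x(2) y(2) .
  then have "G2 ** (X.Phi \<i> pi ** B) = G2' ** (X.Phi \<i> pi ** B)" unfolding matrix_mul_assoc by (rule arg_cong)
  then have "G2 ** T2 = G2' ** T2" unfolding B .
  then show "G2 = G2'" using X.G2 Y.G2 T by simp
qed

end

theorem theorem6p4:
  fixes Q Q' :: "real \<Rightarrow> complex^'m^'m"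
    and T1 T2 G1 G2 T1' T2' G1' G2' :: "complex^'m^'m"
    and lam lam' :: "nat \<Rightarrow> nat \<Rightarrow> real"
    and alpha alpha' :: "nat \<Rightarrow> nat \<Rightarrow> complex^'m^'m"
  assumes "boundary_value_problem Q T1 T2 G1 G2"
    and "boundary_value_problem Q' T1' T2' G1' G2'"
    and "spectral_data Q T1 T2 G1 G2 lam alpha"
    and "spectral_data Q' T1' T2' G1' G2' lam' alpha'"
    and "index_set T1 T2 = index_set T1' T2'"
    and "\<forall>(n, k) \<in> index_set T1 T2. lam n k = lam' n k \<and> alpha n k = alpha' n k"
  shows "(AE x in lebesgue_on {0<..<pi}. Q x = Q' x) \<and>
    T1 = T1' \<and> T2 = T2' \<and> G1 = G1' \<and> G2 = G2'"
proof -
  interpret isospectral Q Q' T1 T2 G1 G2 T1' T2' G1' G2' lam lam' alpha alpha'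
    by unfold_locales (use assms in auto)
  show ?thesis using Q_eq T1_eq T2_G2_eq G1_eq by simp
qed

end
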